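(* Let $\alpha=(1+\sqrt5)/2$. There is an absolute constant $c>0$ such that for every integer $T\ge2$ and all schedules $\eta=(\eta_0,\ldots,\eta_{T-1})\in[0,\infty)^T$ and $\beta=(\beta_0,\ldots,\beta_{T-1})\in[0,1)^T$ there exist a dimension $d\le T+1$, a differentiable convex $1$-smooth Huber-chain objective $f:\mathbb R^d\to\mathbb R$, a minimizer $x^\star$ of $f$, and an initial point $x_0\in\mathbb R^d$ with $\|x_0-x^\star\|_2\le1$, such that the Heavy-Ball iteration $$x_{-1}=x_0,\qquad x_{t+1}=x_t-\eta_t\nabla f(x_t)+\beta_t(x_t-x_{t-1}),\quad t=0,\ldots,T-1,$$ satisfies $$f(x_T)-f(x^\star)\ge\frac{c}{T^\alpha\log T}.$$
   Context: $\log$ is the natural logarithm and norms are Euclidean. $f$ is $1$-smooth if $\|\nabla f(x)-\nabla f(y)\|_2\le\|x-y\|_2$ for all $x,y$. The objective may depend on $T,\eta,\beta$ but is fixed before the run. For $\delta>0$ the one-sided Huber function is $\phi_\delta(z)=0$ for $z\le0$, $\phi_\delta(z)=z^2/2$ for $0\le z\le\delta$, $\phi_\delta(z)=\delta z-\delta^2/2$ for $z\ge\delta$. A Huber-chain objective in dimension $d\ge1$ is a function of the form $$f(x)=\frac14\sum_{i=1}^{d-1}\phi_{\delta_i}(x_i-x_{i+1}-c_i)+\frac12\phi_{\delta_d}(x_d-c_d),\qquad c_i\ge0,\ \delta_i>0,$$ where the sum is empty if $d=1$. *)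

theory Defs
  imports "HOL-Analysis.Analysis" "HOL-Library.Poly_Mapping"
begin

(* The dimension d is existentially quantified after T and the schedules, so it cannot be the
   cardinality of an index type.  Instead R^d is the subspace, supported on the coordinates
   1, ..., d, of the space of finitely supported real sequences, which is made an inner product
   space with the Euclidean inner product; the library norm, has_derivative, convex_on,
   lipschitz_on, etc. then apply, relativised to that subspace. *)

instantiation poly_mapping :: (type, real_inner) real_inner
begin

lift_definition scaleR_poly_mapping :: "real \<Rightarrow> ('a \<Rightarrow>\<^sub>0 'b) \<Rightarrow> 'a \<Rightarrow>\<^sub>0 'b"
  is "\<lambda>r x k. r *\<^sub>R x k"
  by (erule finite_subset [rotated]) auto

definition inner_poly_mapping :: "('a \<Rightarrow>\<^sub>0 'b) \<Rightarrow> ('a \<Rightarrow>\<^sub>0 'b) \<Rightarrow> real"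
  where "inner_poly_mapping x y =
    (\<Sum>k\<in>Poly_Mapping.keys x. Poly_Mapping.lookup x k \<bullet> Poly_Mapping.lookup y k)"

definition norm_poly_mapping :: "('a \<Rightarrow>\<^sub>0 'b) \<Rightarrow> real"
  where "norm_poly_mapping x = sqrt (x \<bullet> x)"

definition sgn_poly_mapping :: "('a \<Rightarrow>\<^sub>0 'b) \<Rightarrow> 'a \<Rightarrow>\<^sub>0 'b"
  where "sgn_poly_mapping x = inverse (norm x) *\<^sub>R x"

definition dist_poly_mapping :: "('a \<Rightarrow>\<^sub>0 'b) \<Rightarrow> ('a \<Rightarrow>\<^sub>0 'b) \<Rightarrow> real"
  where "dist_poly_mapping x y = norm (x - y)"

definition uniformity_poly_mapping :: "(('a \<Rightarrow>\<^sub>0 'b) \<times> ('a \<Rightarrow>\<^sub>0 'b)) filter"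
  where "uniformity_poly_mapping = (INF e\<in>{0<..}. principal {(x, y). dist x y < e})"

definition open_poly_mapping :: "('a \<Rightarrow>\<^sub>0 'b) set \<Rightarrow> bool"
  where "open_poly_mapping U \<longleftrightarrow>
    (\<forall>x\<in>U. eventually (\<lambda>(x', y). x' = x \<longrightarrow> y \<in> U) uniformity)"

lemma inner_poly_mapping_superset:
  fixes x y :: "'a \<Rightarrow>\<^sub>0 'b"
  assumes "finite A" "Poly_Mapping.keys x \<subseteq> A"
  shows "x \<bullet> y = (\<Sum>k\<in>A. Poly_Mapping.lookup x k \<bullet> Poly_Mapping.lookup y k)"
  unfolding inner_poly_mapping_def using assms
  by (intro sum.mono_neutral_left) (auto simp: in_keys_iff)

instance
proof
  fix x y z :: "'a \<Rightarrow>\<^sub>0 'b" and r s :: real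
  let ?A = "Poly_Mapping.keys x \<union> Poly_Mapping.keys y"
  show "r *\<^sub>R (x + y) = r *\<^sub>R x + r *\<^sub>R y"
    by (rule poly_mapping_eqI) (simp add: scaleR_poly_mapping.rep_eq lookup_add scaleR_add_right)
  show "(r + s) *\<^sub>R x = r *\<^sub>R x + s *\<^sub>R x"
    by (rule poly_mapping_eqI) (simp add: scaleR_poly_mapping.rep_eq lookup_add scaleR_add_left)
  show "r *\<^sub>R s *\<^sub>R x = (r * s) *\<^sub>R x"
    by (rule poly_mapping_eqI) (simp add: scaleR_poly_mapping.rep_eq)
  show "1 *\<^sub>R x = x"
    by (rule poly_mapping_eqI) (simp add: scaleR_poly_mapping.rep_eq)
  show "x \<bullet> y = y \<bullet> x"
    by (subst (1 2) inner_poly_mapping_superset [where A = ?A]) (auto simp: inner_commute)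
  show "(x + y) \<bullet> z = x \<bullet> z + y \<bullet> z"
    by (subst (1 2 3) inner_poly_mapping_superset [where A = ?A])
      (auto simp: lookup_add inner_add_left sum.distrib in_keys_iff)
  show "(r *\<^sub>R x) \<bullet> y = r * (x \<bullet> y)"
    by (subst (1 2) inner_poly_mapping_superset [where A = "Poly_Mapping.keys x"])
      (auto simp: scaleR_poly_mapping.rep_eq sum_distrib_left in_keys_iff)
  show "0 \<le> x \<bullet> x"
    unfolding inner_poly_mapping_def by (intro sum_nonneg) simp
  show "x \<bullet> x = 0 \<longleftrightarrow> x = 0"
  proof
    assume "x \<bullet> x = 0"
    then have "Poly_Mapping.lookup x k = 0" for k
      unfolding inner_poly_mapping_def
      by (subst (asm) sum_nonneg_eq_0_iff) (auto simp: in_keys_iff)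
    then show "x = 0"
      by (intro poly_mapping_eqI) simp
  qed (simp add: inner_poly_mapping_def)
qed (simp_all add: norm_poly_mapping_def sgn_poly_mapping_def dist_poly_mapping_def
      uniformity_poly_mapping_def open_poly_mapping_def)

end

definition euclid :: "nat \<Rightarrow> (nat \<Rightarrow>\<^sub>0 real) set"
  where "euclid d = {x. Poly_Mapping.keys x \<subseteq> {1..d}}"

lemma subspace_euclid: "subspace (euclid d)"
  by (auto simp: subspace_def euclid_def in_keys_iff subset_iff lookup_add
      scaleR_poly_mapping.rep_eq) (metis add.right_neutral)+

lemma norm_euclid:
  assumes "x \<in> euclid d"
  shows "norm x = L2_set (Poly_Mapping.lookup x) {1..d}"
proof -
  have "x \<bullet> x = (\<Sum>k\<in>{1..d}. Poly_Mapping.lookup x k \<bullet> Poly_Mapping.lookup x k)"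
    using assms by (intro inner_poly_mapping_superset) (auto simp: euclid_def)
  then show ?thesis
    by (simp add: norm_eq_sqrt_inner L2_set_def power2_eq_square)
qed

definition has_gradient ::
  "nat \<Rightarrow> ((nat \<Rightarrow>\<^sub>0 real) \<Rightarrow> real) \<Rightarrow> (nat \<Rightarrow>\<^sub>0 real) \<Rightarrow> (nat \<Rightarrow>\<^sub>0 real) \<Rightarrow> bool"
  where "has_gradient d f g x \<longleftrightarrow>
    g \<in> euclid d \<and> (f has_derivative (\<lambda>h. g \<bullet> h)) (at x within euclid d)"

definition gradient ::
  "nat \<Rightarrow> ((nat \<Rightarrow>\<^sub>0 real) \<Rightarrow> real) \<Rightarrow> (nat \<Rightarrow>\<^sub>0 real) \<Rightarrow> (nat \<Rightarrow>\<^sub>0 real)"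
  where "gradient d f x = (THE g. has_gradient d f g x)"

lemma has_gradient_unique:
  assumes x: "x \<in> euclid d" and g: "has_gradient d f g x" and g': "has_gradient d f g' x"
  shows "g = g'"
proof -
  have along: "((\<lambda>t. f (x + t *\<^sub>R h)) has_derivative (\<lambda>t. u \<bullet> (t *\<^sub>R h))) (at (0::real))"
    if "has_gradient d f u x" "h \<in> euclid d" for u h
  proof -
    have "(\<lambda>t::real. x + t *\<^sub>R h) ` UNIV \<subseteq> euclid d"
      using x that(2) subspace_euclid by (auto intro: subspace_add subspace_scale)
    then have "(f has_derivative (\<lambda>h. u \<bullet> h))
        (at (x + (0::real) *\<^sub>R h) within (\<lambda>t::real. x + t *\<^sub>R h) ` UNIV)"
      using that(1) by (auto simp: has_gradient_def intro: has_derivative_subset)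
    moreover have "((\<lambda>t::real. x + t *\<^sub>R h) has_derivative (\<lambda>t. t *\<^sub>R h)) (at 0)"
      by (auto intro!: derivative_eq_intros)
    ultimately show ?thesis
      by (rule has_derivative_in_compose [rotated])
  qed
  have "g - g' \<in> euclid d"
    using g g' subspace_euclid by (auto simp: has_gradient_def intro: subspace_diff)
  then have "(\<lambda>t::real. g \<bullet> (t *\<^sub>R (g - g'))) = (\<lambda>t. g' \<bullet> (t *\<^sub>R (g - g')))"
    using along g g' by (blast intro: has_derivative_unique)
  then have "g \<bullet> (1 *\<^sub>R (g - g')) = g' \<bullet> (1 *\<^sub>R (g - g'))"
    by (rule fun_cong)
  then have "(g - g') \<bullet> (g - g') = 0"
    by (simp add: inner_diff_left)
  then show ?thesis
    by simp
qed

lemma gradient_eqI: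
  assumes "x \<in> euclid d" "has_gradient d f g x"
  shows "gradient d f x = g"
  unfolding gradient_def using assms by (blast intro: has_gradient_unique)

definition huber :: "real \<Rightarrow> real \<Rightarrow> real"
  where "huber \<delta> z =
    (if z \<le> 0 then 0 else if z \<le> \<delta> then z\<^sup>2 / 2 else \<delta> * z - \<delta>\<^sup>2 / 2)"

(* f is a total function, but only its values on R^d matter. *)
definition huber_chain_objective :: "nat \<Rightarrow> ((nat \<Rightarrow>\<^sub>0 real) \<Rightarrow> real) \<Rightarrow> bool"
  where "huber_chain_objective d f \<longleftrightarrow>
    d \<ge> 1 \<and>
    (\<exists>c \<delta> :: nat \<Rightarrow> real.
      (\<forall>i\<in>{1..d}. c i \<ge> 0 \<and> \<delta> i > 0) \<and>
      (\<forall>x\<in>euclid d. f x =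
        1 / 4 * (\<Sum>i = 1..<d.
          huber (\<delta> i) (Poly_Mapping.lookup x i - Poly_Mapping.lookup x (i + 1) - c i))
        + 1 / 2 * huber (\<delta> d) (Poly_Mapping.lookup x d - c d)))"

(* Subtraction on nat truncates, so at t = 0 the momentum term uses x (0 - 1) = x 0,
   which is the convention x_{-1} = x_0. *)
fun heavy_ball ::
  "('a::real_vector \<Rightarrow> 'a) \<Rightarrow> (nat \<Rightarrow> real) \<Rightarrow> (nat \<Rightarrow> real) \<Rightarrow> 'a \<Rightarrow> nat \<Rightarrow> 'a"
  where
    "heavy_ball G \<eta> \<beta> x0 0 = x0"
  | "heavy_ball G \<eta> \<beta> x0 (Suc t) =
       heavy_ball G \<eta> \<beta> x0 t - \<eta> t *\<^sub>R G (heavy_ball G \<eta> \<beta> x0 t)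
       + \<beta> t *\<^sub>R (heavy_ball G \<eta> \<beta> x0 t - heavy_ball G \<eta> \<beta> x0 (t - 1))"

end

theory Submission
  imports Defs
begin

text \<open>
  Unroll the momentum: a unit force that acts on a coordinate at time u has moved it by
  resp u t at time t, where resp u t is a sum of products of momentum parameters. Time is
  shifted by one, so that the initial point e_1 is the effect of a unit force on the first
  coordinate at time 0.

  A spring of a Huber chain is silent below its threshold and pulls with constant force once its
  elongation exceeds the threshold by delta. This makes the run controllable. Choose disjoint time
  windows and force levels; spring i is to be silent before its window and saturated during it.
  The velocity which it has then given to the next coordinate must suffice to saturate the next
  spring throughout the next window; this is the predicate chain, and reach q M says that a
  chain whose last window ends at q passes on the velocity M. Up to the horizon H the last
  coordinate coasts over the distance R = M * resp q H, less what the last spring takes back, which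
  is at most delta / 2 * B q. With delta = R / (1 + B q) the final value is at least
  R^2 / (16 (1 + B q)) (reach_lower_bound).

  It remains to find a chain for which U R^2 > 1 + B q, where U is of the order of
  T powr alpha * ln T. Suppose that there is none (bounded_gain), and let travel q be the
  supremum of R over the chains that end at q. Then U (travel q)^2 <= 1 + B q, and travel 0 >= 1
  forces B 0, the total weight of the schedule, to be large. Two arguments bound that weight.

  First, consider the steps of bounded size. Appending a window to a chain is always possible and
  changes travel by an explicit factor. On a stretch where the best available velocity does not
  grow, this makes the accumulated step size almost concave at every scale, and a Gronwall argument
  from both sides with a telescoping sum of chord defects bounds it by 100000 sqrt N on N steps
  (staircase_total). Hence the bounded steps between p and q weigh at most a polylogarithmic
  factor times (q - p) powr (3/2), unless the velocity is pumped up by a polynomial factor in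
  between, which is an even larger gain (slow_or_pump).

  Second, consider the large steps, the atoms. A chain through a set Q of atoms gains at least
  the product over Q of the atom divided by the weight of what lies in the window before it
  (atoms_gain). Sort the atoms by weight, and let the k heaviest be the first ones behind which
  less than Omega * k powr (-3/5) is left. Then the i-th of them dominates, in the sense of
  majorisation, a constant times (k / i) powr (8/5), and the geometric mean of these numbers
  exceeds the mean weight of the windows because exp (8/5) * (3/5) > 2 with room to spare
  (balanced_gain). So the product exceeds 1, and B is at most U / 2 behind that chain: a
  contradiction as soon as U is a large multiple of T powr (8/5) times a power of a logarithm
  (no_atoms_without_gain, large_gain_contradiction). The golden ratio exceeds 8/5, which
  pays for the logarithms.
\<close>

section \<open>Mass of a slow stretch\<close>

text \<open>
  Young's inequality for the exponent s and its conjugate, applied to 1 + s x and 1.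
\<close>

lemma Bernoulli_powr:
  fixes x s :: real
  assumes "-1 < x" "1 \<le> s"
  shows "1 + s * x \<le> (1 + x) powr s"
proof (cases "1 + s * x > 0")
  case True
  let ?u = "1 + s * x"
  have "?u powr (1/s) * 1 powr (1 - 1/s) \<le> (1/s) * ?u + (1 - 1/s) * 1"
    using assms True by (intro Youngs_inequality_0) auto
  also have "\<dots> = 1 + x" using assms by (simp add: field_simps)
  finally have "?u powr (1/s) \<le> 1 + x" by simp
  then have "(?u powr (1/s)) powr s \<le> (1 + x) powr s" using assms by (intro powr_mono2) auto
  then show ?thesis using assms True by (simp add: powr_powr)
next
  case False
  then show ?thesis using powr_ge_zero[of "1 + x" s] by linarith
qed

text \<open>
  A slow stretch of N steps, stripped of its dynamics: w j is the damping since the beginning of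
  the stretch, Z the accumulated step size in units of w, and l the logarithm of the largest
  velocity available so far, relative to the damping. The stretch is so short that l increases by
  at most xi, and xi * ln N is so small that powers with exponent of order xi are bounded.
\<close>

locale staircase =
  fixes N :: nat and w Z l :: "nat \<Rightarrow> real" and \<xi> :: real
  assumes N1: "N \<ge> 1"
    and w_le: "\<And>j. w j \<le> 1" and w_ge: "\<And>j. 1/3 \<le> w j" and w_anti: "\<And>i j. i \<le> j \<Longrightarrow> w j \<le> w i"
    and Z0: "Z 0 = 0" and Z_mono: "\<And>i j. i \<le> j \<Longrightarrow> Z i \<le> Z j"
    and l_mono: "\<And>i j. i \<le> j \<Longrightarrow> l i \<le> l j"
    and l_tot: "l N - l 0 \<le> \<xi>" and xi_pos: "0 < \<xi>" and xi_le: "\<xi> \<le> 1/20"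
    and xi_ln: "\<xi> * ln (3 * real N) \<le> 1/20"
begin

definition tau :: "nat \<Rightarrow> real" where "tau n = (\<Sum>j<n. w j)"

definition area :: "nat \<Rightarrow> nat \<Rightarrow> real" where "area p q = (\<Sum>j\<in>{p..<q}. (Z j - Z p) * w j)"

lemma w_pos: "0 < w j" using w_ge[of j] by linarith

lemma tau_Suc: "tau (Suc n) = tau n + w n" by (simp add: tau_def)

lemma tau_diff: "p \<le> q \<Longrightarrow> tau q - tau p = (\<Sum>j\<in>{p..<q}. w j)"
  by (induction q rule: dec_induct) (auto simp: tau_Suc)

lemma tau_diff_le: assumes "p \<le> q" shows "tau q - tau p \<le> real (q - p)"
proof -
  have "(\<Sum>j\<in>{p..<q}. w j) \<le> (\<Sum>j\<in>{p..<q}. 1)" by (rule sum_mono) (simp add: w_le)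
  then show ?thesis using assms by (simp add: tau_diff)
qed

lemma tau_diff_ge: assumes "p \<le> q" shows "real (q - p) / 3 \<le> tau q - tau p"
proof -
  have "(\<Sum>j\<in>{p..<q}. 1/3) \<le> (\<Sum>j\<in>{p..<q}. w j)" by (rule sum_mono) (rule w_ge)
  then show ?thesis using assms by (simp add: tau_diff)
qed

lemma tau_less: "p < q \<Longrightarrow> tau p < tau q"
  using tau_diff_ge[of p q] by (simp add: less_imp_le)

lemma area_Suc: "p \<le> q \<Longrightarrow> area p (Suc q) = area p q + (Z q - Z p) * w q"
  by (simp add: area_def)

lemma area_nonneg: "0 \<le> area p q"
  unfolding area_def using Z_mono w_pos by (intro sum_nonneg mult_nonneg_nonneg) (auto simp: less_imp_le)

lemma exp_xi: "exp \<xi> \<le> 106/100" "exp \<xi> \<le> 1 + \<xi> * 105/100" "1 \<le> exp \<xi>"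
proof -
  have a: "exp \<xi> \<le> 1 + \<xi> + \<xi>\<^sup>2" using xi_pos xi_le by (intro exp_bound) auto
  have b: "\<xi>\<^sup>2 \<le> \<xi> * (1/20)" unfolding power2_eq_square using xi_pos xi_le by (intro mult_left_mono) auto
  show "exp \<xi> \<le> 106/100" using a b xi_le by linarith
  show "exp \<xi> \<le> 1 + \<xi> * 105/100" using a b xi_le by linarith
  show "1 \<le> exp \<xi>" using xi_pos by simp
qed

lemma pow_small:
  assumes "0 \<le> c" "c \<le> 21/10 * \<xi>" "1 \<le> X" "X \<le> 3 * real N"
  shows "X powr c \<le> 113/100"
proof -
  have "c * ln X \<le> (21/10 * \<xi>) * ln (3 * real N)"
    using assms N1 xi_pos by (intro mult_mono) auto
  also have "\<dots> \<le> 105/1000" using xi_ln by linarith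
  finally have "X powr c \<le> exp (105/1000)" using assms by (simp add: powr_def)
  also have "\<dots> \<le> 1 + 105/1000 + (105/1000)\<^sup>2" by (rule exp_bound) auto
  also have "\<dots> \<le> 113/100" by (simp add: power2_eq_square)
  finally show ?thesis .
qed

lemma l_diff: assumes "p \<le> q" "q \<le> N" shows "0 \<le> l q - l p" "l q - l p \<le> \<xi>"
  using l_mono[OF assms(1)] l_mono[OF assms(2)] l_mono[of 0 p] l_tot by auto

end

text \<open>
  Between p and q a window of a chain can start; it multiplies the velocity by about
  (Z q - Z p) * (tau q - tau p) / (2 * area p q + 8), the rectangle over twice the area below the
  graph of Z, and l records that this factor is available. So wherever Z rises by 40, at least
  about half of the rectangle lies below the graph.
\<close>

locale staircase_edge = staircase +
  assumes edge: "\<And>p q. p < q \<Longrightarrow> q \<le> N \<Longrightarrow> Z q - Z p \<ge> 40 \<Longrightarrow>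
    (Z q - Z p) * (tau q - tau p) \<le> exp (l q - l p) * (2 * area p q + 8)"
begin

lemma edge_xi:
  assumes "p < q" "q \<le> N" "Z q - Z p \<ge> 40"
  shows "(Z q - Z p) * (tau q - tau p) \<le> 2 * exp \<xi> * (area p q + 4)"
proof -
  have "exp (l q - l p) * (2 * area p q + 8) \<le> exp \<xi> * (2 * area p q + 8)"
    using l_diff[of p q] assms area_nonneg[of p q] by (intro mult_right_mono) auto
  then show ?thesis using edge[OF assms] by (simp add: algebra_simps)
qed

text \<open>
  A single jump has no area below it, so a jump of 40 violates the edge inequality.
\<close>

lemma step_lt: assumes "u < N" shows "Z (Suc u) - Z u < 40"
proof (rule ccontr)
  assume "\<not> ?thesis"
  then have z: "Z (Suc u) - Z u \<ge> 40" by simp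
  have a: "area u (Suc u) = 0" by (simp add: area_def)
  have "(Z (Suc u) - Z u) * w u \<le> 2 * exp \<xi> * 4" using edge_xi[of u "Suc u"] assms z a by (simp add: tau_Suc)
  moreover have "40 * (1/3) \<le> (Z (Suc u) - Z u) * w u" using z w_ge by (intro mult_mono) auto
  ultimately show False using exp_xi(1) by linarith
qed

lemma mass_le: assumes "p \<le> q" "q \<le> N" shows "Z q - Z p \<le> 40 * real (q - p)"
  using assms
proof (induction q rule: dec_induct)
  case (step q)
  then show ?case using step_lt[of q] by (simp add: of_nat_diff)
qed simp

text \<open>
  A discrete Gronwall argument: by the edge inequality the relative growth of the area when q moves
  to the right is at most 2 * exp xi times that of the base. So the area grows at most like the
  power 2 * exp xi of the base, which is almost the square.
\<close>

lemma forward_growth: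
  assumes "p < q0" "q0 \<le> q" "q \<le> N" "Z q0 - Z p \<ge> 40"
  shows "area p q + 4 \<le> (area p q0 + 4) * ((tau q - tau p) / (tau q0 - tau p)) powr (2 * exp \<xi>)"
  using assms(2,3)
proof (induction q rule: dec_induct)
  case base
  then show ?case using tau_less[OF assms(1)] by simp
next
  case (step q)
  let ?s = "2 * exp \<xi>"
  have pq: "p < q" using step assms(1) by simp
  have w0: "0 < tau q0 - tau p" "0 < tau q - tau p" using tau_less[of p q0] tau_less[of p q] assms(1) pq by auto
  have z: "Z q - Z p \<ge> 40" using assms(4) Z_mono[of q0 q] step by simp
  have e: "(Z q - Z p) \<le> ?s * (area p q + 4) / (tau q - tau p)"
    using edge_xi[OF pq _ z] step w0 by (simp add: field_simps)
  have "area p (Suc q) + 4 = area p q + 4 + (Z q - Z p) * w q" using pq by (simp add: area_Suc)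
  also have "\<dots> \<le> area p q + 4 + ?s * (area p q + 4) / (tau q - tau p) * w q"
    using e w_pos[of q] by (intro add_left_mono mult_right_mono) auto
  also have "\<dots> = (area p q + 4) * (1 + ?s * (w q / (tau q - tau p)))" by (simp add: field_simps)
  also have "\<dots> \<le> (area p q + 4) * (1 + w q / (tau q - tau p)) powr ?s"
  proof (rule mult_left_mono)
    have "1 + ?s * (w q / (tau q - tau p)) \<le> (1 + w q / (tau q - tau p)) powr ?s"
    proof (rule Bernoulli_powr)
      have "0 < w q / (tau q - tau p)" using w_pos[of q] w0 by simp
      then show "-1 < w q / (tau q - tau p)" by linarith
      show "1 \<le> ?s" using exp_xi(3) by linarith
    qed
    then show "1 + ?s * (w q / (tau q - tau p)) \<le> (1 + w q / (tau q - tau p)) powr ?s" .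
  qed (use area_nonneg[of p q] in auto)
  also have "\<dots> \<le> ((area p q0 + 4) * ((tau q - tau p) / (tau q0 - tau p)) powr ?s) * (1 + w q / (tau q - tau p)) powr ?s"
    using step by (intro mult_right_mono) auto
  also have "\<dots> = (area p q0 + 4) * (((tau q - tau p) / (tau q0 - tau p)) * (1 + w q / (tau q - tau p))) powr ?s"
    using w0 w_pos[of q] by (subst powr_mult) (auto simp: mult.assoc)
  also have "((tau q - tau p) / (tau q0 - tau p)) * (1 + w q / (tau q - tau p)) = (tau (Suc q) - tau p) / (tau q0 - tau p)"
  proof -
    have "a / b * (1 + c / a) = (a + c) / b" if "a \<noteq> 0" for a b c :: real
      using that by (simp add: distrib_left add_divide_distrib)
    from this[of "tau q - tau p" "tau q0 - tau p" "w q"] w0 show ?thesis by (simp add: tau_Suc add_diff_eq diff_add_eq)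
  qed
  finally show ?case .
qed

text \<open>
  While Z stays within 40 of Z p the area is linear in the length m; afterwards it grows at most
  quadratically, and Z N - Z p is bounded by area over length.
\<close>

lemma quiet_then_light:
  assumes "p < q0" "q0 \<le> N" "Z q0 - Z p \<ge> 40" "\<And>j. p \<le> j \<Longrightarrow> j < q0 \<Longrightarrow> Z j - Z p < 40" "m \<ge> 1" "p + m \<le> q0"
  shows "(Z N - Z p) * real m \<le> 400 * real N"
proof -
  let ?s = "2 * exp \<xi>"
  define w0 where "w0 = tau q0 - tau p"
  define wN where "wN = tau N - tau p"
  define X where "X = wN / w0"
  have w0m: "real m / 3 \<le> w0" using tau_diff_ge[of p q0] assms unfolding w0_def by (smt (verit) add_leD1 le_diff_conv2 of_nat_mono divide_right_mono add.commute)
  then have w0: "1/3 \<le> w0" "0 < w0" using assms(5) by linarith+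
  have "0 \<le> tau N - tau q0" using tau_diff_ge[of q0 N] assms(2) by (smt (verit) of_nat_0_le_iff divide_nonneg_nonneg)
  then have wNw: "w0 \<le> wN" unfolding w0_def wN_def by simp
  have X1: "1 \<le> X" unfolding X_def using wNw w0 by simp
  have wN: "wN \<le> real N" "0 < wN" using tau_diff_le[of p N] assms wNw w0 unfolding wN_def by auto
  have XN: "X * real m \<le> 3 * real N"
  proof -
    have "X * real m \<le> X * (3 * w0)" using w0m X1 by (intro mult_left_mono) auto
    also have "\<dots> = 3 * wN" using w0 by (simp add: X_def)
    finally show ?thesis using wN by linarith
  qed
  have "X * 1 \<le> X * real m" using X1 assms(5) by (intro mult_left_mono) auto
  then have X3: "X \<le> 3 * real N" using XN by linarith
  have a0: "area p q0 \<le> 40 * w0"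
  proof -
    have "area p q0 \<le> (\<Sum>j\<in>{p..<q0}. 40 * w j)" unfolding area_def
      using assms(4) w_pos by (intro sum_mono mult_right_mono) (auto simp: less_imp_le)
    then show ?thesis unfolding w0_def using assms(1) by (simp add: tau_diff sum_distrib_left)
  qed
  have zN: "Z N - Z p \<ge> 40" using assms(3) Z_mono[OF assms(2)] by simp
  have "(Z N - Z p) * wN \<le> ?s * (area p N + 4)" unfolding wN_def using edge_xi[of p N] assms zN by simp
  also have "\<dots> \<le> ?s * ((area p q0 + 4) * X powr ?s)"
    using forward_growth[of p q0 N] assms unfolding X_def wN_def w0_def by (intro mult_left_mono) auto
  also have "\<dots> \<le> ?s * ((52 * w0) * X powr ?s)"
    using a0 w0 by (intro mult_left_mono mult_right_mono) auto
  also have "X powr ?s = X * X * X powr (2 * (exp \<xi> - 1))"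
  proof -
    have "X powr ?s = X powr (2 + 2 * (exp \<xi> - 1))" by (simp add: algebra_simps)
    also have "\<dots> = X powr 2 * X powr (2 * (exp \<xi> - 1))" by (rule powr_add)
    finally show ?thesis using X1 by (simp add: powr_numeral power2_eq_square)
  qed
  also have "?s * ((52 * w0) * (X * X * X powr (2 * (exp \<xi> - 1)))) \<le> (212/100) * ((52 * w0) * (X * X * (113/100)))"
  proof -
    have "X powr (2 * (exp \<xi> - 1)) \<le> 113/100" using exp_xi X1 X3 by (intro pow_small) auto
    then show ?thesis using exp_xi w0 X1 by (intro mult_mono) auto
  qed
  also have "\<dots> \<le> 125 * (X * wN)" using w0 X1 wN unfolding X_def by (simp add: field_simps)
  finally have "Z N - Z p \<le> 125 * X" using wN by (simp add: mult.assoc[symmetric])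
  then have "(Z N - Z p) * real m \<le> 125 * X * real m" by (intro mult_right_mono) auto
  then show ?thesis using XN by linarith
qed

text \<open>
  The area above the graph, seen from the right end.
\<close>

definition bk :: "nat \<Rightarrow> nat \<Rightarrow> real" where "bk q p = (\<Sum>j\<in>{p..<q}. (Z q - Z j) * w j)"

lemma bk_Suc: "p < q \<Longrightarrow> bk q p = bk q (Suc p) + (Z q - Z p) * w p"
  unfolding bk_def by (simp add: sum.atLeast_Suc_lessThan)

lemma area_bk: assumes "p \<le> q" shows "area p q = (Z q - Z p) * (tau q - tau p) - bk q p"
  unfolding area_def bk_def tau_diff[OF assms] sum_distrib_left sum_subtractf[symmetric]
  by (intro sum.cong) (auto simp: algebra_simps)

lemma bk_edge:
  assumes "p < q" "q \<le> N" "Z q - Z p \<ge> 40"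
  shows "2 * bk q p - 8 \<le> (1 + \<xi>) * ((Z q - Z p) * (tau q - tau p))"
proof -
  let ?D = "l q - l p" and ?zy = "(Z q - Z p) * (tau q - tau p)"
  have zy: "0 \<le> ?zy" using assms tau_less[of p q] by (intro mult_nonneg_nonneg) auto
  have "exp (- ?D) * ?zy \<le> exp (- ?D) * (exp ?D * (2 * area p q + 8))"
    using edge[OF assms] by (intro mult_left_mono) auto
  also have "\<dots> = 2 * area p q + 8" by (simp only: mult.assoc[symmetric] exp_add[symmetric]) simp
  finally have a: "exp (- ?D) * ?zy \<le> 2 * ?zy - 2 * bk q p + 8" using assms by (simp add: area_bk algebra_simps)
  have "1 - \<xi> \<le> exp (- ?D)"
  proof -
    have "1 + (- ?D) \<le> exp (- ?D)" by (rule exp_ge_add_one_self)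
    moreover have "?D \<le> \<xi>" using l_diff(2)[of p q] assms by simp
    ultimately show ?thesis by linarith
  qed
  then have "(1 - \<xi>) * ?zy \<le> exp (- ?D) * ?zy" using zy by (intro mult_right_mono) auto
  then show ?thesis using a by (simp add: algebra_simps)
qed

text \<open>
  The mirror image of forward_growth. Seen from q, the edge inequality is an upper bound for the area
  above the graph, so that this area grows at least like the power 2 / (1 + xi) of the base.
\<close>

lemma backward_growth:
  assumes "p' \<le> p" "p < q" "q \<le> N" "Z q - Z p \<ge> 40" "4 \<le> bk q p"
  shows "(bk q p - 4) * ((tau q - tau p') / (tau q - tau p)) powr (2 / (1 + \<xi>)) \<le> bk q p' - 4"
  using assms(1)
proof (induction p' rule: inc_induct)
  case base
  then show ?case using tau_less[OF assms(2)] by simp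
next
  case (step p')
  let ?s = "2 / (1 + \<xi>)"
  have s1: "1 \<le> ?s" using xi_pos xi_le by simp
  have pq: "p' < q" "Suc p' < q" using step assms(2) by auto
  have y: "0 < tau q - tau p" "0 < tau q - tau (Suc p')" "0 < tau q - tau p'" using tau_less assms(2) pq by auto
  have z: "Z q - Z p' \<ge> 40" using assms(4) Z_mono[of p' p] step by simp
  define x where "x = w p' / (tau q - tau p')"
  have x: "0 \<le> x" "1 - x = (tau q - tau (Suc p')) / (tau q - tau p')" "x < 1"
    using y w_pos[of p'] by (auto simp: x_def field_simps tau_Suc)
  have "0 \<le> (bk q p - 4) * ((tau q - tau (Suc p')) / (tau q - tau p)) powr ?s" using assms(5) by (intro mult_nonneg_nonneg) auto
  then have I4: "0 \<le> bk q (Suc p') - 4" using step.IH by linarith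
  have bS: "bk q p' = bk q (Suc p') + (Z q - Z p') * w p'" using bk_Suc pq by simp
  have I4': "0 \<le> bk q p' - 4" using bS I4 z w_pos[of p'] by (smt (verit) mult_nonneg_nonneg)
  have "?s * (bk q p' - 4) \<le> (Z q - Z p') * (tau q - tau p')"
    using bk_edge[OF pq(1) assms(3) z] xi_pos by (simp add: field_simps)
  then have "?s * (bk q p' - 4) * x \<le> (Z q - Z p') * w p'"
  proof -
    assume a: "?s * (bk q p' - 4) \<le> (Z q - Z p') * (tau q - tau p')"
    have "?s * (bk q p' - 4) * x \<le> (Z q - Z p') * (tau q - tau p') * x" using a x(1) by (rule mult_right_mono)
    also have "\<dots> = (Z q - Z p') * w p'" using y by (simp add: x_def)
    finally show ?thesis .
  qed
  then have "bk q (Suc p') - 4 \<le> (bk q p' - 4) - ?s * (bk q p' - 4) * x" using bS by linarith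
  also have "\<dots> = (bk q p' - 4) * (1 - ?s * x)" by (simp only: algebra_simps)
  finally have "bk q (Suc p') - 4 \<le> (bk q p' - 4) * (1 - ?s * x)" .
  also have "(bk q p' - 4) * (1 - ?s * x) \<le> (bk q p' - 4) * (1 - x) powr ?s"
    using I4' Bernoulli_powr[of "-x" ?s] x s1 by (intro mult_left_mono) auto
  finally have c: "bk q (Suc p') - 4 \<le> (bk q p' - 4) * (1 - x) powr ?s" .
  have pp: "0 < (1 - x) powr ?s" using x(3) by simp
  have "(bk q p - 4) * ((tau q - tau p') / (tau q - tau p)) powr ?s * (1 - x) powr ?s
      = (bk q p - 4) * ((tau q - tau (Suc p')) / (tau q - tau p)) powr ?s"
  proof -
    have "((tau q - tau p') / (tau q - tau p)) powr ?s * (1 - x) powr ?s = (((tau q - tau p') / (tau q - tau p)) * (1 - x)) powr ?s"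
      by (rule powr_mult[symmetric])
    also have "((tau q - tau p') / (tau q - tau p)) * (1 - x) = (tau q - tau (Suc p')) / (tau q - tau p)"
      unfolding x(2) using y by simp
    finally show ?thesis by (simp add: mult.assoc)
  qed
  then have "(bk q p - 4) * ((tau q - tau p') / (tau q - tau p)) powr ?s * (1 - x) powr ?s \<le> (bk q p' - 4) * (1 - x) powr ?s"
    using step.IH c by linarith
  then show ?case using pp by simp
qed

text \<open>
  A rise on [p, p + n] far above average would, by backward growth from p + n down to 0, create more area
  above the graph than the rectangle with height Z N has.
\<close>

lemma burst_le_average:
  assumes "n \<ge> 1" "6 * n \<le> p" "p + n \<le> N" "Z (p + n) - Z p \<ge> 40"
  shows "(Z (p + n) - Z p) * real p \<le> 100 * Z N * real n"
proof -
  let ?s = "2 / (1 + \<xi>)"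
  define q where "q = p + n"
  define z where "z = Z q - Z p"
  define y where "y = tau q - tau (p - n)"
  define r where "r = tau q / y"
  have z40: "40 \<le> z" using assms(4) by (simp add: z_def q_def)
  have pnq: "p - n < q" "q \<le> N" using assms by (auto simp: q_def)
  have y: "0 < y" "y \<le> 2 * real n" using tau_less[OF pnq(1)] tau_diff_le[of "p - n" q] assms by (auto simp: y_def q_def)
  have zpn: "Z q - Z (p - n) \<ge> z" using Z_mono[of "p - n" p] by (simp add: z_def)
  have I: "z * real n / 3 \<le> bk q (p - n)"
  proof -
    have "(\<Sum>j\<in>{p-n..<p}. z * (1/3)) \<le> (\<Sum>j\<in>{p-n..<p}. (Z q - Z j) * w j)"
    proof (intro sum_mono mult_mono)
      fix j assume "j \<in> {p-n..<p}"
      then have "Z j \<le> Z p" by (intro Z_mono) auto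
      then show "z \<le> Z q - Z j" "0 \<le> Z q - Z j" using z40 by (auto simp: z_def)
      show "1/3 \<le> w j" by (rule w_ge)
    qed auto
    also have "\<dots> \<le> bk q (p - n)" unfolding bk_def
    proof (rule sum_mono2)
      fix j assume j: "j \<in> {p - n..<q} - {p - n..<p}"
      then have "Z j \<le> Z q" by (intro Z_mono) auto
      then show "0 \<le> (Z q - Z j) * w j" using w_pos[of j] by simp
    qed (auto simp: q_def)
    finally show ?thesis using assms(1,2) by (simp add: mult.commute)
  qed
  have zn: "40 * 1 \<le> z * real n" using z40 assms(1) by (intro mult_mono) auto
  have I2: "z * real n / 6 \<le> bk q (p - n) - 4" "4 \<le> bk q (p - n)" using I zn by auto
  have t0: "tau 0 = 0" by (simp add: tau_def)
  have g: "(bk q (p - n) - 4) * r powr ?s \<le> bk q 0 - 4"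
    using backward_growth[of 0 "p - n" q] pnq zpn z40 I2 unfolding r_def y_def t0 by simp
  have bk0: "bk q 0 \<le> Z N * tau q"
  proof -
    have "bk q 0 \<le> (\<Sum>j\<in>{0..<q}. Z N * w j)" unfolding bk_def
    proof (intro sum_mono mult_right_mono)
      fix j show "Z q - Z j \<le> Z N" using Z_mono[OF pnq(2)] Z_mono[of 0 j] Z0 by simp
      show "0 \<le> w j" using w_pos[of j] by simp
    qed
    then show ?thesis by (simp add: tau_def sum_distrib_left lessThan_atLeast0)
  qed
  have tq: "real p / 3 \<le> tau q" "tau q \<le> real N"
    using tau_diff_ge[of 0 q] tau_diff_le[of 0 q] pnq t0 by (auto simp: q_def)
  have "2 * real n \<le> real p / 3" using assms(2) by linarith
  then have yq: "y \<le> tau q" using y tq by linarith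
  have r1: "1 \<le> r" unfolding r_def using yq y by simp
  have "real (q - (p - n)) / 3 \<le> y" using tau_diff_ge[of "p - n" q] pnq by (simp add: y_def)
  moreover have "1 \<le> real (q - (p - n))" using pnq by simp
  ultimately have y3: "1/3 \<le> y" by linarith
  have "real N * (1/3) \<le> real N * y" using y3 by (intro mult_left_mono) auto
  then have r3: "r \<le> 3 * real N" unfolding r_def using y tq by (simp add: field_simps)
  have s: "2 - ?s \<le> 21/10 * \<xi>" "0 \<le> 2 - ?s" using xi_pos xi_le by (auto simp: field_simps)
  have rs: "r * r \<le> r powr ?s * (113/100)"
  proof -
    have "r * r = r powr ?s * r powr (2 - ?s)" using r1 by (simp add: powr_add[symmetric] powr_numeral power2_eq_square)
    also have "\<dots> \<le> r powr ?s * (113/100)" using pow_small[OF s(2) s(1) r1 r3] by (intro mult_left_mono) auto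
    finally show ?thesis .
  qed
  have "(z * real n / 6) * (r * r) \<le> (z * real n / 6) * (r powr ?s * (113/100))"
    using rs z40 by (intro mult_left_mono) auto
  also have "\<dots> \<le> (bk q (p-n) - 4) * (r powr ?s * (113/100))" using I2 by (intro mult_right_mono) auto
  also have "\<dots> \<le> (Z N * tau q) * (113/100)" using g bk0 by linarith
  finally have "(z * real n / 6) * (r * r) \<le> Z N * (r * y) * (113/100)" using y by (simp add: r_def)
  then have "((z * real n / 6) * r) * r \<le> (Z N * y * (113/100)) * r" by (simp add: algebra_simps)
  then have "(z * real n / 6) * r \<le> Z N * y * (113/100)" using r1 by (subst (asm) mult_le_cancel_right) linarith
  also have "\<dots> \<le> Z N * (2 * real n) * (113/100)" using y Z_mono[of 0 N] Z0 by (intro mult_right_mono mult_left_mono) auto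
  finally have "z * r \<le> 14 * Z N" using assms(1) Z_mono[of 0 N] Z0 by (simp add: field_simps)
  then have "z * r * y \<le> 14 * Z N * y" using y by (intro mult_right_mono) auto
  then have "z * tau q \<le> 14 * Z N * y" using y by (simp add: r_def)
  moreover have "z * (real p / 3) \<le> z * tau q" using tq z40 by (intro mult_left_mono) auto
  moreover have "14 * Z N * y \<le> 14 * Z N * (2 * real n)" using y Z_mono[of 0 N] Z0 by (intro mult_left_mono) auto
  ultimately have "z * real p \<le> 84 * Z N * real n" by linarith
  also have "\<dots> \<le> 100 * Z N * real n" using Z_mono[of 0 N] Z0 by (intro mult_right_mono) auto
  finally show ?thesis by (simp add: z_def q_def)
qed

lemma telescope_shift:
  fixes g :: "nat \<Rightarrow> real"
  assumes "a \<le> b"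
  shows "(\<Sum>p\<in>{a..<b}. g (p + n) - g p) = (\<Sum>m<n. g (b + m) - g (a + m))"
proof -
  have t: "(\<Sum>p\<in>{a..<b}. g (p + Suc k) - g (p + k)) = g (b + k) - g (a + k)" for k
    using sum_Suc_diff'[OF assms, of "\<lambda>p. g (p + k)"] by simp
  have "(\<Sum>p\<in>{a..<b}. g (p + n) - g p) = (\<Sum>p\<in>{a..<b}. \<Sum>m<n. g (p + Suc m) - g (p + m))"
    using sum_lessThan_telescope[of "\<lambda>m. g (p + m)" n for p] by simp
  also have "\<dots> = (\<Sum>m<n. \<Sum>p\<in>{a..<b}. g (p + Suc m) - g (p + m))" by (rule sum.swap)
  finally show ?thesis by (simp only: t)
qed

text \<open>
  The left-hand side measures how far the graph over a window of length n stays below its chord.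
  Since Z increases and w decreases, Chebyshev's sum inequality bounds the area by its value for
  constant w; the edge inequality then says that the defect is small when l hardly grows.
\<close>

lemma window_defect_le:
  assumes "n \<ge> 1" "p + n \<le> N" "Z (p + n) - Z p \<ge> 40"
  shows "Z (p + n) + Z p - 2 / real n * (\<Sum>i<n. Z (p + i))
    \<le> (Z (p + n) - Z p) * (l (p + n) - l p) + 24 / real n"
proof -
  let ?z = "Z (p + n) - Z p" and ?D = "l (p + n) - l p"
  define y where "y = tau (p + n) - tau p"
  have y: "real n / 3 \<le> y" "0 < y" using tau_diff_ge[of p "p + n"] tau_less[of p "p + n"] assms by (auto simp: y_def)
  have "area p (p + n) = (\<Sum>i<n. (Z (p + i) - Z p) * w (p + i))"
    unfolding area_def using sum.shift_bounds_nat_ivl[of "\<lambda>j. (Z j - Z p) * w j" 0 p n]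
    by (simp add: lessThan_atLeast0 add.commute)
  moreover have "y = (\<Sum>i<n. w (p + i))"
    unfolding y_def using sum.shift_bounds_nat_ivl[of w 0 p n]
    by (simp add: tau_diff lessThan_atLeast0 add.commute)
  moreover have "real n * (\<Sum>i\<in>{0..<n}. (Z (p + i) - Z p) * w (p + i)) \<le> (\<Sum>i\<in>{0..<n}. Z (p + i) - Z p) * (\<Sum>i\<in>{0..<n}. w (p + i))"
    using Z_mono w_anti by (intro Chebyshev_sum_upper) auto
  ultimately have "real n * area p (p + n) \<le> (\<Sum>i<n. Z (p + i) - Z p) * y" by (simp add: lessThan_atLeast0)
  then have "real n * area p (p + n) \<le> ((\<Sum>i<n. Z (p + i)) - real n * Z p) * y" by (simp add: sum_subtractf)
  then have a: "2 * area p (p + n) / y \<le> 2 / real n * (\<Sum>i<n. Z (p + i)) - 2 * Z p"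
    using assms(1) y by (simp add: field_simps)
  have zy: "0 \<le> ?z * y" using assms y by (intro mult_nonneg_nonneg) auto
  have "exp (- ?D) * (?z * y) \<le> exp (- ?D) * (exp ?D * (2 * area p (p + n) + 8))"
    using edge[of p "p + n"] assms unfolding y_def by (intro mult_left_mono) auto
  also have "\<dots> = 2 * area p (p + n) + 8" by (simp only: mult.assoc[symmetric] exp_add[symmetric]) simp
  finally have b: "exp (- ?D) * (?z * y) \<le> 2 * area p (p + n) + 8" .
  have "1 + (- ?D) \<le> exp (- ?D)" by (rule exp_ge_add_one_self)
  then have "(1 - ?D) * (?z * y) \<le> exp (- ?D) * (?z * y)" using zy by (intro mult_right_mono) linarith+
  then have "((1 - ?D) * ?z) * y \<le> 2 * area p (p + n) + 8" using b by (simp add: mult.assoc)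
  then have "(1 - ?D) * ?z \<le> 2 * area p (p + n) / y + 8 / y" using y by (simp add: field_simps)
  moreover have "8 / y \<le> 24 / real n" using y assms(1) by (simp add: field_simps)
  ultimately have "(1 - ?D) * ?z \<le> 2 / real n * (\<Sum>i<n. Z (p + i)) - 2 * Z p + 24 / real n" using a by linarith
  then show ?thesis by (simp add: algebra_simps)
qed

lemma sum_centered: "(\<Sum>m<k. (2 * real m + 2 - c) * (G (Suc m) - G m)) = (2 * real k - c) * G k + c * G 0 - 2 * (\<Sum>i<k. G i)"
  for G :: "nat \<Rightarrow> real"
  by (induction k) (auto simp: algebra_simps)

lemma sum_weights: "(\<Sum>m<n. 2 * real m + 2 - real n) = real n"
proof -
  have "(\<Sum>m<k. 2 * real m + 2 - c) = real k * (real k - 1) + 2 * real k - c * real k" for k and c :: real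
    by (induction k) (auto simp: algebra_simps)
  from this[where k = n and c = "real n"] show ?thesis by (simp add: algebra_simps)
qed

text \<open>
  Summed over all starting points, the defects telescope. The increments of the sum over p receive the
  weights 2 m + 2 - n, whose sum is n, and the weights increase with m just as Z does.
\<close>

lemma defect_sum_ge:
  assumes "n \<ge> 1" "a \<le> b"
  shows "(\<Sum>p\<in>{a..<b}. Z (p + n) + Z p - 2 / real n * (\<Sum>i<n. Z (p + i)))
    \<ge> Z b - Z a - real n * (Z (a + n) - Z a)"
proof -
  define G where "G i = (\<Sum>p\<in>{a..<b}. Z (p + i))" for i
  define c where "c m = 2 * real m + 2 - real n" for m
  have Gd: "G (Suc m) - G m = Z (b + m) - Z (a + m)" for m
    unfolding G_def sum_subtractf[symmetric] using sum_Suc_diff'[OF assms(2), of "\<lambda>p. Z (p + m)"] by simp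
  have swap: "(\<Sum>p\<in>{a..<b}. \<Sum>i<n. Z (p + i)) = (\<Sum>i<n. G i)" unfolding G_def by (rule sum.swap)
  have "(\<Sum>p\<in>{a..<b}. Z (p + n) + Z p - 2 / real n * (\<Sum>i<n. Z (p + i))) = G n + G 0 - 2 / real n * (\<Sum>i<n. G i)"
    unfolding sum.distrib sum_subtractf sum_distrib_left[symmetric] swap by (simp add: G_def)
  also have "\<dots> = (real n * G n + real n * G 0 - 2 * (\<Sum>i<n. G i)) / real n"
    using assms(1) by (simp add: field_simps)
  also have "real n * G n + real n * G 0 - 2 * (\<Sum>i<n. G i) = (\<Sum>m<n. c m * (G (Suc m) - G m))"
    unfolding c_def sum_centered by simp
  also have "\<dots> = (\<Sum>m<n. c m * (Z (b + m) - Z b)) - (\<Sum>m<n. c m * (Z (a + m) - Z a)) + (\<Sum>m<n. c m) * (Z b - Z a)"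
    unfolding Gd by (simp add: algebra_simps sum.distrib sum_subtractf sum_distrib_left)
  also have "(\<Sum>m<n. c m) = real n" unfolding c_def by (rule sum_weights)
  finally have e: "(\<Sum>p\<in>{a..<b}. Z (p + n) + Z p - 2 / real n * (\<Sum>i<n. Z (p + i)))
     = ((\<Sum>m<n. c m * (Z (b + m) - Z b)) - (\<Sum>m<n. c m * (Z (a + m) - Z a)) + real n * (Z b - Z a)) / real n" .
  have "real n * (\<Sum>m\<in>{0..<n}. c m * (Z b - Z (b + m))) \<le> (\<Sum>m\<in>{0..<n}. c m) * (\<Sum>m\<in>{0..<n}. Z b - Z (b + m))"
    using Z_mono by (intro Chebyshev_sum_upper) (auto simp: c_def)
  also have "\<dots> = real n * (\<Sum>m\<in>{0..<n}. Z b - Z (b + m))" using sum_weights[of n] by (simp add: c_def lessThan_atLeast0)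
  also have "\<dots> \<le> real n * 0" using Z_mono by (intro mult_left_mono sum_nonpos) auto
  finally have "(\<Sum>m\<in>{0..<n}. c m * (Z b - Z (b + m))) \<le> 0" using assms(1) by (simp add: mult_le_0_iff)
  moreover have "(\<Sum>m\<in>{0..<n}. c m * (Z b - Z (b + m))) = - (\<Sum>m<n. c m * (Z (b + m) - Z b))"
    by (simp add: lessThan_atLeast0 sum_negf[symmetric] algebra_simps)
  ultimately have lo: "0 \<le> (\<Sum>m<n. c m * (Z (b + m) - Z b))" by linarith
  have "(\<Sum>m<n. c m * (Z (a + m) - Z a)) \<le> (\<Sum>m<n. real n * (Z (a + n) - Z a))"
    using Z_mono by (intro sum_mono mult_mono) (auto simp: c_def)
  then have hi: "(\<Sum>m<n. c m * (Z (a + m) - Z a)) \<le> real n * (real n * (Z (a + n) - Z a))" by simp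
  have "real n * (Z b - Z a - real n * (Z (a + n) - Z a))
      \<le> (\<Sum>m<n. c m * (Z (b + m) - Z b)) - (\<Sum>m<n. c m * (Z (a + m) - Z a)) + real n * (Z b - Z a)"
    using lo hi by (simp add: algebra_simps)
  then show ?thesis unfolding e using assms(1) by (simp add: field_simps)
qed

text \<open>
  Suppose that M = Z N exceeds the bound, and let x1 and x2 be the times at which Z passes M / 4
  and M / 2. Every window of length n, about 800 N / M, that starts between them rises by at least
  40 (quiet_then_light) and by at most 1600 M n / N (burst_le_average). Hence the chord defects sum
  to almost M / 4 from below, by defect_sum_ge, and to small multiples of n^2 M / N and N / n from
  above, by window_defect_le, because the increments of l telescope as well. Both multiples are
  small against M. The extremality of N keeps x1 above N / 16; otherwise the bound on a rise
  would be useless.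
\<close>

lemma total_le_of_extremal:
  assumes ext: "\<And>x. 1 \<le> x \<Longrightarrow> x \<le> N \<Longrightarrow> Z x \<le> Z N * sqrt (real x / real N)"
  shows "Z N \<le> 100000 * sqrt (real N)"
proof (rule ccontr)
  assume "\<not> ?thesis"
  then have big: "100000 * sqrt (real N) < Z N" by simp
  define M where "M = Z N"
  have sq1: "1 \<le> sqrt (real N)" using N1 by simp
  have M: "100000 < M" using big sq1 unfolding M_def by linarith
  have "(100000 * sqrt (real N)) * (100000 * sqrt (real N)) \<le> M * M"
    using big M unfolding M_def by (intro mult_mono) auto
  then have M2: "10000000000 * real N \<le> M * M" by simp
  have M40: "M \<le> 40 * real N" using mass_le[of 0 N] Z0 by (simp add: M_def)
  \<comment> \<open>the shortest length for which quiet_then_light forbids a rise below 40 starting under M / 2\<close>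
  define n where "n = nat \<lfloor>800 * real N / M\<rfloor>"
  have q20: "20 \<le> 800 * real N / M" using M40 M by (simp add: field_simps)
  have "real n \<le> 800 * real N / M" "800 * real N / M < real n + 1" unfolding n_def using q20 by linarith+
  then have n: "real n * M \<le> 800 * real N" "800 * real N < (real n + 1) * M" using M by (auto simp: field_simps)
  have n20: "20 \<le> n" unfolding n_def using q20 by (simp add: le_nat_floor)
  have "(real n + 1) * M \<le> (2 * real n) * M" using n20 M by (intro mult_right_mono) auto
  then have nM: "400 * real N \<le> real n * M" using n by linarith
  have "(real n * M) * (real n * M) \<le> (800 * real N) * (800 * real N)"
    using n(1) M by (intro mult_mono[OF n(1) n(1)]) auto
  then have "(real n * real n) * (M * M) \<le> 640000 * real N * real N" by (simp add: algebra_simps)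
  moreover have "(real n * real n) * (10000000000 * real N) \<le> (real n * real n) * (M * M)" using M2 by (intro mult_left_mono) auto
  ultimately have "(real n * real n * 15625) * real N \<le> real N * real N" by simp
  then have nn: "real n * real n * 15625 \<le> real N" using N1 by (subst (asm) mult_le_cancel_right) auto
  have "real n * 20 * 15625 \<le> real n * real n * 15625" using n20 by (intro mult_right_mono mult_left_mono) auto
  then have nN: "real n * 312500 \<le> real N" using nn by linarith
  define x1 where "x1 = (LEAST x. M / 4 \<le> Z x)"
  have x1a: "M / 4 \<le> Z x1" unfolding x1_def by (rule LeastI[of _ N]) (use M in \<open>simp add: M_def\<close>)
  have x1N: "x1 \<le> N" unfolding x1_def by (rule Least_le) (use M in \<open>simp add: M_def\<close>)
  have x1pos: "1 \<le> x1" using x1a M Z0 by (cases x1) auto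
  have "\<not> M / 4 \<le> Z (x1 - 1)" using not_less_Least[of "x1 - 1" "\<lambda>x. M / 4 \<le> Z x"] x1pos unfolding x1_def[symmetric] by simp
  moreover have "Z (Suc (x1 - 1)) - Z (x1 - 1) < 40" using step_lt[of "x1 - 1"] x1pos x1N by simp
  ultimately have x1b: "Z x1 < M / 4 + 40" using x1pos by simp
  have "M / 4 \<le> M * sqrt (real x1 / real N)" using ext[OF x1pos x1N] x1a unfolding M_def by linarith
  then have "1 / 4 \<le> sqrt (real x1 / real N)" using M by (simp add: field_simps)
  then have "(1/4)\<^sup>2 \<le> (sqrt (real x1 / real N))\<^sup>2" by (intro power_mono) auto
  then have x1N16: "real N \<le> 16 * real x1" using N1 by (simp add: field_simps power2_eq_square)
  define x2 where "x2 = Max {x. x \<le> N \<and> Z x \<le> M / 2}"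
  have fin: "finite {x. x \<le> N \<and> Z x \<le> M / 2}" by (rule finite_subset[of _ "{..N}"]) auto
  have x12: "x1 \<in> {x. x \<le> N \<and> Z x \<le> M / 2}" using x1b x1N M by simp
  have "x2 \<in> {x. x \<le> N \<and> Z x \<le> M / 2}" unfolding x2_def using fin x12 by (intro Max_in) auto
  then have x2a: "x2 \<le> N" "Z x2 \<le> M / 2" by auto
  have x2N: "x2 < N" using x2a M unfolding M_def by (cases "x2 = N") auto
  have "\<not> Z (Suc x2) \<le> M / 2"
  proof
    assume "Z (Suc x2) \<le> M / 2"
    then have "Suc x2 \<le> x2" unfolding x2_def using fin x2N x2_def by (intro Max_ge) auto
    then show False by simp
  qed
  then have x2b: "M / 2 - 40 \<le> Z x2" using step_lt[OF x2N] by linarith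
  have x1x2: "x1 \<le> x2" unfolding x2_def using fin x12 by (rule Max_ge)
  have heavy: "p + n \<le> N \<and> 40 \<le> Z (p + n) - Z p" if p: "x1 \<le> p" "p \<le> x2" for p
  proof -
    have zp: "Z p \<le> M / 2" using Z_mono[OF p(2)] x2a by linarith
    have pN: "p < N" using p x2N by simp
    have "M / 2 \<le> 40 * real (N - p)" using mass_le[of p N] pN zp by (simp add: M_def)
    moreover have "80 * real n \<le> M"
    proof -
      have "80 * real n * M \<le> 64000 * real N" using n by linarith
      also have "\<dots> \<le> M * M" using M2 by linarith
      finally show ?thesis using M by simp
    qed
    ultimately have pn: "p + n \<le> N" using pN by linarith
    define q0 where "q0 = (LEAST q. 40 \<le> Z q - Z p)"
    have "40 \<le> Z N - Z p" using zp M by (simp add: M_def)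
    then have q0: "40 \<le> Z q0 - Z p" "q0 \<le> N" unfolding q0_def by (auto intro: LeastI Least_le)
    have pq0: "p < q0" using q0(1) Z_mono[of q0 p] by (cases "p < q0") auto
    have "q0 \<le> p + n"
    proof (rule ccontr)
      assume "\<not> q0 \<le> p + n"
      then have "p + Suc n \<le> q0" by simp
      moreover have "Z j - Z p < 40" if "j < q0" for j using not_less_Least[of j "\<lambda>q. 40 \<le> Z q - Z p"] that unfolding q0_def by simp
      ultimately have "(Z N - Z p) * real (Suc n) \<le> 400 * real N"
        using quiet_then_light[OF pq0 q0(2) q0(1), of "Suc n"] by simp
      moreover have "M / 2 * real (Suc n) \<le> (Z N - Z p) * real (Suc n)" using zp by (intro mult_right_mono) (auto simp: M_def)
      moreover have "400 * real N < M / 2 * real (Suc n)" using n(2) by (simp add: field_simps)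
      ultimately show False by linarith
    qed
    then show ?thesis using pn q0(1) Z_mono[of q0 "p + n"] by linarith
  qed
  have burst: "Z (p + n) - Z p \<le> 1600 * M * real n / real N" if p: "x1 \<le> p" "p \<le> x2" for p
  proof -
    have "6 * real n \<le> real p" using nN x1N16 p by linarith
    then have "(Z (p + n) - Z p) * real p \<le> 100 * M * real n"
      using burst_le_average[of n p] heavy[OF p] n20 unfolding M_def by linarith
    moreover have "(Z (p + n) - Z p) * (real N / 16) \<le> (Z (p + n) - Z p) * real p"
      using heavy[OF p] x1N16 p by (intro mult_left_mono) auto
    ultimately show ?thesis using N1 by (simp add: field_simps)
  qed
  have n1: "n \<ge> 1" using n20 by simp
  have "Z x2 - Z x1 - real n * (Z (x1 + n) - Z x1)
    \<le> (\<Sum>p\<in>{x1..<x2}. Z (p + n) + Z p - 2 / real n * (\<Sum>i<n. Z (p + i)))"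
    using defect_sum_ge[OF n1 x1x2] .
  also have "\<dots> \<le> (\<Sum>p\<in>{x1..<x2}. 1600 * M * real n / real N * (l (p + n) - l p) + 24 / real n)"
  proof (rule sum_mono)
    fix p assume p: "p \<in> {x1..<x2}"
    have "Z (p + n) + Z p - 2 / real n * (\<Sum>i<n. Z (p + i)) \<le> (Z (p + n) - Z p) * (l (p + n) - l p) + 24 / real n"
      using window_defect_le[OF n1, of p] heavy[of p] p by auto
    also have "\<dots> \<le> 1600 * M * real n / real N * (l (p + n) - l p) + 24 / real n"
      using burst[of p] p l_mono[of p "p + n"] by (intro add_right_mono mult_right_mono) auto
    finally show "Z (p + n) + Z p - 2 / real n * (\<Sum>i<n. Z (p + i)) \<le> 1600 * M * real n / real N * (l (p + n) - l p) + 24 / real n" .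
  qed
  also have "\<dots> = 1600 * M * real n / real N * (\<Sum>m<n. l (x2 + m) - l (x1 + m)) + real (x2 - x1) * (24 / real n)"
    unfolding sum.distrib sum_distrib_left[symmetric] telescope_shift[OF x1x2] by simp
  also have "\<dots> \<le> 1600 * M * real n / real N * (\<Sum>m<n. \<xi>) + real N * (24 / real n)"
  proof (intro add_mono mult_left_mono mult_right_mono sum_mono)
    fix m assume "m \<in> {..<n}"
    then have "x2 + m \<le> N" using heavy[of x2] x1x2 by auto
    then have "l (x2 + m) \<le> l N" by (rule l_mono)
    then show "l (x2 + m) - l (x1 + m) \<le> \<xi>" using l_mono[of 0 "x1 + m"] l_tot by simp
  qed (use M x2N in auto)
  finally have fin_ineq: "Z x2 - Z x1 - real n * (Z (x1 + n) - Z x1) \<le> 1600 * M * real n / real N * (real n * \<xi>) + real N * (24 / real n)" by simp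
  have k: "M * (real n * real n) / real N \<le> M / 15625" using nn N1 M by (simp add: field_simps)
  have "real n * (Z (x1 + n) - Z x1) \<le> real n * (1600 * M * real n / real N)" using burst[of x1] x1x2 by (intro mult_left_mono) auto
  also have "\<dots> = 1600 * (M * (real n * real n) / real N)" by simp
  finally have i1: "real n * (Z (x1 + n) - Z x1) \<le> 1600 * (M / 15625)" using k by linarith
  have "1600 * M * real n / real N * (real n * \<xi>) = 1600 * (M * (real n * real n) / real N) * \<xi>" by simp
  also have "\<dots> \<le> 1600 * (M / 15625) * (1/20)" using k xi_le xi_pos M by (intro mult_mono) auto
  finally have i2: "1600 * M * real n / real N * (real n * \<xi>) \<le> 80 * (M / 15625)" by simp
  have i3: "real N * (24 / real n) \<le> 24 * M / 400" using nM n1 by (simp add: field_simps)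
  show False using fin_ineq i1 i2 i3 x1b x2b M by linarith
qed

end

lemma staircase_edge_shorten:
  assumes "staircase_edge N w Z l \<xi>" "1 \<le> x" "x \<le> N"
  shows "staircase_edge x w Z l \<xi>"
proof -
  interpret staircase_edge N w Z l \<xi> by fact
  have "\<xi> * ln (3 * real x) \<le> \<xi> * ln (3 * real N)" using assms xi_pos by (intro mult_left_mono) auto
  then have "\<xi> * ln (3 * real x) \<le> 1/20" using xi_ln by linarith
  note xl = this
  have s: "staircase x w Z l \<xi>"
  proof (intro staircase.intro)
    show "l x - l 0 \<le> \<xi>" using l_mono[OF assms(3)] l_tot by linarith
    show "\<xi> * ln (3 * real x) \<le> 1/20" by (rule xl)
  qed (fact assms(2) w_le w_ge w_anti Z0 Z_mono l_mono xi_pos xi_le)+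
  show ?thesis
  proof (intro staircase_edge.intro s staircase_edge_axioms.intro)
    fix p q assume "p < q" "q \<le> x" "40 \<le> Z q - Z p"
    then show "(Z q - Z p) * (staircase.tau w q - staircase.tau w p) \<le> exp (l q - l p) * (2 * staircase.area w Z p q + 8)"
      using edge[of p q] assms(3) by simp
  qed
qed

text \<open>
  Truncating at the x that maximises Z x / sqrt x makes the right end extremal without decreasing
  this quotient.
\<close>

lemma staircase_total:
  assumes "staircase_edge N w Z l \<xi>"
  shows "Z N \<le> 100000 * sqrt (real N)"
proof -
  interpret staircase_edge N w Z l \<xi> by fact
  define g where "g x = Z x / sqrt (real x)" for x :: nat
  have "\<exists>x\<in>{1..N}. \<forall>y\<in>{1..N}. g y \<le> g x"
  proof -
    have "Max (g ` {1..N}) \<in> g ` {1..N}" using N1 by (intro Max_in) auto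
    then obtain x where "x \<in> {1..N}" "g x = Max (g ` {1..N})" by auto
    then show ?thesis by (intro bexI[of _ x]) auto
  qed
  then obtain x where x: "1 \<le> x" "x \<le> N" and mx: "\<And>y. 1 \<le> y \<Longrightarrow> y \<le> N \<Longrightarrow> g y \<le> g x" by auto
  interpret sx: staircase_edge x w Z l \<xi> using staircase_edge_shorten[OF assms x] .
  have "Z x \<le> 100000 * sqrt (real x)"
  proof (rule sx.total_le_of_extremal)
    fix y assume y: "1 \<le> y" "y \<le> x"
    have "g y \<le> g x" using mx y x by simp
    then show "Z y \<le> Z x * sqrt (real y / real x)" using y x by (simp add: g_def field_simps real_sqrt_divide)
  qed
  then have "g x \<le> 100000" using x by (simp add: g_def field_simps)
  then have "g N \<le> 100000" using mx[of N] N1 by simp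
  then show ?thesis using N1 by (simp add: g_def field_simps)
qed

text \<open>
  Greedy cutting: a piece ends when l has risen by xi, which happens at most (l y - l x) / xi times.
  Each piece obeys the bound for staircases, and the single step at which it ends is cut off at Gamma.
\<close>

lemma cut_interval:
  fixes w Z l :: "nat \<Rightarrow> real"
  assumes w_le: "\<And>j. w j \<le> 1" and w_ge: "\<And>j. 1/3 \<le> w j" and w_anti: "\<And>i j. i \<le> j \<Longrightarrow> w j \<le> w i"
    and Z_mono: "\<And>i j. i \<le> j \<Longrightarrow> Z i \<le> Z j" and l_mono: "\<And>i j. i \<le> j \<Longrightarrow> l i \<le> l j"
    and edge: "\<And>p q. p < q \<Longrightarrow> q \<le> N \<Longrightarrow> Z q - Z p \<ge> 40 \<Longrightarrow> l q - l p \<le> 1/20 \<Longrightarrow>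
      (Z q - Z p) * (\<Sum>j\<in>{p..<q}. w j) \<le> exp (l q - l p) * (2 * (\<Sum>j\<in>{p..<q}. (Z j - Z p) * w j) + 8)"
    and N1: "N \<ge> 1" and \<Gamma>: "0 \<le> \<Gamma>" and xi: "\<xi> = 1 / (20 * ln (3 * real N))"
    and xy: "x \<le> y" "y \<le> N"
  shows "(\<Sum>u\<in>{x<..y}. min (Z u - Z (u - 1)) \<Gamma>) \<le> ((l y - l x) / \<xi> + 1) * (100000 * sqrt (real N) + \<Gamma>)"
  using xy
proof (induction "y - x" arbitrary: x rule: less_induct)
  case less
  let ?c = "100000 * sqrt (real N) + \<Gamma>"
  have "1 \<le> ln (3::real)"
    using e_less_272 by (subst ln_ge_iff) auto
  also have "ln (3::real) \<le> ln (3 * real N)" using N1 by simp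
  finally have ln1: "1 \<le> ln (3 * real N)" .
  have xi_pos: "0 < \<xi>" and xi_le: "\<xi> \<le> 1/20" and xi_ln: "\<xi> * ln (3 * real N) = 1/20"
    using ln1 unfolding xi by (auto simp: field_simps)
  have c0: "0 \<le> ?c" using \<Gamma> by simp
  have tel: "(\<Sum>u\<in>{a<..b}. Z u - Z (u - 1)) = Z b - Z a" if "a \<le> b" for a b
    using that by (induction b rule: dec_induct) (auto simp: atLeastSucAtMost_greaterThanAtMost[symmetric] )
  have small: "(\<Sum>u\<in>{x<..y'}. min (Z u - Z (u - 1)) \<Gamma>) \<le> 100000 * sqrt (real N)"
    if y': "x \<le> y'" "y' \<le> y" "l y' - l x \<le> \<xi>" for y'
  proof (cases "x = y'")
    case False
    define n where "n = y' - x"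
    have n1: "n \<ge> 1" and nN: "n \<le> N" and xn: "x + n = y'" using False y' less.prems by (auto simp: n_def)
    define Z' where "Z' j = Z (x + j) - Z x" for j
    have shift: "sum g {x + p..<x + q} = (\<Sum>j\<in>{p..<q}. g (x + j))" for g :: "nat \<Rightarrow> real" and p q
      using sum.shift_bounds_nat_ivl[of g p x q] by (simp add: add.commute)
    have "\<xi> * ln (3 * real n) \<le> \<xi> * ln (3 * real N)" using xi_pos n1 nN by (intro mult_left_mono) auto
    then have s: "staircase n (\<lambda>j. w (x + j)) Z' (\<lambda>j. l (x + j)) \<xi>"
    proof (intro staircase.intro)
      show "l (x + n) - l (x + 0) \<le> \<xi>" using y' xn by simp
      show "\<xi> * ln (3 * real n) \<le> 1/20" using \<open>\<xi> * ln (3 * real n) \<le> \<xi> * ln (3 * real N)\<close> xi_ln by linarith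
      show "1 \<le> n" by (rule n1)
      show "\<xi> \<le> 1/20" by (rule xi_le)
      fix j show "1/3 \<le> w (x + j)" by (rule w_ge)
    qed (auto simp: Z'_def xi_pos intro!: Z_mono l_mono w_anti w_le)
    have "staircase_edge n (\<lambda>j. w (x + j)) Z' (\<lambda>j. l (x + j)) \<xi>"
    proof (intro staircase_edge.intro s staircase_edge_axioms.intro)
      fix p q assume pq: "p < q" "q \<le> n" "40 \<le> Z' q - Z' p"
      have "l (x + q) \<le> l y'" "l x \<le> l (x + p)" using pq xn by (auto intro!: l_mono)
      then have "l (x + q) - l (x + p) \<le> 1/20" using y' xi_le by linarith
      then have "(Z (x + q) - Z (x + p)) * (\<Sum>j\<in>{x + p..<x + q}. w j)
        \<le> exp (l (x + q) - l (x + p)) * (2 * (\<Sum>j\<in>{x + p..<x + q}. (Z j - Z (x + p)) * w j) + 8)"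
        using pq xn y' less.prems by (intro edge) (auto simp: Z'_def)
      then show "(Z' q - Z' p) * (staircase.tau (\<lambda>j. w (x + j)) q - staircase.tau (\<lambda>j. w (x + j)) p)
        \<le> exp (l (x + q) - l (x + p)) * (2 * staircase.area (\<lambda>j. w (x + j)) Z' p q + 8)"
        using pq unfolding shift by (simp add: staircase.tau_diff[OF s] staircase.area_def[OF s] Z'_def)
    qed
    from staircase_total[OF this] have "Z y' - Z x \<le> 100000 * sqrt (real n)" by (simp add: Z'_def xn)
    also have "\<dots> \<le> 100000 * sqrt (real N)" using nN by simp
    finally have "(\<Sum>u\<in>{x<..y'}. Z u - Z (u - 1)) \<le> 100000 * sqrt (real N)" using tel[OF y'(1)] by simp
    moreover have "(\<Sum>u\<in>{x<..y'}. min (Z u - Z (u - 1)) \<Gamma>) \<le> (\<Sum>u\<in>{x<..y'}. Z u - Z (u - 1))"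
      by (intro sum_mono) auto
    ultimately show ?thesis by linarith
  qed simp
  show ?case
  proof (cases "l y - l x \<le> \<xi>")
    case True
    have "1 * ?c \<le> ((l y - l x) / \<xi> + 1) * ?c" using l_mono[OF less.prems(1)] xi_pos c0 by (intro mult_right_mono) auto
    then show ?thesis using small[of y] True less.prems \<Gamma> by simp
  next
    case False
    define v where "v = (LEAST v. \<xi> < l v - l x)"
    have v: "\<xi> < l v - l x" "v \<le> y"
      using False LeastI[of "\<lambda>v. \<xi> < l v - l x" y] Least_le[of "\<lambda>v. \<xi> < l v - l x" y] unfolding v_def by auto
    have xv: "x < v" using v(1) xi_pos l_mono[of v x] by (cases "x < v") auto
    have "\<not> \<xi> < l (v - 1) - l x" using not_less_Least[of "v - 1" "\<lambda>v. \<xi> < l v - l x"] xv unfolding v_def[symmetric] by simp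
    then have a: "(\<Sum>u\<in>{x<..v - 1}. min (Z u - Z (u - 1)) \<Gamma>) \<le> 100000 * sqrt (real N)" using xv v by (intro small) auto
    have b: "(\<Sum>u\<in>{v<..y}. min (Z u - Z (u - 1)) \<Gamma>) \<le> ((l y - l v) / \<xi> + 1) * ?c"
      using less.hyps[of v] xv v less.prems by simp
    have "{x<..y} = {x<..v - 1} \<union> {v} \<union> {v<..y}" using xv v by auto
    then have "(\<Sum>u\<in>{x<..y}. min (Z u - Z (u - 1)) \<Gamma>) = (\<Sum>u\<in>{x<..v - 1} \<union> {v} \<union> {v<..y}. min (Z u - Z (u - 1)) \<Gamma>)" by simp
    also have "\<dots> = (\<Sum>u\<in>{x<..v - 1}. min (Z u - Z (u - 1)) \<Gamma>) + min (Z v - Z (v - 1)) \<Gamma> + (\<Sum>u\<in>{v<..y}. min (Z u - Z (u - 1)) \<Gamma>)"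
      using xv by (subst sum.union_disjoint, auto)+
    also have "\<dots> \<le> 1 * ?c + ((l y - l v) / \<xi> + 1) * ?c" using a b by (simp add: min_le_iff_disj)
    also have "\<dots> \<le> ((l v - l x) / \<xi>) * ?c + ((l y - l v) / \<xi> + 1) * ?c"
      using v(1) xi_pos c0 by (intro add_right_mono mult_right_mono) auto
    also have "\<dots> = ((l y - l x) / \<xi> + 1) * ?c" by (simp add: algebra_simps diff_divide_distrib)
    finally show ?thesis .
  qed
qed

section \<open>Response of a schedule to forces\<close>

text \<open>
  Time runs from 0 to H = T + 1. The step sizes and momentum parameters of the method are those at
  the times 1, ..., T; e 0 = 1 and b 1 = 0 turn the initial point into the effect of a unit force
  at time 0 on a system at rest in the origin.
\<close>

locale schedule =
  fixes T :: nat and e b :: "nat \<Rightarrow> real"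
  assumes T2: "T \<ge> 2" and e_nonneg: "\<And>u. 0 \<le> e u" and b_nonneg: "\<And>u. 0 \<le> b u" and b_lt: "\<And>u. b u < 1"
    and e_0: "e 0 = 1" and b_1: "b (Suc 0) = 0"
begin

text \<open>
  Of a unit velocity at time p the part damp p q is left at time q, and it has moved its coordinate by
  resp p q until then. A unit force during [a, q] leaves the velocity vel a q at time q, and a unit force
  during [a, t) causes the displacement disp a t. A unit force at time u has caused the displacement s u
  at the horizon, and a unit force at all times after q the displacement B q.
\<close>

definition damp :: "nat \<Rightarrow> nat \<Rightarrow> real" where "damp p q = (\<Prod>i\<in>{p<..q}. b i)"
definition resp :: "nat \<Rightarrow> nat \<Rightarrow> real" where "resp p q = (\<Sum>j\<in>{p..<q}. damp p j)"
definition vel :: "nat \<Rightarrow> nat \<Rightarrow> real" where "vel a q = (\<Sum>u\<in>{a..q}. e u * damp u q)"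
definition disp :: "nat \<Rightarrow> nat \<Rightarrow> real" where "disp a t = (\<Sum>u\<in>{a..<t}. e u * resp u t)"
abbreviation "H \<equiv> Suc T"
definition s :: "nat \<Rightarrow> real" where "s u = e u * resp u H"
definition B :: "nat \<Rightarrow> real" where "B q = (\<Sum>u\<in>{q<..T}. s u)"

lemma damp_self [simp]: "damp p p = 1" by (simp add: damp_def)

lemma damp_mult: assumes "p \<le> q" "q \<le> r" shows "damp p r = damp p q * damp q r"
proof -
  have "{p<..r} = {p<..q} \<union> {q<..r}" using assms by auto
  then show ?thesis unfolding damp_def by (simp add: prod.union_disjoint)
qed

lemma damp_nonneg: "0 \<le> damp p q" unfolding damp_def by (intro prod_nonneg) (auto simp: b_nonneg)

lemma damp_le_1: "damp p q \<le> 1" unfolding damp_def using b_lt by (intro prod_le_1) (auto simp: b_nonneg less_imp_le)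

lemma damp_anti: "p \<le> q \<Longrightarrow> q \<le> r \<Longrightarrow> damp p r \<le> damp p q"
  using damp_mult[of p q r] damp_le_1[of q r] damp_nonneg[of p q] mult_left_mono[of "damp q r" 1 "damp p q"] by simp

lemma resp_self [simp]: "resp p p = 0" by (simp add: resp_def)

lemma resp_Suc [simp]: "resp p (Suc p) = 1" by (simp add: resp_def)

lemma resp_add: assumes "p \<le> q" "q \<le> r" shows "resp p r = resp p q + damp p q * resp q r"
proof -
  have "resp p r = resp p q + (\<Sum>j\<in>{q..<r}. damp p j)" unfolding resp_def using assms by (simp add: sum.atLeastLessThan_concat)
  also have "(\<Sum>j\<in>{q..<r}. damp p j) = (\<Sum>j\<in>{q..<r}. damp p q * damp q j)" using assms by (intro sum.cong) (auto intro!: damp_mult)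
  finally show ?thesis by (simp add: resp_def sum_distrib_left)
qed

lemma resp_nonneg: "0 \<le> resp p q" unfolding resp_def by (intro sum_nonneg) (auto simp: damp_nonneg)

lemma resp_ge_1: assumes "p < q" shows "1 \<le> resp p q"
  using resp_add[of p "Suc p" q] assms damp_nonneg[of p "Suc p"] resp_nonneg[of "Suc p" q] by simp

lemma resp_mono: "p \<le> q \<Longrightarrow> q \<le> r \<Longrightarrow> resp p q \<le> resp p r"
  using resp_add[of p q r] damp_nonneg[of p q] resp_nonneg[of q r] by simp

lemma resp_le: "resp p q \<le> real (q - p)"
proof -
  have "resp p q \<le> (\<Sum>j\<in>{p..<q}. 1)" unfolding resp_def by (intro sum_mono) (simp add: damp_le_1)
  then show ?thesis by simp
qed

text \<open>
  Of two starting times p and u, the later one has covered the smaller fraction of its way to r at time q.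
\<close>

lemma resp_ratio:
  assumes "p \<le> u" "u \<le> q" "q \<le> r"
  shows "resp u q * resp p r \<le> resp p q * resp u r"
proof -
  have "damp p u * resp u q \<le> resp p q" using resp_add[of p u q] assms resp_nonneg[of p u] by simp
  then have "(damp p u * resp u q) * (damp u q * resp q r) \<le> resp p q * (damp u q * resp q r)"
    using damp_nonneg resp_nonneg by (intro mult_right_mono mult_nonneg_nonneg) auto
  then have "resp u q * (damp p q * resp q r) \<le> resp p q * (damp u q * resp q r)"
    using damp_mult[OF assms(1,2)] by (simp add: algebra_simps)
  then show ?thesis using resp_add[of p q r] resp_add[of u q r] assms by (simp add: algebra_simps)
qed

lemma resp_diff: assumes "u \<le> a" "a \<le> t" shows "resp u t - resp u a = damp u a * resp a t"
  using resp_add[OF assms] by simp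

lemma vel_ge: "a \<le> q \<Longrightarrow> e q \<le> vel a q"
  unfolding vel_def using member_le_sum[of q "{a..q}" "\<lambda>u. e u * damp u q"] e_nonneg damp_nonneg by auto

lemma vel_nonneg: "0 \<le> vel a q"
  unfolding vel_def using e_nonneg damp_nonneg by (intro sum_nonneg mult_nonneg_nonneg) auto

lemma disp_nonneg: "0 \<le> disp a q"
  unfolding disp_def using e_nonneg resp_nonneg by (intro sum_nonneg mult_nonneg_nonneg) auto

lemma s_nonneg: "0 \<le> s u" by (simp add: s_def e_nonneg resp_nonneg)

lemma B_nonneg: "0 \<le> B q" unfolding B_def using s_nonneg by (intro sum_nonneg)

lemma resp_0: "0 < t \<Longrightarrow> resp 0 t = 1"
proof -
  assume "0 < t"
  moreover have "{0<..Suc 0} = {Suc 0}" by auto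
  ultimately show ?thesis using resp_add[of 0 "Suc 0" t] b_1 by (simp add: damp_def)
qed

lemma disp_ratio: assumes "p < t" "t \<le> q" shows "disp (Suc p) t * resp p q \<le> disp (Suc p) q * resp p t"
proof -
  have "disp (Suc p) t * resp p q = (\<Sum>u\<in>{Suc p..<t}. e u * (resp u t * resp p q))"
    by (simp add: disp_def sum_distrib_right mult.assoc)
  also have "\<dots> \<le> (\<Sum>u\<in>{Suc p..<t}. e u * (resp p t * resp u q))"
    using assms e_nonneg by (intro sum_mono mult_left_mono resp_ratio) auto
  also have "\<dots> \<le> (\<Sum>u\<in>{Suc p..<q}. e u * (resp p t * resp u q))"
    using assms e_nonneg resp_nonneg by (intro sum_mono2) auto
  also have "\<dots> = disp (Suc p) q * resp p t" unfolding disp_def sum_distrib_right by (intro sum.cong) auto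
  finally show ?thesis .
qed

text \<open>
  During the window [aa i, bb i] spring i pulls with force gg i; index 0 is the initial unit force.
  Window i - 1 leaves the velocity on the right-hand side, decayed until the time aa i - 1 at which the threshold
  of spring i is reached. The elongation of spring i beyond its threshold is at least the distance
  covered since, less twice the displacement gg i * disp (aa i) t that the spring causes itself, once at
  each end. The inequality requires that it is at least 4 * gg i, where spring i saturates.
\<close>

definition chain :: "nat \<Rightarrow> (nat \<Rightarrow> nat) \<Rightarrow> (nat \<Rightarrow> nat) \<Rightarrow> (nat \<Rightarrow> real) \<Rightarrow> bool" where
  "chain k aa bb gg \<longleftrightarrow> aa 0 = 0 \<and> bb 0 = 0 \<and> gg 0 = 1 \<and>
    (\<forall>i\<in>{1..k}. bb (i - 1) < aa i \<and> aa i \<le> bb i \<and> bb i \<le> T \<and> 0 < gg i \<and>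
      (\<forall>t\<in>{aa i..bb i}. 2 * gg i * disp (aa i) t + 4 * gg i
        \<le> gg (i - 1) * vel (aa (i - 1)) (bb (i - 1)) * damp (bb (i - 1)) (aa i - 1) * resp (aa i - 1) t))"

definition reach :: "nat \<Rightarrow> real \<Rightarrow> bool" where
  "reach q M \<longleftrightarrow> (\<exists>k aa bb gg. chain k aa bb gg \<and> q = bb k \<and> M = gg k * vel (aa k) (bb k) \<and> 0 < M)"

lemma reach_0: "reach 0 1"
  unfolding reach_def chain_def
  by (intro exI[of _ 0] exI[of _ "\<lambda>_. 0"] exI[of _ "\<lambda>_. 1"]) (simp add: vel_def e_0)

text \<open>
  The new window pulls with the force M * damp p (a - 1) / D, the largest one for which the bound by D gives the
  chain inequality.
\<close>

lemma reach_step: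
  assumes "reach p M" "p < a" "a \<le> q" "q \<le> T" "0 < damp p (a - 1)" "0 < vel a q" "0 < D"
    and D: "\<And>t. a \<le> t \<Longrightarrow> t \<le> q \<Longrightarrow> 2 * disp a t + 4 \<le> D * resp (a - 1) t"
  shows "reach q (M * damp p (a - 1) * vel a q / D)"
proof -
  have "\<exists>k aa bb gg. chain k aa bb gg \<and> p = bb k \<and> M = gg k * vel (aa k) (bb k) \<and> 0 < M"
    using assms(1) by (simp only: reach_def)
  then obtain k aa bb gg where "chain k aa bb gg \<and> p = bb k \<and> M = gg k * vel (aa k) (bb k) \<and> 0 < M"
    by (elim exE)
  then have c: "chain k aa bb gg" and p: "p = bb k" and M: "M = gg k * vel (aa k) (bb k)" "0 < M" by simp_all
  define g where "g = M * damp p (a - 1) / D"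
  have g: "0 < g" using M assms by (simp add: g_def)
  define aa' where "aa' = aa(Suc k := a)"
  define bb' where "bb' = bb(Suc k := q)"
  define gg' where "gg' = gg(Suc k := g)"
  have "2 * g * disp a t + 4 * g \<le> M * damp p (a - 1) * resp (a - 1) t" if "a \<le> t" "t \<le> q" for t
  proof -
    have "g * (2 * disp a t + 4) \<le> g * (D * resp (a - 1) t)" using D[OF that] g by (intro mult_left_mono) auto
    moreover have "g * D = M * damp p (a - 1)" using \<open>0 < D\<close> by (simp add: g_def)
    ultimately show ?thesis by (simp only: mult.assoc[symmetric]) (simp add: algebra_simps)
  qed
  note new = this
  have old: "aa' i = aa i" "bb' i = bb i" "gg' i = gg i" if "i \<le> k" for i
    using that by (auto simp: aa'_def bb'_def gg'_def)
  have ne: "aa' (Suc k) = a" "bb' (Suc k) = q" "gg' (Suc k) = g" by (auto simp: aa'_def bb'_def gg'_def)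
  have "chain (Suc k) aa' bb' gg'"
    unfolding chain_def
  proof (intro conjI ballI)
    show "aa' 0 = 0" "bb' 0 = 0" "gg' 0 = 1" using c old[of 0] by (auto simp: chain_def)
    fix i assume i: "i \<in> {1..Suc k}"
    have "bb' (i - 1) < aa' i \<and> aa' i \<le> bb' i \<and> bb' i \<le> T \<and> 0 < gg' i"
    proof (cases "i = Suc k")
      case True
      then show ?thesis using assms(2-4) g p old[of k] ne by simp
    next
      case False
      then have "i \<in> {1..k}" "i \<le> k" "i - 1 \<le> k" using i by auto
      then show ?thesis using c old[of i] old[of "i - 1"] unfolding chain_def by simp
    qed
    then show "bb' (i - 1) < aa' i" "aa' i \<le> bb' i" "bb' i \<le> T" "0 < gg' i" by auto
    fix t assume t: "t \<in> {aa' i..bb' i}"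
    show "2 * gg' i * disp (aa' i) t + 4 * gg' i
        \<le> gg' (i - 1) * vel (aa' (i - 1)) (bb' (i - 1)) * damp (bb' (i - 1)) (aa' i - 1) * resp (aa' i - 1) t"
    proof (cases "i = Suc k")
      case True
      then show ?thesis using new[of t] t ne old[of k] M p by simp
    next
      case False
      then have "i \<in> {1..k}" "i \<le> k" "i - 1 \<le> k" using i by auto
      then show ?thesis using c t old[of i] old[of "i - 1"] unfolding chain_def by simp
    qed
  qed
  then show ?thesis unfolding reach_def
    using M(2) assms(5,6,7) ne
    by (intro exI[of _ "Suc k"] exI[of _ aa'] exI[of _ bb'] exI[of _ gg']) (simp add: g_def)
qed

end

section \<open>Simulation of a chain of springs\<close>

text \<open>
  The derivative of the one-sided Huber function.
\<close>

definition ramp :: "real \<Rightarrow> real \<Rightarrow> real" where "ramp \<delta> z = max 0 (min z \<delta>)"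

definition stiff :: "nat \<Rightarrow> nat \<Rightarrow> real" where "stiff d i = (if i = d then 1/2 else 1/4)"

text \<open>
  The forces of all springs along the run, before there is an objective. At time u they depend only on the
  forces at earlier times, so that recursion on time defines them. The third sum is the threshold of spring i: the
  position of coordinate i at the time a i - 1, which the same recursion provides.
\<close>

function force :: "(nat \<Rightarrow> real) \<Rightarrow> (nat \<Rightarrow> nat \<Rightarrow> real) \<Rightarrow> (nat \<Rightarrow> nat) \<Rightarrow> (nat \<Rightarrow> real) \<Rightarrow> nat \<Rightarrow> nat \<Rightarrow> nat \<Rightarrow> real" where
  "force e K a \<delta> d u i =
    (if i = 0 then (if u = 0 then 1 else 0)
     else if d < i \<or> u < a i then 0
     else stiff d i * ramp (\<delta> i)
       ((\<Sum>v<u. e v * (force e K a \<delta> d v (i - 1) - force e K a \<delta> d v i) * K v u)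
        - (if i < d then (\<Sum>v<u. e v * (force e K a \<delta> d v i - force e K a \<delta> d v (i + 1)) * K v u) else 0)
        - (\<Sum>v<a i - 1. e v * (force e K a \<delta> d v (i - 1) - force e K a \<delta> d v i) * K v (a i - 1))))"
  by pat_completeness auto
termination
  by (relation "Wellfounded.measure (\<lambda>(e, K, a, \<delta>, d, u, i). u)") auto

declare force.simps [simp del]

text \<open>
  A chain with k windows is realised in dimension d = k + 1: springs 1, ..., k work in the windows,
  and spring d starts right after the last window and records the final displacement. F u i is
  the force of spring i at time u and X t i the position of coordinate i at time t.
\<close>

locale activation = schedule +
  fixes k :: nat and aa bb :: "nat \<Rightarrow> nat" and gg :: "nat \<Rightarrow> real"
  assumes chain: "chain k aa bb gg" and gain_pos: "0 < gg k * vel (aa k) (bb k)"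
begin

definition d :: nat where "d = Suc k"
definition a :: "nat \<Rightarrow> nat" where "a i = (if i \<le> k then aa i else Suc (bb k))"
definition R :: real where "R = gg k * vel (aa k) (bb k) * resp (bb k) H"
definition \<delta> :: "nat \<Rightarrow> real" where "\<delta> i = (if i \<le> k then 4 * gg i else R / (1 + B (bb k)))"
definition F :: "nat \<Rightarrow> nat \<Rightarrow> real" where "F = force e resp a \<delta> d"
definition X :: "nat \<Rightarrow> nat \<Rightarrow> real" where "X t i = (\<Sum>v<t. e v * (F v (i - 1) - F v i) * resp v t)"
definition c :: "nat \<Rightarrow> real" where "c i = X (a i - 1) i"
definition cap :: "nat \<Rightarrow> real" where "cap i = stiff d i * \<delta> i"

lemma F_0: "F u 0 = (if u = 0 then 1 else 0)"
  unfolding F_def by (subst force.simps) simp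

lemma F_eq: assumes "1 \<le> i" "i \<le> d" "a i \<le> u"
  shows "F u i = stiff d i * ramp (\<delta> i) (X u i - (if i < d then X u (i + 1) else 0) - c i)"
  using assms unfolding F_def c_def X_def by (subst force.simps) simp

lemma F_zero: "1 \<le> i \<Longrightarrow> u < a i \<Longrightarrow> F u i = 0"
  unfolding F_def by (subst force.simps) simp

lemma F_zero': "d < i \<Longrightarrow> F u i = 0"
  unfolding F_def by (subst force.simps) simp

lemma chain_gain:
  assumes "1 \<le> i" "i \<le> k" "aa i \<le> t" "t \<le> bb i"
  shows "2 * gg i * disp (aa i) t + 4 * gg i
    \<le> gg (i - 1) * vel (aa (i - 1)) (bb (i - 1)) * damp (bb (i - 1)) (aa i - 1) * resp (aa i - 1) t"
proof -
  have "i \<in> {1..k}" "t \<in> {aa i..bb i}" using assms by auto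
  then show ?thesis using chain unfolding chain_def by blast
qed

lemma bb_T: "i \<le> k \<Longrightarrow> bb i \<le> T"
  using chain T2 by (cases "i = 0") (auto simp: chain_def)

lemma gg_pos: "i \<le> k \<Longrightarrow> 0 < gg i"
  using chain by (cases "i = 0") (auto simp: chain_def)

lemma aa_le_bb: "i \<le> k \<Longrightarrow> aa i \<le> bb i"
  using chain by (cases "i = 0") (auto simp: chain_def)

lemma bb_less_a: assumes "1 \<le> i" "i \<le> d" shows "bb (i - 1) < a i"
  using assms chain unfolding chain_def a_def d_def by (cases "i = Suc k") auto

lemma a_mono1: assumes "1 \<le> i" "i \<le> d" shows "a (i - 1) < a i"
proof -
  have "a (i - 1) \<le> bb (i - 1)" using assms aa_le_bb[of "i - 1"] by (auto simp: a_def d_def)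
  then show ?thesis using bb_less_a[OF assms] by simp
qed

lemma a_pos: "1 \<le> i \<Longrightarrow> i \<le> d \<Longrightarrow> 1 \<le> a i"
  using bb_less_a[of i] by simp

lemma k_le: "i \<le> k \<Longrightarrow> i \<le> bb i"
proof (induction i)
  case (Suc i)
  have "Suc i \<in> {1..k}" using Suc.prems by simp
  then have "bb (Suc i - 1) < aa (Suc i)" "aa (Suc i) \<le> bb (Suc i)" using chain unfolding chain_def by blast+
  then show ?case using Suc by simp
qed simp

lemma d_le: "d \<le> Suc T"
  using k_le[of k] bb_T[of k] by (simp add: d_def)

lemma R_pos: "0 < R"
  using gain_pos resp_ge_1[of "bb k" H] bb_T[of k] by (simp add: R_def)

lemma delta_pos: "0 < \<delta> i"
  using gg_pos R_pos B_nonneg[of "bb k"] by (auto simp: \<delta>_def intro!: divide_pos_pos)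

lemma ramp_bounds: "0 \<le> x \<Longrightarrow> 0 \<le> ramp x z \<and> ramp x z \<le> x" by (auto simp: ramp_def)

lemma F_bounds: assumes "1 \<le> i" "i \<le> d" shows "0 \<le> F u i" "F u i \<le> cap i"
proof -
  have "0 \<le> F u i \<and> F u i \<le> cap i"
  proof (cases "u < a i")
    case True
    then show ?thesis using F_zero assms delta_pos[of i] by (simp add: cap_def stiff_def)
  next
    case False
    then show ?thesis using F_eq[OF assms, of u] ramp_bounds[of "\<delta> i"] delta_pos[of i]
      by (auto simp: cap_def stiff_def)
  qed
  then show "0 \<le> F u i" "F u i \<le> cap i" by auto
qed

lemma F_nonneg: "0 \<le> F u i"
  using F_bounds(1)[of i u] F_0[of u] F_zero'[of i u] by (cases "i = 0"; cases "i \<le> d") auto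

lemma X_early: assumes "1 \<le> i" "t \<le> a i"
  shows "X t i = (\<Sum>v<t. e v * F v (i - 1) * resp v t)"
  unfolding X_def using assms by (intro sum.cong) (auto simp: F_zero)

lemma X_zero: assumes "2 \<le> i" "i \<le> d" "t \<le> a (i - 1)" shows "X t i = 0"
proof -
  have "F v (i - 1) = 0" if "v < t" for v using that assms by (intro F_zero) auto
  moreover have "a (i - 1) < a i" using a_mono1 assms by simp
  ultimately show ?thesis using X_early[of i t] assms by simp
qed

lemma X_early_mono: assumes "1 \<le> i" "i \<le> d" "t \<le> t'" "t' \<le> a i" shows "X t i \<le> X t' i"
proof -
  have "X t i = (\<Sum>v<t. e v * F v (i - 1) * resp v t)" using assms by (intro X_early) auto
  also have "\<dots> \<le> (\<Sum>v<t. e v * F v (i - 1) * resp v t')"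
    using e_nonneg F_nonneg assms(3) by (intro sum_mono mult_left_mono resp_mono mult_nonneg_nonneg) auto
  also have "\<dots> \<le> (\<Sum>v<t'. e v * F v (i - 1) * resp v t')"
    using e_nonneg F_nonneg assms(3) resp_nonneg by (intro sum_mono2 mult_nonneg_nonneg) auto
  also have "\<dots> = X t' i" using assms by (intro X_early[symmetric]) auto
  finally show ?thesis .
qed

lemma c_nonneg: assumes "1 \<le> i" "i \<le> d" shows "0 \<le> c i"
proof -
  have "X 0 i \<le> X (a i - 1) i" using assms by (intro X_early_mono) auto
  then show ?thesis by (simp add: c_def X_def)
qed

text \<open>
  The forces were set to 0 before the time a i. There the ramp vanishes on its own: coordinate i only moves
  forward until a i and is still below its position c i at the time a i - 1, while coordinate i + 1 has
  not moved. So at all times the forces are those of one and the same objective.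
\<close>

lemma F_gradient: assumes "1 \<le> i" "i \<le> d"
  shows "F u i = stiff d i * ramp (\<delta> i) (X u i - (if i < d then X u (i + 1) else 0) - c i)"
proof (cases "a i \<le> u")
  case False
  then have "X u i \<le> c i" unfolding c_def using assms by (intro X_early_mono) auto
  moreover have "i < d \<Longrightarrow> X u (i + 1) = 0" using X_zero[of "i + 1" u] assms False by simp
  ultimately have "X u i - (if i < d then X u (i + 1) else 0) - c i \<le> 0" by simp
  then have "ramp (\<delta> i) (X u i - (if i < d then X u (i + 1) else 0) - c i) = 0"
    using delta_pos[of i] unfolding ramp_def by (simp only: max_def min_def) auto
  then show ?thesis using False assms F_zero[of i u] by simp
qed (use F_eq assms in auto)

text \<open>
  Differences of positions are sums of damped impulses, and damping them once more multiplies by b t.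
\<close>

lemma X_Suc: assumes "1 \<le> t"
  shows "X (Suc t) i = X t i + e t * (F t (i - 1) - F t i) + b t * (X t i - X (t - 1) i)"
proof -
  define f where "f v = e v * (F v (i - 1) - F v i)" for v
  have X: "X t i = (\<Sum>v<t. f v * resp v t)" for t by (simp add: X_def f_def)
  have diff: "X (Suc t) i - X t i = (\<Sum>v<Suc t. f v * damp v t)" for t
  proof -
    have "X (Suc t) i - X t i = (\<Sum>v<Suc t. f v * resp v (Suc t)) - (\<Sum>v<Suc t. f v * resp v t)" by (simp add: X)
    also have "\<dots> = (\<Sum>v<Suc t. f v * (resp v (Suc t) - resp v t))" unfolding right_diff_distrib sum_subtractf ..
    also have "\<dots> = (\<Sum>v<Suc t. f v * damp v t)" by (intro sum.cong) (auto simp: resp_def)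
    finally show ?thesis .
  qed
  obtain t' where t': "t = Suc t'" using assms by (cases t) auto
  have "(\<Sum>v<t. f v * damp v t) = (\<Sum>v<t. b t * (f v * damp v t'))"
  proof (intro sum.cong refl)
    fix v assume "v \<in> {..<t}"
    then have "damp v t = damp v t' * damp t' t" using t' by (intro damp_mult) auto
    moreover have "{t'<..t} = {t}" using t' by auto
    ultimately show "f v * damp v t = b t * (f v * damp v t')" by (simp add: damp_def[of t' t])
  qed
  also have "\<dots> = b t * (X t i - X (t - 1) i)" using diff[of t'] t' by (simp add: sum_distrib_left del: sum.lessThan_Suc)
  finally show ?thesis using diff[of t] by (simp add: f_def)
qed

lemma X_1: assumes "1 \<le> i" "i \<le> d" shows "X 1 i = (if i = 1 then 1 else 0)"
proof -
  have "X 1 i = e 0 * (F 0 (i - 1) - F 0 i) * resp 0 1" by (simp add: X_def)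
  moreover have "F 0 i = 0" using F_zero[of i 0] a_pos[of i] assms by simp
  moreover have "F 0 (i - 1) = (if i = 1 then 1 else 0)"
  proof (cases "i = 1")
    case False
    then have "1 \<le> i - 1" "i - 1 \<le> d" using assms by auto
    then show ?thesis using F_zero[of "i - 1" 0] a_pos[of "i - 1"] False by simp
  qed (simp add: F_0)
  ultimately show ?thesis by (simp add: e_0)
qed

text \<open>
  The forces of spring i - 1 during its window alone account for the first term; its other forces only help,
  and spring i pulls back with at most cap i.
\<close>

lemma rise:
  assumes i: "1 \<le> i" "i \<le> d" and t: "a i \<le> t"
    and full: "\<And>v. aa (i - 1) \<le> v \<Longrightarrow> v \<le> bb (i - 1) \<Longrightarrow> F v (i - 1) = gg (i - 1)"
  shows "gg (i - 1) * vel (aa (i - 1)) (bb (i - 1)) * damp (bb (i - 1)) (a i - 1) * resp (a i - 1) t - cap i * disp (a i) t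
    \<le> X t i - c i"
proof -
  let ?a = "a i" and ?p = "bb (i - 1)"
  have pa: "?p \<le> ?a - 1" using bb_less_a[OF i] by simp
  have c: "c i = (\<Sum>v<t. e v * F v (i - 1) * resp v (?a - 1))"
  proof -
    have "c i = (\<Sum>v<?a - 1. e v * F v (i - 1) * resp v (?a - 1))" unfolding c_def using i by (intro X_early) auto
    also have "\<dots> = (\<Sum>v<t. e v * F v (i - 1) * resp v (?a - 1))"
      using t by (intro sum.mono_neutral_left) (auto simp: resp_def)
    finally show ?thesis .
  qed
  have own: "(\<Sum>v<t. e v * F v i * resp v t) \<le> cap i * disp ?a t"
  proof -
    have "(\<Sum>v<t. e v * F v i * resp v t) = (\<Sum>v\<in>{?a..<t}. e v * F v i * resp v t)"
      using F_zero i by (intro sum.mono_neutral_right) auto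
    also have "\<dots> \<le> (\<Sum>v\<in>{?a..<t}. e v * cap i * resp v t)"
      using F_bounds[OF i] e_nonneg resp_nonneg by (intro sum_mono mult_right_mono mult_left_mono) auto
    also have "\<dots> = cap i * disp ?a t" unfolding disp_def sum_distrib_left by (intro sum.cong) auto
    finally show ?thesis .
  qed
  have "gg (i - 1) * vel (aa (i - 1)) ?p * damp ?p (?a - 1) * resp (?a - 1) t
      = (\<Sum>v\<in>{aa (i - 1)..?p}. e v * gg (i - 1) * (damp v (?a - 1) * resp (?a - 1) t))"
    unfolding vel_def sum_distrib_left sum_distrib_right
  proof (intro sum.cong refl)
    fix v assume "v \<in> {aa (i - 1)..?p}"
    then have "damp v (?a - 1) = damp v ?p * damp ?p (?a - 1)" using pa by (intro damp_mult) auto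
    then show "gg (i - 1) * (e v * damp v ?p) * damp ?p (?a - 1) * resp (?a - 1) t
      = e v * gg (i - 1) * (damp v (?a - 1) * resp (?a - 1) t)" by simp
  qed
  also have "\<dots> = (\<Sum>v\<in>{aa (i - 1)..?p}. e v * F v (i - 1) * (resp v t - resp v (?a - 1)))"
    using full pa t by (intro sum.cong) (auto simp: resp_diff)
  also have "\<dots> \<le> (\<Sum>v<t. e v * F v (i - 1) * (resp v t - resp v (?a - 1)))"
  proof (rule sum_mono2)
    show "{aa (i - 1)..?p} \<subseteq> {..<t}" using pa t a_pos[OF i] by auto
    fix v assume "v \<in> {..<t} - {aa (i - 1)..?p}"
    have "resp v (?a - 1) \<le> resp v t"
    proof (cases "v \<le> ?a - 1")
      case True
      then show ?thesis using t by (intro resp_mono) auto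
    next
      case False
      then have "resp v (?a - 1) = 0" by (simp add: resp_def)
      then show ?thesis using resp_nonneg by simp
    qed
    then show "0 \<le> e v * F v (i - 1) * (resp v t - resp v (?a - 1))"
      using e_nonneg F_nonneg by (intro mult_nonneg_nonneg) auto
  qed auto
  also have "\<dots> = (\<Sum>v<t. e v * F v (i - 1) * resp v t) - c i" unfolding c by (simp add: algebra_simps sum_subtractf)
  finally have "gg (i - 1) * vel (aa (i - 1)) ?p * damp ?p (?a - 1) * resp (?a - 1) t \<le> (\<Sum>v<t. e v * F v (i - 1) * resp v t) - c i" .
  moreover have "X t i = (\<Sum>v<t. e v * F v (i - 1) * resp v t) - (\<Sum>v<t. e v * F v i * resp v t)"
    unfolding X_def by (simp add: algebra_simps sum_subtractf)
  ultimately show ?thesis using own by linarith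
qed

text \<open>
  By induction along the chain. If spring i - 1 is saturated in its window, coordinate i rises as in the previous lemma,
  coordinate i + 1 has moved by at most gg i * disp (aa i) t, and the chain inequality puts the elongation
  above the saturation point 4 * gg i.
\<close>

lemma full_force: assumes "i \<le> k" "aa i \<le> t" "t \<le> bb i" shows "F t i = gg i"
  using assms
proof (induction i arbitrary: t)
  case 0
  then show ?case using chain F_0 by (auto simp: chain_def)
next
  case (Suc i)
  let ?i = "Suc i"
  have i: "1 \<le> ?i" "?i \<le> d" "?i < d" using Suc.prems by (auto simp: d_def)
  have a: "a ?i = aa ?i" "\<delta> ?i = 4 * gg ?i" "cap ?i = gg ?i"
    using Suc.prems by (auto simp: a_def \<delta>_def cap_def stiff_def d_def)
  have r: "gg i * vel (aa i) (bb i) * damp (bb i) (aa ?i - 1) * resp (aa ?i - 1) t - gg ?i * disp (aa ?i) t \<le> X t ?i - c ?i"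
    using rise[of ?i t] i Suc a by simp
  have n: "X t (?i + 1) \<le> gg ?i * disp (aa ?i) t"
  proof -
    have "X t (?i + 1) \<le> (\<Sum>v<t. e v * F v ?i * resp v t)"
      unfolding X_def using F_nonneg e_nonneg resp_nonneg by (intro sum_mono mult_right_mono mult_left_mono) auto
    also have "\<dots> = (\<Sum>v\<in>{aa ?i..<t}. e v * F v ?i * resp v t)"
      using F_zero[of ?i] a by (intro sum.mono_neutral_right) auto
    also have "\<dots> \<le> (\<Sum>v\<in>{aa ?i..<t}. e v * gg ?i * resp v t)"
      using F_bounds[OF i(1,2)] a e_nonneg resp_nonneg by (intro sum_mono mult_right_mono mult_left_mono) auto
    also have "\<dots> = gg ?i * disp (aa ?i) t" unfolding disp_def sum_distrib_left by (intro sum.cong) auto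
    finally show ?thesis .
  qed
  have "2 * gg ?i * disp (aa ?i) t + 4 * gg ?i \<le> gg i * vel (aa i) (bb i) * damp (bb i) (aa ?i - 1) * resp (aa ?i - 1) t"
    using chain_gain[of ?i t] Suc.prems by simp
  then have "4 * gg ?i \<le> X t ?i - X t (?i + 1) - c ?i" using r n by linarith
  then show ?case using F_gradient[OF i(1,2), of t] i a gg_pos[OF Suc.prems(1)] by (simp add: ramp_def stiff_def)
qed

lemma last_rise: "R - \<delta> d / 2 * B (bb k) \<le> X H d - c d"
proof -
  have i: "1 \<le> d" "d - 1 = k" "a d = Suc (bb k)" "cap d = \<delta> d / 2" by (auto simp: d_def a_def cap_def stiff_def)
  have "disp (Suc (bb k)) H = B (bb k)"
    unfolding disp_def B_def s_def by (intro sum.cong) auto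
  then show ?thesis using rise[of d H] full_force[of k] bb_T[of k] i(1) unfolding i(2-4) by (simp add: R_def)
qed

end

section \<open>Smoothness and convexity of Huber chains\<close>

lemma huber_nonneg: assumes "0 \<le> \<delta>" shows "0 \<le> huber \<delta> z"
proof (cases "z \<le> \<delta>")
  case False
  have "\<delta> * \<delta> \<le> \<delta> * z" using False assms by (auto intro!: mult_left_mono)
  moreover have "0 \<le> \<delta> * \<delta>" by simp
  ultimately have "\<delta> * \<delta> \<le> 2 * (\<delta> * z)" by linarith
  then show ?thesis using False assms by (simp add: huber_def power2_eq_square)
qed (simp add: huber_def)

text \<open>
  The Huber function is the supremum of r * z - r^2 / 2 over r in [0, delta], and ramp delta z, the point of
  [0, delta] nearest to z, is the maximiser. The expansion bounds follow from the obtuse angles at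
  the nearest points of x and y.
\<close>

lemma huber_eq_ramp: assumes "0 < \<delta>" shows "huber \<delta> z = ramp \<delta> z * z - (ramp \<delta> z)\<^sup>2 / 2"
proof -
  consider "z \<le> 0" | "0 < z" "z \<le> \<delta>" | "\<delta> < z" by linarith
  then show ?thesis
    by cases (use assms in \<open>simp_all add: huber_def ramp_def power2_eq_square\<close>)
qed

lemma ramp_nearest: assumes "0 \<le> r" "r \<le> \<delta>" shows "0 \<le> (ramp \<delta> z - r) * (z - ramp \<delta> z)"
proof -
  consider "z \<le> 0" | "0 < z" "z \<le> \<delta>" | "\<delta> < z" by linarith
  then show ?thesis
  proof cases
    case 1
    then have "ramp \<delta> z = 0" using assms by (simp add: ramp_def)
    then show ?thesis using 1 assms by (simp add: mult_nonneg_nonpos)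
  next
    case 2
    then have "ramp \<delta> z = z" by (simp add: ramp_def)
    then show ?thesis by simp
  next
    case 3
    then have "ramp \<delta> z = \<delta>" using assms by (simp add: ramp_def)
    then show ?thesis using 3 assms by simp
  qed
qed

lemma huber_expansion_bounds:
  assumes "0 < \<delta>"
  shows "0 \<le> huber \<delta> y - huber \<delta> x - ramp \<delta> x * (y - x) \<and>
    huber \<delta> y - huber \<delta> x - ramp \<delta> x * (y - x) \<le> (y - x)\<^sup>2 / 2"
proof -
  define p where "p = ramp \<delta> x"
  define q where "q = ramp \<delta> y"
  have pq: "0 \<le> p" "p \<le> \<delta>" "0 \<le> q" "q \<le> \<delta>" using assms by (auto simp: p_def q_def ramp_def)
  have y: "0 \<le> (q - p) * (y - q)" unfolding q_def using pq by (intro ramp_nearest)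
  have x: "0 \<le> (p - q) * (x - p)" unfolding p_def using pq by (intro ramp_nearest)
  have e: "huber \<delta> y - huber \<delta> x - p * (y - x) = (q - p) * (y - q) + (q - p)\<^sup>2 / 2"
    unfolding huber_eq_ramp[OF assms] p_def[symmetric] q_def[symmetric] by (simp add: power2_eq_square field_simps)
  have d: "(y - x)\<^sup>2 / 2 - ((q - p) * (y - q) + (q - p)\<^sup>2 / 2) = (y - x - (q - p))\<^sup>2 / 2 + (p - q) * (x - p)"
    by (simp add: power2_eq_square field_simps)
  have "0 \<le> (y - x)\<^sup>2 / 2 - ((q - p) * (y - q) + (q - p)\<^sup>2 / 2)" unfolding d using x by simp
  moreover have "0 \<le> (q - p) * (y - q) + (q - p)\<^sup>2 / 2" using y by simp
  ultimately show ?thesis unfolding p_def[symmetric] e by simp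
qed

lemmas huber_expansion = huber_expansion_bounds[THEN conjunct1] huber_expansion_bounds[THEN conjunct2]

lemma ramp_lipschitz: "\<bar>ramp \<delta> x - ramp \<delta> y\<bar> \<le> \<bar>x - y\<bar>"
proof -
  have "\<bar>max 0 u - max 0 v\<bar> \<le> \<bar>u - v\<bar>" "\<bar>min u \<delta> - min v \<delta>\<bar> \<le> \<bar>u - v\<bar>" for u v :: real
    by linarith+
  then show ?thesis unfolding ramp_def using order_trans by blast
qed

lemma huber_large:
  assumes "0 < \<delta>" "\<delta> \<le> R" "R / 2 \<le> z"
  shows "\<delta> * R / 8 \<le> huber \<delta> z"
proof (cases "z \<le> \<delta>")
  case True
  have "(R / 2) * (R / 2) \<le> z * z" using assms by (intro mult_mono) auto
  moreover have "0 < z" using assms by linarith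
  moreover have "\<delta> * R \<le> R * R" using assms by (intro mult_right_mono) auto
  moreover have "huber \<delta> z = z * z / 2" using True assms by (simp add: huber_def power2_eq_square)
  ultimately show ?thesis by simp
next
  case False
  have "\<delta> * \<delta> \<le> \<delta> * z" using False assms by (intro mult_left_mono) auto
  moreover have "\<delta> * (R / 2) \<le> \<delta> * z" using assms by (intro mult_left_mono) auto
  moreover have "huber \<delta> z = \<delta> * z - \<delta> * \<delta> / 2" using False assms by (simp add: huber_def power2_eq_square)
  moreover have "0 \<le> \<delta> * R" using assms by simp
  ultimately show ?thesis by simp
qed

abbreviation lk :: "(nat \<Rightarrow>\<^sub>0 real) \<Rightarrow> nat \<Rightarrow> real" where "lk \<equiv> Poly_Mapping.lookup"

definition vec :: "nat \<Rightarrow> (nat \<Rightarrow> real) \<Rightarrow> (nat \<Rightarrow>\<^sub>0 real)"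
  where "vec d q = Abs_poly_mapping (\<lambda>i. if i \<in> {1..d} then q i else 0)"

lemma lk_vec: "lk (vec d q) i = (if i \<in> {1..d} then q i else 0)"
proof -
  have "finite {i. (if i \<in> {1..d} then q i else 0) \<noteq> 0}" by (rule finite_subset[of _ "{1..d}"]) auto
  then show ?thesis unfolding vec_def by (subst lookup_Abs_poly_mapping) auto
qed

lemma vec_euclid: "vec d q \<in> euclid d"
proof -
  have "i \<in> {1..d}" if "i \<in> Poly_Mapping.keys (vec d q)" for i
    using that unfolding in_keys_iff lk_vec by (simp split: if_splits)
  then show ?thesis by (auto simp: euclid_def)
qed

lemma inner_euclid: assumes "x \<in> euclid d" shows "x \<bullet> y = (\<Sum>i\<in>{1..d}. lk x i * lk y i)"
  using inner_poly_mapping_superset[of "{1..d}" x y] assms by (simp add: euclid_def)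

lemma sum_squares_le_norm: "(\<Sum>i\<in>{1..d}. (lk h i)\<^sup>2) \<le> (norm h)\<^sup>2"
proof -
  let ?A = "{1..d} \<union> Poly_Mapping.keys h"
  have "(norm h)\<^sup>2 = (\<Sum>i\<in>?A. lk h i \<bullet> lk h i)"
    unfolding power2_norm_eq_inner by (rule inner_poly_mapping_superset) auto
  also have "\<dots> = (\<Sum>i\<in>?A. (lk h i)\<^sup>2)" by (simp add: power2_eq_square)
  finally show ?thesis by (simp add: sum_mono2)
qed

lemma lk_add: "lk (x + y) i = lk x i + lk y i" by (simp add: lookup_add)
lemma lk_diff: "lk (x - y) i = lk x i - lk y i" by (simp add: lookup_minus)
lemma lk_scaleR: "lk (r *\<^sub>R x) i = r * lk x i" by (simp add: scaleR_poly_mapping.rep_eq)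

locale huber_chain =
  fixes d :: nat and c \<delta> :: "nat \<Rightarrow> real"
  assumes d1: "1 \<le> d" and c_nonneg: "\<And>i. 1 \<le> i \<Longrightarrow> i \<le> d \<Longrightarrow> 0 \<le> c i"
    and delta_pos: "\<And>i. 1 \<le> i \<Longrightarrow> i \<le> d \<Longrightarrow> 0 < \<delta> i"
begin

definition slope :: "(nat \<Rightarrow>\<^sub>0 real) \<Rightarrow> nat \<Rightarrow> real" where
  "slope h i = lk h i - (if i < d then lk h (i + 1) else 0)"

definition f :: "(nat \<Rightarrow>\<^sub>0 real) \<Rightarrow> real" where
  "f x = (\<Sum>i\<in>{1..d}. stiff d i * huber (\<delta> i) (slope x i - c i))"

definition pull :: "(nat \<Rightarrow>\<^sub>0 real) \<Rightarrow> nat \<Rightarrow> real" where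
  "pull x i = (if i \<in> {1..d} then stiff d i * ramp (\<delta> i) (slope x i - c i) else 0)"

definition grad :: "(nat \<Rightarrow>\<^sub>0 real) \<Rightarrow> (nat \<Rightarrow>\<^sub>0 real)" where
  "grad x = vec d (\<lambda>i. pull x i - pull x (i - 1))"

lemma stiff_pos: "0 < stiff d i" by (simp add: stiff_def)

lemma slope_diff: "slope (x - y) i = slope x i - slope y i" by (simp add: slope_def lk_diff)

lemma sum_by_parts:
  fixes p :: "nat \<Rightarrow> real"
  assumes "p 0 = 0"
  shows "(\<Sum>i\<in>{1..d}. (p i - p (i - 1)) * lk h i) = (\<Sum>i\<in>{1..d}. p i * slope h i)"
proof -
  have "(\<Sum>i\<in>{1..m}. (p i - p (i - 1)) * lk h i)
    = (\<Sum>i\<in>{1..<m}. p i * (lk h i - lk h (i + 1))) + p m * lk h m" if "1 \<le> m" for m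
    using that
  proof (induction m rule: dec_induct)
    case (step m)
    have l: "(\<Sum>i\<in>{1..Suc m}. (p i - p (i - 1)) * lk h i)
      = (\<Sum>i\<in>{1..m}. (p i - p (i - 1)) * lk h i) + (p (Suc m) - p m) * lk h (Suc m)"
      by simp
    have r: "(\<Sum>i\<in>{1..<Suc m}. p i * (lk h i - lk h (i + 1)))
      = (\<Sum>i\<in>{1..<m}. p i * (lk h i - lk h (i + 1))) + p m * (lk h m - lk h (m + 1))"
      using step.hyps by simp
    have "a + q * u + (p' - q) * u' = a + q * (u - u') + p' * u'" for a q u p' u' :: real
      by (simp add: algebra_simps)
    then show ?case unfolding l r step.IH by simp
  next
    case base
    show ?case using assms by simp
  qed
  from this[OF d1] have "(\<Sum>i\<in>{1..d}. (p i - p (i - 1)) * lk h i)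
    = (\<Sum>i\<in>{1..<d}. p i * slope h i) + p d * slope h d"
    by (simp add: slope_def)
  also have "\<dots> = (\<Sum>i\<in>{1..d}. p i * slope h i)"
    using d1 by (cases d) (auto simp: atLeastLessThanSuc_atLeastAtMost)
  finally show ?thesis .
qed

lemma grad_inner: "grad x \<bullet> h = (\<Sum>i\<in>{1..d}. stiff d i * ramp (\<delta> i) (slope x i - c i) * slope h i)"
proof -
  have "grad x \<bullet> h = (\<Sum>i\<in>{1..d}. (pull x i - pull x (i - 1)) * lk h i)"
    unfolding grad_def inner_euclid[OF vec_euclid] by (intro sum.cong) (auto simp: lk_vec)
  also have "\<dots> = (\<Sum>i\<in>{1..d}. pull x i * slope h i)" by (rule sum_by_parts) (simp add: pull_def)
  also have "\<dots> = (\<Sum>i\<in>{1..d}. stiff d i * ramp (\<delta> i) (slope x i - c i) * slope h i)"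
    by (intro sum.cong) (auto simp: pull_def)
  finally show ?thesis .
qed

text \<open>
  This is where the weights of the objective come from: (u - v)^2 / 4 is at most (u^2 + v^2) / 2, every
  inner coordinate occurs in two springs, and the last coordinate may use its second half in the last spring.
\<close>

lemma slope_energy: "(\<Sum>i\<in>{1..d}. stiff d i * (slope h i)\<^sup>2) \<le> (norm h)\<^sup>2"
proof -
  have "(\<Sum>i\<in>{1..m}. (if i = m then 1/2 else 1/4) * (lk h i - (if i < m then lk h (i + 1) else 0))\<^sup>2)
    \<le> (\<Sum>i\<in>{1..m}. (lk h i)\<^sup>2)" for m
  proof (induction m)
    case (Suc m)
    show ?case
    proof (cases m)
      case (Suc m')
      let ?u = "lk h m" and ?v = "lk h (Suc m)"
      have *: "(\<Sum>i\<in>{1..m'}. (if i = Suc m then 1/2 else 1/4) * (lk h i - (if i < Suc m then lk h (i + 1) else 0))\<^sup>2)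
        = (\<Sum>i\<in>{1..m'}. (if i = m then 1/2 else 1/4) * (lk h i - (if i < m then lk h (i + 1) else 0))\<^sup>2)"
        by (intro sum.cong) (auto simp: Suc)
      have "0 \<le> (?u + ?v)\<^sup>2" by simp
      then have q: "1/4 * (?u - ?v)\<^sup>2 \<le> ?u\<^sup>2 / 2 + ?v\<^sup>2 / 2" by (simp add: power2_eq_square algebra_simps)
      have "(\<Sum>i\<in>{1..m'}. (if i = m then 1/2 else 1/4) * (lk h i - (if i < m then lk h (i + 1) else 0))\<^sup>2) + 1/2 * ?u\<^sup>2
        \<le> (\<Sum>i\<in>{1..m'}. (lk h i)\<^sup>2) + ?u\<^sup>2"
        using Suc.IH \<open>m = Suc m'\<close> by simp
      then show ?thesis using q * \<open>m = Suc m'\<close> by simp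
    qed simp
  qed simp
  from this[of d] have "(\<Sum>i\<in>{1..d}. stiff d i * (slope h i)\<^sup>2) \<le> (\<Sum>i\<in>{1..d}. (lk h i)\<^sup>2)"
    unfolding stiff_def slope_def .
  then show ?thesis using sum_squares_le_norm[of h d] by linarith
qed

text \<open>
  The bounds for the Huber function, added up; the upper one becomes a Euclidean norm by slope_energy.
\<close>

lemma f_expansion:
  shows "0 \<le> f y - f x - grad x \<bullet> (y - x)" and "f y - f x - grad x \<bullet> (y - x) \<le> (norm (y - x))\<^sup>2 / 2"
proof -
  let ?r = "\<lambda>i. huber (\<delta> i) (slope y i - c i) - huber (\<delta> i) (slope x i - c i)
      - ramp (\<delta> i) (slope x i - c i) * ((slope y i - c i) - (slope x i - c i))"
  have eq: "f y - f x - grad x \<bullet> (y - x) = (\<Sum>i\<in>{1..d}. stiff d i * ?r i)"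
    unfolding f_def grad_inner slope_diff sum_subtractf[symmetric] by (intro sum.cong) (auto simp: algebra_simps)
  show "0 \<le> f y - f x - grad x \<bullet> (y - x)"
    unfolding eq
  proof (intro sum_nonneg mult_nonneg_nonneg huber_expansion)
    fix i assume "i \<in> {1..d}"
    then show "0 < \<delta> i" "0 \<le> stiff d i" using delta_pos[of i] stiff_pos[of i] by simp_all
  qed
  have "(\<Sum>i\<in>{1..d}. stiff d i * ?r i) \<le> (\<Sum>i\<in>{1..d}. stiff d i * ((slope (y - x) i)\<^sup>2 / 2))"
  proof (intro sum_mono mult_left_mono)
    fix i assume "i \<in> {1..d}"
    then show "?r i \<le> (slope (y - x) i)\<^sup>2 / 2"
      using huber_expansion(2)[of "\<delta> i" "slope y i - c i" "slope x i - c i"] delta_pos by (simp add: slope_diff)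
  qed (use stiff_pos in \<open>auto simp: less_imp_le\<close>)
  also have "\<dots> = (\<Sum>i\<in>{1..d}. stiff d i * (slope (y - x) i)\<^sup>2) / 2" by (simp add: sum_divide_distrib)
  also have "\<dots> \<le> (norm (y - x))\<^sup>2 / 2" using slope_energy[of "y - x"] by simp
  finally show "f y - f x - grad x \<bullet> (y - x) \<le> (norm (y - x))\<^sup>2 / 2" unfolding eq .
qed

lemma f_has_derivative: "(f has_derivative (\<lambda>h. grad x \<bullet> h)) (at x within S)"
proof (rule has_derivativeI_sandwich[of 1])
  show "bounded_linear (\<lambda>h. grad x \<bullet> h)" by (rule bounded_linear_inner_right)
  show "((\<lambda>y. norm (y - x) / 2) \<longlongrightarrow> 0) (at x within S)"
    by (auto intro!: tendsto_eq_intros)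
  fix y assume "y \<noteq> x"
  then show "norm (f y - f x - grad x \<bullet> (y - x)) / norm (y - x) \<le> norm (y - x) / 2"
    using f_expansion[of y x] by (simp add: field_simps power2_eq_square)
qed simp

lemma f_gradient: assumes "x \<in> euclid d" shows "gradient d f x = grad x"
proof (rule gradient_eqI[OF assms])
  have "grad x \<in> euclid d" unfolding grad_def by (rule vec_euclid)
  then show "has_gradient d f (grad x) x" unfolding has_gradient_def using f_has_derivative by (intro conjI)
qed

lemma f_convex: "convex_on (euclid d) f"
proof (rule convex_onI)
  show "convex (euclid d)" by (rule subspace_imp_convex[OF subspace_euclid])
  fix t :: real and x y :: "nat \<Rightarrow>\<^sub>0 real"
  assume t: "0 < t" "t < 1"
  define z where "z = (1 - t) *\<^sub>R x + t *\<^sub>R y"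
  have "(1 - t) * (f z + grad z \<bullet> (x - z)) + t * (f z + grad z \<bullet> (y - z)) \<le> (1 - t) * f x + t * f y"
    using f_expansion(1)[of x z] f_expansion(1)[of y z] t by (intro add_mono mult_left_mono) auto
  moreover have "(1 - t) * (grad z \<bullet> (x - z)) + t * (grad z \<bullet> (y - z)) = 0"
  proof -
    have "(1 - t) * (grad z \<bullet> (x - z)) + t * (grad z \<bullet> (y - z)) = grad z \<bullet> ((1 - t) *\<^sub>R (x - z) + t *\<^sub>R (y - z))"
      by (simp add: inner_add_right)
    also have "(1 - t) *\<^sub>R (x - z) + t *\<^sub>R (y - z) = 0" by (simp add: z_def algebra_simps)
    finally show ?thesis by simp
  qed
  ultimately show "f ((1 - t) *\<^sub>R x + t *\<^sub>R y) \<le> (1 - t) * f x + t * f y"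
    unfolding z_def[symmetric] by (simp add: algebra_simps)
qed

text \<open>
  With the weighted slope map S, the gradient is the adjoint of S applied to ramps of S x. Ramps are
  1-Lipschitz, and S has norm at most 1 by slope_energy.
\<close>

lemma grad_lipschitz: "norm (grad x - grad y) \<le> norm (x - y)"
proof -
  let ?h = "grad x - grad y" and ?k = "x - y"
  define u where "u i = ramp (\<delta> i) (slope x i - c i) - ramp (\<delta> i) (slope y i - c i)" for i
  have u: "(u i)\<^sup>2 \<le> (slope ?k i)\<^sup>2" for i
  proof -
    have "\<bar>u i\<bar> \<le> \<bar>slope ?k i\<bar>" using ramp_lipschitz[of "\<delta> i" "slope x i - c i" "slope y i - c i"] by (simp add: u_def slope_diff)
    then show ?thesis by (simp add: abs_le_square_iff)
  qed
  have "?h \<bullet> ?h = (\<Sum>i\<in>{1..d}. stiff d i * u i * slope ?h i)"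
    unfolding inner_diff_left grad_inner sum_subtractf[symmetric] by (intro sum.cong) (auto simp: u_def algebra_simps)
  also have "\<dots> = (\<Sum>i\<in>{1..d}. (sqrt (stiff d i) * u i) * (sqrt (stiff d i) * slope ?h i))"
    using stiff_pos by (intro sum.cong) (auto simp: less_imp_le algebra_simps)
  also have "\<dots> \<le> L2_set (\<lambda>i. sqrt (stiff d i) * u i) {1..d} * L2_set (\<lambda>i. sqrt (stiff d i) * slope ?h i) {1..d}"
    by (rule order_trans[OF sum_mono L2_set_mult_ineq]) (auto simp: abs_mult[symmetric])
  also have "\<dots> \<le> norm ?k * norm ?h"
  proof (intro mult_mono)
    have *: "L2_set (\<lambda>i. sqrt (stiff d i) * w i) {1..d} \<le> norm z"
      if "\<And>i. (w i)\<^sup>2 \<le> (slope z i)\<^sup>2" for w and z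
    proof -
      have "(\<Sum>i\<in>{1..d}. (sqrt (stiff d i) * w i)\<^sup>2) \<le> (\<Sum>i\<in>{1..d}. stiff d i * (slope z i)\<^sup>2)"
        using that stiff_pos by (intro sum_mono) (auto simp: power_mult_distrib less_imp_le intro!: mult_left_mono)
      also have "\<dots> \<le> (norm z)\<^sup>2" by (rule slope_energy)
      finally show ?thesis unfolding L2_set_def by (intro real_le_lsqrt) (auto intro: sum_nonneg)
    qed
    show "L2_set (\<lambda>i. sqrt (stiff d i) * u i) {1..d} \<le> norm ?k" using u by (rule *)
    show "L2_set (\<lambda>i. sqrt (stiff d i) * slope ?h i) {1..d} \<le> norm ?h" by (rule *) simp
  qed auto
  finally have "norm ?h * norm ?h \<le> norm ?k * norm ?h" by (simp add: power2_norm_eq_inner[symmetric] power2_eq_square)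
  then show ?thesis by (cases "norm ?h = 0") (auto simp: mult_le_cancel_right)
qed

lemma f_lipschitz: "1-lipschitz_on (euclid d) (gradient d f)"
proof (rule lipschitz_onI)
  fix x y assume "x \<in> euclid d" "y \<in> euclid d"
  then show "dist (gradient d f x) (gradient d f y) \<le> 1 * dist x y"
    using grad_lipschitz[of x y] by (simp add: f_gradient dist_norm)
qed simp

lemma f_differentiable: "f differentiable_on euclid d"
  unfolding differentiable_on_def by (intro ballI differentiableI[OF f_has_derivative])

lemma f_objective: "huber_chain_objective d f"
  unfolding huber_chain_objective_def
proof (intro conjI exI[of _ c, OF exI[of _ \<delta>]] ballI)
  fix x
  have "f x = (\<Sum>i = 1..<d. stiff d i * huber (\<delta> i) (slope x i - c i)) + stiff d d * huber (\<delta> d) (slope x d - c d)"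
    unfolding f_def using d1 by (cases d) (auto simp: atLeastLessThanSuc_atLeastAtMost)
  also have "(\<Sum>i = 1..<d. stiff d i * huber (\<delta> i) (slope x i - c i))
    = 1 / 4 * (\<Sum>i = 1..<d. huber (\<delta> i) (lk x i - lk x (i + 1) - c i))"
    unfolding sum_distrib_left by (intro sum.cong) (auto simp: stiff_def slope_def)
  finally show "f x = 1 / 4 * (\<Sum>i = 1..<d. huber (\<delta> i) (lk x i - lk x (i + 1) - c i)) + 1 / 2 * huber (\<delta> d) (lk x d - c d)"
    by (simp add: stiff_def slope_def)
next
  fix i assume "i \<in> {1..d}"
  then show "0 \<le> c i" "0 < \<delta> i" using c_nonneg delta_pos by simp_all
qed (rule d1)

lemma f_nonneg: "0 \<le> f x"
  unfolding f_def
proof (intro sum_nonneg mult_nonneg_nonneg huber_nonneg)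
  fix i assume "i \<in> {1..d}"
  then show "0 \<le> \<delta> i" "0 \<le> stiff d i" using delta_pos[of i] stiff_pos[of i] by simp_all
qed

lemma f_zero: "f 0 = 0"
proof -
  have "huber (\<delta> i) (slope 0 i - c i) = 0" if "i \<in> {1..d}" for i
    using c_nonneg[of i] that by (simp add: slope_def huber_def)
  then show ?thesis by (simp add: f_def)
qed

lemma f_arg_min: "is_arg_min f (\<lambda>x. x \<in> euclid d) 0"
proof -
  have "0 \<in> euclid d" by (simp add: euclid_def)
  moreover have "\<not> f y < f 0" for y using f_nonneg[of y] f_zero by linarith
  ultimately show ?thesis unfolding is_arg_min_def by blast
qed

lemma f_ge_last: "1 / 2 * huber (\<delta> d) (lk x d - c d) \<le> f x"
proof -
  have "stiff d d * huber (\<delta> d) (slope x d - c d) \<le> f x"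
    unfolding f_def using stiff_pos delta_pos d1
    by (intro member_le_sum[of d "{1..d}" "\<lambda>i. stiff d i * huber (\<delta> i) (slope x i - c i)"] mult_nonneg_nonneg huber_nonneg)
      (auto simp: less_imp_le)
  then show ?thesis by (simp add: stiff_def slope_def)
qed

end

section \<open>From a chain to a hard instance\<close>

text \<open>
  The heavy-ball run from e_1 is the simulated run. The last spring pulls with at most delta / 2, so with
  delta = R / (1 + B q) it takes back at most half of R, and the remaining elongation R / 2 is
  large enough for the value delta * R / 16. The origin is a minimiser because the thresholds are nonnegative.
\<close>

lemma (in schedule) reach_lower_bound:
  assumes "reach q M"
    and eta: "\<And>t. t < T \<Longrightarrow> e (Suc t) = \<eta> t" and beta: "\<And>t. 1 \<le> t \<Longrightarrow> t < T \<Longrightarrow> b (Suc t) = \<beta> t"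
  shows "\<exists>d f xstar x0. d \<le> T + 1 \<and> huber_chain_objective d f \<and> f differentiable_on euclid d \<and>
    convex_on (euclid d) f \<and> 1-lipschitz_on (euclid d) (gradient d f) \<and>
    is_arg_min f (\<lambda>x. x \<in> euclid d) xstar \<and> x0 \<in> euclid d \<and> norm (x0 - xstar) \<le> 1 \<and>
    (M * resp q H)\<^sup>2 / (16 * (1 + B q)) \<le> f (heavy_ball (gradient d f) \<eta> \<beta> x0 T) - f xstar"
proof -
  have "\<exists>k aa bb gg. chain k aa bb gg \<and> q = bb k \<and> M = gg k * vel (aa k) (bb k) \<and> 0 < M"
    using assms(1) by (simp only: reach_def)
  then obtain k aa bb gg where "chain k aa bb gg \<and> q = bb k \<and> M = gg k * vel (aa k) (bb k) \<and> 0 < M"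
    by (elim exE)
  then have ch: "chain k aa bb gg" and q: "q = bb k" and M: "M = gg k * vel (aa k) (bb k)" "0 < M" by simp_all
  interpret activation T e b k aa bb gg
    using ch M by unfold_locales simp_all
  interpret hc: huber_chain d c \<delta>
    by unfold_locales (auto simp: d_def c_nonneg delta_pos)
  define x0 where "x0 = vec d (\<lambda>i. if i = 1 then 1 else 0)"
  define hb where "hb t = heavy_ball (gradient d hc.f) \<eta> \<beta> x0 t" for t
  have x0e: "x0 \<in> euclid d" unfolding x0_def by (rule vec_euclid)
  have sub: "subspace (euclid d)" by (rule subspace_euclid)
  have main: "hb t \<in> euclid d \<and> (\<forall>i\<in>{1..d}. lk (hb t) i = X (Suc t) i)" if "t \<le> T" for t
    using that
  proof (induction t rule: less_induct)
    case (less t)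
    show ?case
    proof (cases t)
      case 0
      have "lk (hb t) i = X (Suc t) i" if "i \<in> {1..d}" for i
        using X_1[of i] that by (simp add: 0 hb_def x0_def lk_vec)
      then show ?thesis using x0e by (simp add: 0 hb_def)
    next
      case (Suc t')
      have IH: "hb t' \<in> euclid d" "\<And>i. i \<in> {1..d} \<Longrightarrow> lk (hb t') i = X (Suc t') i"
        using less.IH[of t'] less.prems Suc by auto
      have IH2: "hb (t' - 1) \<in> euclid d" "\<And>i. i \<in> {1..d} \<Longrightarrow> lk (hb (t' - 1)) i = X (Suc (t' - 1)) i"
        using less.IH[of "t' - 1"] less.prems Suc by auto
      have step: "hb t = hb t' - \<eta> t' *\<^sub>R hc.grad (hb t') + \<beta> t' *\<^sub>R (hb t' - hb (t' - 1))"
        using hc.f_gradient[OF IH(1)] by (simp add: Suc hb_def)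
      have ge: "hc.grad (hb t') \<in> euclid d" unfolding hc.grad_def by (rule vec_euclid)
      have "hb t \<in> euclid d" unfolding step using IH(1) IH2(1) ge
        by (intro subspace_add[OF sub] subspace_diff[OF sub] subspace_scale[OF sub])
      moreover have "lk (hb t) i = X (Suc t) i" if i: "i \<in> {1..d}" for i
      proof -
        have sl: "hc.slope (hb t') j = X (Suc t') j - (if j < d then X (Suc t') (j + 1) else 0)" if "j \<in> {1..d}" for j
          using IH(2)[of j] IH(2)[of "j + 1"] that by (auto simp: hc.slope_def)
        have pl: "hc.pull (hb t') j = F (Suc t') j" if "j \<le> d" for j
          using F_gradient[of j "Suc t'"] sl[of j] that F_0[of "Suc t'"] by (cases "j = 0") (auto simp: hc.pull_def)
        have "i - 1 \<le> d" using i by auto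
        then have "lk (hc.grad (hb t')) i = F (Suc t') i - F (Suc t') (i - 1)"
          unfolding hc.grad_def using i pl[of i] pl[of "i - 1"] by (simp add: lk_vec)
        then have "lk (hb t) i = X (Suc t') i - \<eta> t' * (F (Suc t') i - F (Suc t') (i - 1))
          + \<beta> t' * (X (Suc t') i - X (Suc (t' - 1)) i)"
          unfolding step lk_add lk_diff lk_scaleR using IH(2)[OF i] IH2(2)[OF i] by simp
        moreover have "\<beta> t' * (X (Suc t') i - X (Suc (t' - 1)) i) = b (Suc t') * (X (Suc t') i - X t' i)"
          using beta[of t'] b_1 less.prems Suc by (cases "t' = 0") auto
        moreover have "e (Suc t') = \<eta> t'" using eta less.prems Suc by simp
        ultimately show ?thesis using X_Suc[of "Suc t'" i] Suc by (simp add: algebra_simps)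
      qed
      ultimately show ?thesis by blast
    qed
  qed
  have B0: "0 \<le> B (bb k)" by (rule B_nonneg)
  have dR: "\<delta> d = R / (1 + B (bb k))" by (simp add: \<delta>_def d_def)
  have dle: "\<delta> d \<le> R" "0 < \<delta> d" unfolding dR using B0 R_pos by (auto simp: field_simps)
  have "\<delta> d * B (bb k) \<le> R" unfolding dR using B0 R_pos by (simp add: field_simps)
  then have "R / 2 \<le> X H d - c d" using last_rise by simp
  then have "\<delta> d * R / 8 \<le> huber (\<delta> d) (X H d - c d)" using dle by (intro huber_large)
  moreover have "lk (hb T) d = X H d" using main[of T] by (auto simp: d_def)
  ultimately have "\<delta> d * R / 16 \<le> hc.f (hb T)" using hc.f_ge_last[of "hb T"] by simp
  moreover have "\<delta> d * R / 16 = (M * resp q H)\<^sup>2 / (16 * (1 + B q))"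
    unfolding dR using B0 by (simp add: q M R_def power2_eq_square field_simps)
  ultimately have val: "(M * resp q H)\<^sup>2 / (16 * (1 + B q)) \<le> hc.f (hb T) - hc.f 0"
    using hc.f_zero by simp
  have "(norm x0)\<^sup>2 = (\<Sum>i\<in>{1..d}. lk x0 i * lk x0 i)"
    unfolding power2_norm_eq_inner by (rule inner_euclid[OF x0e])
  also have "\<dots> = (\<Sum>i\<in>{1..d}. if i = 1 then 1 else 0)"
    by (intro sum.cong) (auto simp: x0_def lk_vec)
  also have "\<dots> = 1" by (simp add: d_def)
  finally have "norm (x0 - 0) \<le> 1" using power2_le_imp_le[of "norm x0" 1] by simp
  then show ?thesis
    using val d_le hc.f_objective hc.f_differentiable hc.f_convex hc.f_lipschitz hc.f_arg_min x0e
    unfolding hb_def by (intro exI[of _ d] exI[of _ hc.f] exI[of _ 0] exI[of _ x0]) simp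
qed

section \<open>Gain of appending one window\<close>

text \<open>
  The negation of the desired lower bound: no chain achieves a final value above the order of 1 / U. This
  is the standing assumption under which the weight of the schedule is bounded. speed q is the largest velocity that
  a chain passes on at q, and travel q the distance that it covers until the horizon.
\<close>

locale bounded_gain = schedule +
  fixes U :: real
  assumes U1: "1 \<le> U" and gain_bound: "\<And>q M. reach q M \<Longrightarrow> U * (M * resp q H)\<^sup>2 \<le> 1 + B q"
begin

definition speed :: "nat \<Rightarrow> real" where "speed q = Sup (insert 0 {M. reach q M})"

definition travel :: "nat \<Rightarrow> real" where "travel q = speed q * resp q H"

lemma reach_pos: "reach q M \<Longrightarrow> 0 < M"
  by (auto simp: reach_def)

lemma reach_le_T: "reach q M \<Longrightarrow> q \<le> T"
  unfolding reach_def chain_def by (elim exE conjE) (metis atLeastAtMost_iff le0 le_refl less_one not_le)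

lemma reach_bounded: assumes "reach q M" "q \<le> T" shows "M * resp q H \<le> sqrt ((1 + B q) / U)"
proof -
  have "(M * resp q H)\<^sup>2 \<le> (1 + B q) / U" using gain_bound[OF assms(1)] U1 by (simp add: field_simps)
  then show ?thesis by (rule real_le_rsqrt)
qed

lemma reach_bdd: "bdd_above (insert 0 {M. reach q M})"
proof (rule bdd_aboveI[where M = "sqrt ((1 + B q) / U)"])
  fix M assume "M \<in> insert 0 {M. reach q M}"
  moreover have "M \<le> sqrt ((1 + B q) / U)" if r: "reach q M"
  proof -
    have "M * 1 \<le> M * resp q H" using reach_pos[OF r] reach_le_T[OF r] by (intro mult_left_mono resp_ge_1) auto
    then show ?thesis using reach_bounded[OF r reach_le_T[OF r]] by simp
  qed
  moreover have "0 \<le> sqrt ((1 + B q) / U)" using U1 B_nonneg[of q] by simp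
  ultimately show "M \<le> sqrt ((1 + B q) / U)" by auto
qed

lemma reach_le_Mb: "reach q M \<Longrightarrow> M \<le> speed q"
  unfolding speed_def using reach_bdd by (intro cSup_upper) auto

lemma speed_nonneg: "0 \<le> speed q"
  unfolding speed_def using reach_bdd by (intro cSup_upper) auto

lemma speed_least: assumes "0 \<le> x" "\<And>M. reach q M \<Longrightarrow> M \<le> x" shows "speed q \<le> x"
  unfolding speed_def using assms by (intro cSup_least) auto

lemma travel_nonneg: "0 \<le> travel q"
  by (simp add: travel_def speed_nonneg resp_nonneg)

lemma travel_0: "1 \<le> travel 0"
  using reach_le_Mb[OF reach_0] resp_0[of H] by (simp add: travel_def)

lemma travel_bound: assumes "q \<le> T" shows "U * (travel q)\<^sup>2 \<le> 1 + B q"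
proof -
  have k: "1 \<le> resp q H" using assms by (intro resp_ge_1) auto
  have "0 \<le> (1 + B q) / U" using U1 B_nonneg[of q] by simp
  then have "speed q \<le> sqrt ((1 + B q) / U) / resp q H"
    using k reach_bounded[OF _ assms] by (intro speed_least) (auto simp: field_simps)
  then have "travel q \<le> sqrt ((1 + B q) / U)" using k by (simp add: travel_def field_simps)
  then have "(travel q)\<^sup>2 \<le> (sqrt ((1 + B q) / U))\<^sup>2" using travel_nonneg by (intro power_mono) auto
  also have "\<dots> = (1 + B q) / U" using U1 B_nonneg[of q] by simp
  finally show ?thesis using U1 by (simp add: field_simps)
qed

text \<open>
  Passing to the supremum in reach_step.
\<close>

lemma speed_edge:
  assumes "p < a" "a \<le> q" "q \<le> T"
    and D: "\<And>t. a \<le> t \<Longrightarrow> t \<le> q \<Longrightarrow> 2 * disp a t + 4 \<le> D * resp (a - 1) t"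
  shows "speed p * damp p (a - 1) * vel a q \<le> speed q * D"
proof -
  have "2 * disp a a + 4 \<le> D * resp (a - 1) a" using assms(2) by (intro D) auto
  then have "0 < D * resp (a - 1) a" using disp_nonneg[of a a] by linarith
  then have D0: "0 < D" using resp_nonneg[of "a - 1" a] by (simp add: zero_less_mult_iff)
  show ?thesis
  proof (cases "0 < damp p (a - 1) * vel a q")
    case True
    then have pv: "0 < damp p (a - 1)" "0 < vel a q"
      using damp_nonneg[of p "a - 1"] vel_nonneg[of a q] by (auto simp: zero_less_mult_iff)
    have "speed p \<le> speed q * D / (damp p (a - 1) * vel a q)"
    proof (rule speed_least)
      show "0 \<le> speed q * D / (damp p (a - 1) * vel a q)" using speed_nonneg D0 True by simp
      fix M assume "reach p M"
      then have "reach q (M * damp p (a - 1) * vel a q / D)" using assms(1-3) pv D0 D by (rule reach_step)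
      then have "M * damp p (a - 1) * vel a q / D \<le> speed q" by (rule reach_le_Mb)
      then show "M \<le> speed q * D / (damp p (a - 1) * vel a q)" using D0 True by (simp add: field_simps)
    qed
    then show ?thesis using True by (simp add: field_simps)
  next
    case False
    then have "damp p (a - 1) * vel a q = 0" using damp_nonneg[of p "a - 1"] vel_nonneg[of a q]
      by (meson mult_nonneg_nonneg not_less order_antisym)
    then show ?thesis using speed_nonneg[of q] D0 by (auto simp: mult.assoc)
  qed
qed

text \<open>
  For the window (p, q] the quotient disp / resp is largest at the right end, by disp_ratio, so that the
  requirement at q implies the one at all earlier times.
\<close>

lemma edge_contiguous:
  assumes "p < q" "q \<le> T"
  shows "travel p * s q * resp p q \<le> travel q * (2 * (disp (Suc p) q * resp p H) + 4 * (resp p q * resp p H))"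
proof -
  let ?K = "resp p q"
  define D where "D = (2 * disp (Suc p) q + 4 * ?K) / ?K"
  have K: "1 \<le> ?K" using assms by (intro resp_ge_1)
  have "2 * disp (Suc p) t + 4 \<le> D * resp p t" if t: "Suc p \<le> t" "t \<le> q" for t
  proof -
    have "disp (Suc p) t * ?K \<le> disp (Suc p) q * resp p t" using t by (intro disp_ratio) auto
    moreover have "?K * 1 \<le> ?K * resp p t" using t K by (intro mult_left_mono resp_ge_1) auto
    ultimately have "(2 * disp (Suc p) t + 4) * ?K \<le> (2 * disp (Suc p) q + 4 * ?K) * resp p t" by (simp add: algebra_simps)
    then show ?thesis using K by (simp add: D_def field_simps)
  qed
  then have "speed p * damp p (Suc p - 1) * vel (Suc p) q \<le> speed q * D" using assms by (intro speed_edge) auto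
  then have a: "speed p * vel (Suc p) q * ?K \<le> speed q * (2 * disp (Suc p) q + 4 * ?K)" using K by (simp add: D_def field_simps)
  have "travel p * s q * ?K = (speed p * e q * ?K) * (resp p H * resp q H)" by (simp add: travel_def s_def)
  also have "\<dots> \<le> (speed p * vel (Suc p) q * ?K) * (resp p H * resp q H)"
    using assms speed_nonneg resp_nonneg by (intro mult_right_mono mult_left_mono vel_ge mult_nonneg_nonneg) auto
  also have "\<dots> \<le> (speed q * (2 * disp (Suc p) q + 4 * ?K)) * (resp p H * resp q H)"
    using a resp_nonneg by (intro mult_right_mono mult_nonneg_nonneg) auto
  also have "\<dots> = travel q * (2 * (disp (Suc p) q * resp p H) + 4 * (?K * resp p H))" by (simp add: travel_def algebra_simps)
  finally show ?thesis .
qed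

lemma travel_edge:
  assumes "p < q" "q \<le> T"
  shows "travel p * s q \<le> travel q * (2 * (\<Sum>u\<in>{p<..<q}. s u) + 4 * resp p H)"
proof -
  let ?K = "resp p q"
  have K: "1 \<le> ?K" using assms by (intro resp_ge_1)
  have "disp (Suc p) q * resp p H = (\<Sum>u\<in>{p<..<q}. e u * (resp u q * resp p H))"
    unfolding disp_def sum_distrib_right by (intro sum.cong) (auto simp: mult.assoc)
  also have "\<dots> \<le> (\<Sum>u\<in>{p<..<q}. e u * (?K * resp u H))"
    using assms e_nonneg by (intro sum_mono mult_left_mono resp_ratio) auto
  also have "\<dots> = (\<Sum>u\<in>{p<..<q}. s u) * ?K"
    unfolding sum_distrib_right s_def by (intro sum.cong) auto
  finally have "2 * (disp (Suc p) q * resp p H) + 4 * (?K * resp p H) \<le> (2 * (\<Sum>u\<in>{p<..<q}. s u) + 4 * resp p H) * ?K"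
    by (simp add: algebra_simps)
  then have "travel q * (2 * (disp (Suc p) q * resp p H) + 4 * (?K * resp p H)) \<le> travel q * ((2 * (\<Sum>u\<in>{p<..<q}. s u) + 4 * resp p H) * ?K)"
    using travel_nonneg by (rule mult_left_mono)
  then have "(travel p * s q) * ?K \<le> (travel q * (2 * (\<Sum>u\<in>{p<..<q}. s u) + 4 * resp p H)) * ?K"
    using edge_contiguous[OF assms] by (simp add: mult.assoc)
  then show ?thesis using K by (subst (asm) mult_le_cancel_right) auto
qed

text \<open>
  If half of the way from p to the horizon is already covered at q, then a step u in between
  loads the window by at most twice e u * resp u q. So for the steps outside the set E only
  the time between p and q counts, and not the time until the horizon.
\<close>

lemma travel_edge_damped:
  assumes "p < q" "q \<le> T" and half: "resp p H \<le> 2 * resp p q"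
  shows "travel p * s q \<le> travel q * (2 * (\<Sum>u\<in>{p<..<q} \<inter> E. s u) + 4 * (\<Sum>u\<in>{p<..<q} - E. e u * resp u q) + 8 * real (q - p))"
proof -
  let ?K = "resp p q"
  let ?R = "2 * (\<Sum>u\<in>{p<..<q} \<inter> E. s u) + 4 * (\<Sum>u\<in>{p<..<q} - E. e u * resp u q) + 8 * real (q - p)"
  have K: "1 \<le> ?K" using assms by (intro resp_ge_1)
  have "disp (Suc p) q * resp p H = (\<Sum>u\<in>{p<..<q}. e u * resp u q * resp p H)"
    unfolding disp_def sum_distrib_right by (intro sum.cong) auto
  also have "\<dots> = (\<Sum>u\<in>{p<..<q} \<inter> E. e u * resp u q * resp p H) + (\<Sum>u\<in>{p<..<q} - E. e u * resp u q * resp p H)"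
    by (rule sum.Int_Diff) simp
  also have "(\<Sum>u\<in>{p<..<q} \<inter> E. e u * resp u q * resp p H) \<le> (\<Sum>u\<in>{p<..<q} \<inter> E. s u * ?K)"
  proof (rule sum_mono)
    fix u assume "u \<in> {p<..<q} \<inter> E"
    then have "e u * (resp u q * resp p H) \<le> e u * (?K * resp u H)" using assms e_nonneg by (intro mult_left_mono resp_ratio) auto
    then show "e u * resp u q * resp p H \<le> s u * ?K" by (simp add: s_def algebra_simps)
  qed
  also have "(\<Sum>u\<in>{p<..<q} - E. e u * resp u q * resp p H) \<le> (\<Sum>u\<in>{p<..<q} - E. e u * resp u q * (2 * ?K))"
    using half e_nonneg resp_nonneg by (intro sum_mono mult_left_mono mult_nonneg_nonneg) auto
  finally have L: "disp (Suc p) q * resp p H \<le> ((\<Sum>u\<in>{p<..<q} \<inter> E. s u) + 2 * (\<Sum>u\<in>{p<..<q} - E. e u * resp u q)) * ?K"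
    unfolding distrib_right mult.assoc sum_distrib_right sum_distrib_left by (simp add: mult.commute mult.left_commute)
  have "resp p H \<le> 2 * real (q - p)" using half resp_le[of p q] by linarith
  then have "?K * resp p H \<le> ?K * (2 * real (q - p))" using K by (intro mult_left_mono) auto
  then have "2 * (disp (Suc p) q * resp p H) + 4 * (?K * resp p H) \<le> ?R * ?K" using L by (simp add: algebra_simps)
  then have "travel q * (2 * (disp (Suc p) q * resp p H) + 4 * (?K * resp p H)) \<le> travel q * (?R * ?K)"
    using travel_nonneg by (rule mult_left_mono)
  then have "(travel p * s q) * ?K \<le> (travel q * ?R) * ?K"
    using edge_contiguous[OF assms(1,2)] by (simp only: mult.assoc)
  then show ?thesis using K by (subst (asm) mult_le_cancel_right) auto
qed

text \<open>
  Otherwise more than half of the way is still ahead at q, and the window that consists of q alone loses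
  nothing else.
\<close>

lemma travel_edge_coasting:
  assumes "p < q" "q \<le> T" and half: "2 * resp p q < resp p H"
  shows "travel p * e q \<le> 8 * travel q"
proof -
  have "2 * disp q t + 4 \<le> 4 * resp (q - 1) t" if "q \<le> t" "t \<le> q" for t
  proof -
    have "resp (q - 1) q = 1" using assms resp_Suc[of "q - 1"] by simp
    moreover have "t = q" using that by simp
    ultimately show ?thesis by (simp add: disp_def)
  qed
  then have "speed p * damp p (q - 1) * vel q q \<le> speed q * 4" using assms by (intro speed_edge) auto
  moreover have "vel q q = e q" by (simp add: vel_def)
  ultimately have a: "speed p * damp p (q - 1) * e q \<le> 4 * speed q" by simp
  have "resp p H \<le> 2 * (damp p q * resp q H)" using resp_add[of p q H] assms by simp
  also have "\<dots> \<le> 2 * (damp p (q - 1) * resp q H)"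
    using assms resp_nonneg by (intro mult_left_mono mult_right_mono damp_anti) auto
  finally have "(speed p * e q) * resp p H \<le> (speed p * e q) * (2 * (damp p (q - 1) * resp q H))"
    using speed_nonneg e_nonneg by (intro mult_left_mono) auto
  also have "\<dots> = 2 * (speed p * damp p (q - 1) * e q) * resp q H" by simp
  also have "\<dots> \<le> 2 * (4 * speed q) * resp q H" using mult_right_mono[OF a resp_nonneg[of q H]] by (simp add: mult.commute mult.left_commute)
  finally show ?thesis by (simp add: travel_def algebra_simps)
qed

end

text \<open>
  A window has to satisfy the chain inequality at all of its times t and not only at q. Early times at which
  Z has risen by less than 12 cost at most the constant 36. At later times the area is so
  large that the quotient is at most that for q with 8 instead of 4.
\<close>

lemma chord_bound:
  fixes w Z :: "nat \<Rightarrow> real"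
  assumes w_le: "\<And>j. w j \<le> 1" and w_ge: "\<And>j. 1/3 \<le> w j"
    and Z_mono: "\<And>i j. i \<le> j \<Longrightarrow> Z i \<le> Z j"
    and t: "p < t" "t \<le> q"
  defines "W \<equiv> \<lambda>t. \<Sum>j\<in>{p..<t}. w j" and "A \<equiv> \<lambda>t. \<Sum>j\<in>{p..<t}. (Z j - Z p) * w j"
  shows "2 * A t + 4 \<le> max 36 ((2 * A q + 8) / W q) * W t"
proof -
  have w0: "0 < w j" for j using w_ge[of j] by linarith
  define z where "z = Z t - Z p"
  have z0: "0 \<le> z" using Z_mono[of p t] t by (simp add: z_def)
  have Wt: "1/3 \<le> W t"
  proof -
    have "w p \<le> W t" unfolding W_def using t w0 by (intro member_le_sum) (auto simp: less_imp_le)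
    then show ?thesis using w_ge[of p] by linarith
  qed
  have WtWq: "W q = W t + (\<Sum>j\<in>{t..<q}. w j)" unfolding W_def using t by (simp add: sum.atLeastLessThan_concat)
  have AtAq: "A q = A t + (\<Sum>j\<in>{t..<q}. (Z j - Z p) * w j)" unfolding A_def using t by (simp add: sum.atLeastLessThan_concat)
  have r0: "0 \<le> (\<Sum>j\<in>{t..<q}. w j)" using w0 by (intro sum_nonneg) (auto simp: less_imp_le)
  then have Wq: "W t \<le> W q" "0 < W q" using WtWq Wt by auto
  have "(W q - W t) * z = (\<Sum>j\<in>{t..<q}. z * w j)" using WtWq by (simp add: sum_distrib_left mult.commute)
  also have "\<dots> \<le> (\<Sum>j\<in>{t..<q}. (Z j - Z p) * w j)"
    using Z_mono w0 by (intro sum_mono mult_right_mono) (auto simp: z_def less_imp_le)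
  finally have Aq: "A t + (W q - W t) * z \<le> A q" using AtAq by linarith
  have At: "A t + z * w p \<le> z * W t"
  proof -
    have "A t = (\<Sum>j\<in>{Suc p..<t}. (Z j - Z p) * w j)" unfolding A_def using t by (simp add: sum.atLeast_Suc_lessThan)
    also have "\<dots> \<le> (\<Sum>j\<in>{Suc p..<t}. z * w j)"
      using Z_mono w0 by (intro sum_mono mult_right_mono) (auto simp: z_def less_imp_le)
    also have "\<dots> = z * W t - z * w p" unfolding W_def using t by (simp add: sum.atLeast_Suc_lessThan sum_distrib_left algebra_simps)
    finally show ?thesis by linarith
  qed
  have At0: "A t \<le> z * W t" using At z0 w0[of p] by (smt (verit) mult_nonneg_nonneg)
  show ?thesis
  proof (cases "W t \<le> W q / 2 \<and> z < 12")
    case True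
    then have "z * W t \<le> 12 * W t" using Wt by (intro mult_right_mono) auto
    then have "2 * A t + 4 \<le> 36 * W t" using At0 Wt by linarith
    also have "\<dots> \<le> max 36 ((2 * A q + 8) / W q) * W t" using Wt by (intro mult_right_mono) auto
    finally show ?thesis .
  next
    case False
    have "(2 * A t + 4) * W q \<le> (2 * A q + 8) * W t"
    proof (cases "W t \<le> W q / 2")
      case True
      with False have z12: "12 \<le> z" by simp
      have "4 \<le> z * w p" using z12 w_ge[of p] mult_mono[of 12 z "1/3" "w p"] by simp
      \<comment> \<open>z * W t exceeds A t by at least z * w p, since the first step has no area below it\<close>
      have "(W q / 2) * 4 \<le> (W q - W t) * (z * W t - A t)"
        using True Wq At \<open>4 \<le> z * w p\<close> by (intro mult_mono) auto
      moreover have "(A t + (W q - W t) * z) * W t \<le> A q * W t" using Aq Wt by (intro mult_right_mono) auto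
      moreover have "0 \<le> W t" using Wt by linarith
      ultimately show ?thesis by (simp add: algebra_simps)
    next
      case ff: False
      have "(W q - W t) * A t \<le> (W q - W t) * (z * W t)" using At0 Wq by (intro mult_left_mono) auto
      moreover have "(A t + (W q - W t) * z) * W t \<le> A q * W t" using Aq Wt by (intro mult_right_mono) auto
      ultimately have "A t * W q \<le> A q * W t" by (simp add: algebra_simps)
      moreover have "4 * W q \<le> 8 * W t" using ff by simp
      ultimately show ?thesis by (simp add: algebra_simps)
    qed
    then have "2 * A t + 4 \<le> (2 * A q + 8) / W q * W t" using Wq by (simp add: field_simps)
    also have "\<dots> \<le> max 36 ((2 * A q + 8) / W q) * W t" using Wt by (intro mult_right_mono) auto
    finally show ?thesis .
  qed
qed

context bounded_gain
begin

lemma disp_Suc: assumes "a \<le> t" shows "disp a (Suc t) = disp a t + vel a t"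
proof -
  have "disp a (Suc t) = (\<Sum>u\<in>{a..<t}. e u * resp u (Suc t)) + e t" using assms by (simp add: disp_def)
  also have "(\<Sum>u\<in>{a..<t}. e u * resp u (Suc t)) = (\<Sum>u\<in>{a..<t}. e u * resp u t + e u * damp u t)"
    by (intro sum.cong) (auto simp: resp_def algebra_simps)
  finally have "disp a (Suc t) = disp a t + ((\<Sum>u\<in>{a..<t}. e u * damp u t) + e t)" by (simp add: disp_def sum.distrib)
  also have "(\<Sum>u\<in>{a..<t}. e u * damp u t) + e t = vel a t"
    unfolding vel_def using assms by (simp add: sum.last_plus)
  finally show ?thesis .
qed

section \<open>Weight of the bounded steps\<close>

text \<open>
  A stretch on which the best velocity grows by at most the factor G beyond the damping. Dividing by the
  damping turns steps into Z, the available velocity into the increasing function m = exp l, and the gain of appending a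
  window into the edge inequality of a staircase; cutting into pieces costs the factor ln N * ln G.
\<close>

lemma pump_bound:
  assumes w01: "w0 < w1" "w1 \<le> T" and damp: "1/3 \<le> damp w0 w1" and pos: "0 < speed w0" and \<Gamma>: "0 \<le> \<Gamma>"
    and G: "\<And>z. w0 \<le> z \<Longrightarrow> z \<le> w1 \<Longrightarrow> speed z \<le> G * speed w0 * damp w0 z"
  shows "(\<Sum>u\<in>{w0<..w1}. min (e u) \<Gamma>)
    \<le> (20 * ln (3 * real (w1 - w0)) * ln G + 1) * (100000 * sqrt (real (w1 - w0)) + \<Gamma>)"
proof -
  define N where "N = w1 - w0"
  have N1: "1 \<le> N" using w01 by (simp add: N_def)
  define w where "w j = damp w0 (w0 + min j N)" for j
  define Z where "Z j = (\<Sum>u\<in>{w0<..w0 + min j N}. e u / damp w0 u)" for j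
  define m where "m j = Max ((\<lambda>p. speed (w0 + p) / w p) ` {..min j N})" for j
  define l where "l j = ln (m j)" for j
  have w_le: "w j \<le> 1" for j by (simp add: w_def damp_le_1)
  have w_ge: "1/3 \<le> w j" for j
  proof -
    have "min j N \<le> N" by simp
    then have "w0 + min j N \<le> w1" using w01 unfolding N_def by linarith
    then have "damp w0 w1 \<le> damp w0 (w0 + min j N)" by (intro damp_anti) auto
    then show ?thesis using damp unfolding w_def by linarith
  qed
  have w_pos: "0 < w j" for j using w_ge[of j] by linarith
  have w_anti: "w j \<le> w i" if "i \<le> j" for i j unfolding w_def using that by (intro damp_anti) auto
  have w_eq: "damp w0 u = w (u - w0)" if "w0 \<le> u" "u \<le> w1" for u using that by (simp add: w_def N_def)
  have zeta: "0 \<le> e u / damp w0 u" for u using e_nonneg damp_nonneg by simp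
  have Z_mono: "Z i \<le> Z j" if "i \<le> j" for i j unfolding Z_def using that zeta by (intro sum_mono2) auto
  have Z_diff: "Z q - Z p = (\<Sum>u\<in>{w0 + p<..w0 + q}. e u / damp w0 u)" if "p \<le> q" "q \<le> N" for p q
  proof -
    have "{w0<..w0 + q} = {w0<..w0 + p} \<union> {w0 + p<..w0 + q}" using that by auto
    then have "(\<Sum>u\<in>{w0<..w0 + q}. e u / damp w0 u) = (\<Sum>u\<in>{w0<..w0 + p} \<union> {w0 + p<..w0 + q}. e u / damp w0 u)" by simp
    also have "\<dots> = (\<Sum>u\<in>{w0<..w0 + p}. e u / damp w0 u) + (\<Sum>u\<in>{w0 + p<..w0 + q}. e u / damp w0 u)"
      by (rule sum.union_disjoint) auto
    finally show ?thesis using that by (simp add: Z_def min_absorb1)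
  qed
  have m_fin: "finite ((\<lambda>p. speed (w0 + p) / w p) ` {..min j N})" for j by simp
  have m_ge: "speed (w0 + p) / w p \<le> m j" if "p \<le> j" "p \<le> N" for p j
    unfolding m_def using that by (intro Max_ge) auto
  have m0: "m 0 = speed w0" by (simp add: m_def w_def)
  have m_mono: "m i \<le> m j" if "i \<le> j" for i j unfolding m_def using that by (intro Max_mono) auto
  have m_pos: "0 < m j" for j using m_mono[of 0 j] m0 pos by simp
  have m_att: "\<exists>p. p \<le> j \<and> p \<le> N \<and> m j = speed (w0 + p) / w p" for j
  proof -
    have "m j \<in> (\<lambda>p. speed (w0 + p) / w p) ` {..min j N}" unfolding m_def by (intro Max_in) auto
    then show ?thesis by auto
  qed
  have l_mono: "l i \<le> l j" if "i \<le> j" for i j unfolding l_def using m_mono[OF that] m_pos[of i] by simp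
  have V: "vel (Suc (w0 + p)) (w0 + q) = w q * (Z q - Z p)" if "p \<le> q" "q \<le> N" for p q
  proof -
    have "vel (Suc (w0 + p)) (w0 + q) = (\<Sum>u\<in>{w0 + p<..w0 + q}. w q * (e u / damp w0 u))"
      unfolding vel_def
    proof (intro sum.cong)
      fix u assume u: "u \<in> {w0 + p<..w0 + q}"
      then have "damp w0 (w0 + q) = damp w0 u * damp u (w0 + q)" by (intro damp_mult) auto
      moreover have "u \<le> w1" "w0 \<le> u" using u that w01 unfolding N_def by auto
      then have "0 < damp w0 u" using w_pos[of "u - w0"] w_eq[of u] by simp
      ultimately show "e u * damp u (w0 + q) = w q * (e u / damp w0 u)" using that by (simp add: w_def min_absorb1)
    qed auto
    then show ?thesis using Z_diff[OF that] by (simp add: sum_distrib_left)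
  qed
  have K: "w p * resp (w0 + p) (w0 + q) = (\<Sum>j\<in>{p..<q}. w j)" if "p \<le> q" "q \<le> N" for p q
  proof -
    have "resp (w0 + p) (w0 + q) = (\<Sum>j\<in>{p..<q}. damp (w0 + p) (w0 + j))"
      unfolding resp_def using sum.shift_bounds_nat_ivl[of "damp (w0 + p)" p w0 q] by (simp add: add.commute)
    then have "w p * resp (w0 + p) (w0 + q) = (\<Sum>j\<in>{p..<q}. w p * damp (w0 + p) (w0 + j))" by (simp add: sum_distrib_left)
    also have "\<dots> = (\<Sum>j\<in>{p..<q}. w j)"
    proof (intro sum.cong refl)
      fix j assume j: "j \<in> {p..<q}"
      then have "damp w0 (w0 + j) = damp w0 (w0 + p) * damp (w0 + p) (w0 + j)" by (intro damp_mult) auto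
      then show "w p * damp (w0 + p) (w0 + j) = w j" using j that by (simp add: w_def min_absorb1)
    qed
    finally show ?thesis .
  qed
  have L: "disp (Suc (w0 + p)) (w0 + q) = (\<Sum>j\<in>{p..<q}. (Z j - Z p) * w j)" if "p \<le> q" "q \<le> N" for p q
    using that
  proof (induction q rule: dec_induct)
    case base
    then show ?case by (simp add: disp_def)
  next
    case (step q)
    show ?case
    proof (cases "p = q")
      case True
      then show ?thesis by (simp add: disp_def)
    next
      case False
      then have "disp (Suc (w0 + p)) (w0 + Suc q) = disp (Suc (w0 + p)) (w0 + q) + vel (Suc (w0 + p)) (w0 + q)"
        using disp_Suc[of "Suc (w0 + p)" "w0 + q"] step.hyps by simp
      then show ?thesis using step V[of p q] by (simp add: mult.commute)
    qed
  qed
  have edge: "(Z q - Z p) * (\<Sum>j\<in>{p..<q}. w j) \<le> exp (l q - l p) * (2 * (\<Sum>j\<in>{p..<q}. (Z j - Z p) * w j) + 8)"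
    if pq: "p < q" "q \<le> N" and z: "40 \<le> Z q - Z p" and small: "l q - l p \<le> 1/20" for p q
  proof -
    let ?W = "\<Sum>j\<in>{p..<q}. w j" and ?A = "\<Sum>j\<in>{p..<q}. (Z j - Z p) * w j"
    define D where "D = max 36 ((2 * ?A + 8) / ?W)"
    have W: "0 < ?W" using pq w_pos by (intro sum_pos) auto
    obtain p0 where p0: "p0 \<le> p" "p0 \<le> N" "m p = speed (w0 + p0) / w p0" using m_att by blast
    have "2 * disp (Suc (w0 + p)) t + 4 \<le> (w p * D) * resp (w0 + p) t" if t: "Suc (w0 + p) \<le> t" "t \<le> w0 + q" for t
    proof -
      define t' where "t' = t - w0"
      have t': "t = w0 + t'" "p < t'" "t' \<le> q" using t by (auto simp: t'_def)
      have "2 * (\<Sum>j\<in>{p..<t'}. (Z j - Z p) * w j) + 4 \<le> D * (\<Sum>j\<in>{p..<t'}. w j)"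
        unfolding D_def by (rule chord_bound[OF w_le w_ge Z_mono t'(2,3)])
      moreover have "(w p * D) * resp (w0 + p) t = D * (\<Sum>j\<in>{p..<t'}. w j)"
        using K[of p t'] t' pq by (simp add: mult.commute mult.left_commute)
      moreover have "disp (Suc (w0 + p)) t = (\<Sum>j\<in>{p..<t'}. (Z j - Z p) * w j)" using L[of p t'] t' pq by simp
      ultimately show ?thesis by (simp only:)
    qed
    then have "speed (w0 + p0) * damp (w0 + p0) (Suc (w0 + p) - 1) * vel (Suc (w0 + p)) (w0 + q) \<le> speed (w0 + q) * (w p * D)"
      using p0 pq w01 by (intro speed_edge) (auto simp: N_def)
    then have a: "speed (w0 + p0) * damp (w0 + p0) (w0 + p) * (w q * (Z q - Z p)) \<le> speed (w0 + q) * (w p * D)"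
      using V[of p q] pq by simp
    have wp: "w p = w p0 * damp (w0 + p0) (w0 + p)"
      using damp_mult[of w0 "w0 + p0" "w0 + p"] p0 pq by (simp add: w_def min_absorb1)
    have "m p * (Z q - Z p) * (w p * w q) = speed (w0 + p0) * damp (w0 + p0) (w0 + p) * (w q * (Z q - Z p))"
      using p0(3) w_pos[of p0] wp by simp
    also have "\<dots> \<le> speed (w0 + q) * (w p * D)" by (rule a)
    also have "\<dots> = (speed (w0 + q) / w q) * D * (w p * w q)" using w_pos[of q] by simp
    also have "\<dots> \<le> m q * D * (w p * w q)"
      using m_ge[of q q] pq w_pos by (intro mult_right_mono) (auto simp: D_def less_imp_le)
    finally have "m p * (Z q - Z p) \<le> m q * D" using w_pos[of p] w_pos[of q] by (subst (asm) mult_le_cancel_right) auto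
    then have "Z q - Z p \<le> m q / m p * D" using m_pos[of p] by (simp add: field_simps)
    also have "m q / m p = exp (l q - l p)" using m_pos by (simp add: l_def exp_diff)
    finally have b: "Z q - Z p \<le> exp (l q - l p) * D" .
    have "exp (l q - l p) \<le> exp (1/20)" using small by simp
    also have "\<dots> \<le> 1 + 1/20 + (1/20)\<^sup>2" by (rule exp_bound) auto
    finally have "exp (l q - l p) * 36 < 40" by (simp add: power2_eq_square)
    then have "D = (2 * ?A + 8) / ?W" using b z unfolding D_def by (auto simp: max_def split: if_splits)
    then have "D * ?W = 2 * ?A + 8" using W by simp
    moreover have "(Z q - Z p) * ?W \<le> exp (l q - l p) * D * ?W" using b W by (intro mult_right_mono) auto
    ultimately show ?thesis by (simp only: mult.assoc)
  qed
  have "(\<Sum>u\<in>{0<..N}. min (Z u - Z (u - 1)) \<Gamma>)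
    \<le> ((l N - l 0) / (1 / (20 * ln (3 * real N))) + 1) * (100000 * sqrt (real N) + \<Gamma>)"
    by (rule cut_interval[OF w_le w_ge w_anti Z_mono l_mono edge N1 \<Gamma> refl]) auto
  also have "\<dots> \<le> (20 * ln (3 * real N) * ln G + 1) * (100000 * sqrt (real N) + \<Gamma>)"
  proof -
    have "m N \<le> G * speed w0"
    proof -
      obtain p where p: "p \<le> N" "m N = speed (w0 + p) / w p" using m_att by blast
      then have "w0 + p \<le> w1" using w01 by (simp add: N_def)
      then have "speed (w0 + p) \<le> G * speed w0 * w p" using G[of "w0 + p"] p by (simp add: w_def min_absorb1)
      then show ?thesis using p(2) w_pos[of p] by (simp add: pos_divide_le_eq)
    qed
    then have "m N / m 0 \<le> G" using m0 pos by (simp add: field_simps)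
    then have "ln (m N / m 0) \<le> ln G" using m_pos[of N] m_pos[of 0] by (subst ln_le_cancel_iff) (auto intro: less_le_trans[of 0 "m N / m 0"])
    then have "l N - l 0 \<le> ln G" using m_pos[of N] m_pos[of 0] by (simp add: l_def ln_div)
    then have "(20 * ln (3 * real N)) * (l N - l 0) \<le> (20 * ln (3 * real N)) * ln G" using N1 by (intro mult_left_mono) auto
    then show ?thesis using \<Gamma> by (intro mult_right_mono) (auto simp: algebra_simps)
  qed
  finally have fin: "(\<Sum>u\<in>{0<..N}. min (Z u - Z (u - 1)) \<Gamma>) \<le> (20 * ln (3 * real N) * ln G + 1) * (100000 * sqrt (real N) + \<Gamma>)" .
  have "(\<Sum>u\<in>{w0<..w1}. min (e u) \<Gamma>) = (\<Sum>j\<in>{0<..N}. min (e (w0 + j)) \<Gamma>)"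
    by (rule sum.reindex_bij_witness[where i = "\<lambda>j. w0 + j" and j = "\<lambda>u. u - w0"]) (auto simp: N_def)
  also have "\<dots> \<le> (\<Sum>u\<in>{0<..N}. min (Z u - Z (u - 1)) \<Gamma>)"
  proof (rule sum_mono)
    fix j assume j: "j \<in> {0<..N}"
    then have "{w0 + (j - 1)<..w0 + j} = {w0 + j}" by auto
    then have "Z j - Z (j - 1) = e (w0 + j) / damp w0 (w0 + j)" using Z_diff[of "j - 1" j] j by simp
    moreover have "e (w0 + j) \<le> e (w0 + j) / damp w0 (w0 + j)"
    proof -
      have w: "0 < damp w0 (w0 + j)" using w_pos[of j] j by (simp add: w_def min_absorb1)
      have "e (w0 + j) * damp w0 (w0 + j) \<le> e (w0 + j) * 1" using e_nonneg damp_le_1 by (intro mult_left_mono) auto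
      then show ?thesis using w by (simp add: pos_le_divide_eq)
    qed
    ultimately show "min (e (w0 + j)) \<Gamma> \<le> min (Z j - Z (j - 1)) \<Gamma>" by simp
  qed
  finally show ?thesis using fin unfolding N_def by linarith
qed

end

context bounded_gain
begin

text \<open>
  On a cell, resp u q is constant up to a factor 2 and the length is at most a quarter of that
  constant. So the damping across the cell is at least 1/3, and resp w0 z is so small that no_pump applies to the
  first element w0 and all z in the cell.
\<close>

lemma slow_cell:
  assumes q: "q \<le> H" and \<Gamma>: "0 \<le> \<Gamma>" and G1: "1 \<le> G"
    and D: "finite D" "D \<subseteq> {p<..<q}" "\<And>u v. u \<in> D \<Longrightarrow> v \<in> D \<Longrightarrow> v - u < max 1 (2 ^ j div 4)"
    and cls: "\<And>u. u \<in> D \<Longrightarrow> 2 ^ j \<le> resp u q \<and> resp u q < 2 ^ Suc j"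
    and fast: "\<And>u. u \<in> D \<Longrightarrow> e u < \<Gamma>" and pos: "\<And>u. u \<in> D \<Longrightarrow> 0 < speed u"
    and no_pump: "\<And>u z. u \<in> D \<Longrightarrow> u \<le> z \<Longrightarrow> z < q \<Longrightarrow> 3 / 4 * resp u H \<le> damp u z * resp z H
      \<Longrightarrow> speed z \<le> G * speed u * damp u z"
  shows "(\<Sum>u\<in>D. e u) \<le> \<Gamma> + (20 * ln (3 * real (q - p)) * ln G + 1) * (100000 * sqrt (real (q - p)) + \<Gamma>)"
proof (cases "D = {}")
  case False
  define w0 where "w0 = Min D"
  define w1 where "w1 = Max D"
  have w: "w0 \<in> D" "w1 \<in> D" "w0 \<le> w1" unfolding w0_def w1_def using D(1) False by auto
  have bnd: "w0 \<le> u" "u \<le> w1" if "u \<in> D" for u unfolding w0_def w1_def using D(1) that by auto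
  have pq: "p < w0" "w1 < q" using w D(2) by auto
  have lnG: "0 \<le> ln G" using G1 by simp
  have ln1: "0 \<le> ln (3 * real (q - p))" using pq w(3) by (intro ln_ge_zero) linarith
  have rhs0: "0 \<le> (20 * ln (3 * real (q - p)) * ln G + 1) * (100000 * sqrt (real (q - p)) + \<Gamma>)"
    using ln1 lnG \<Gamma> by (intro mult_nonneg_nonneg add_nonneg_nonneg) auto
  show ?thesis
  proof (cases "w0 = w1")
    case True
    then have "D = {w0}" using bnd w by force
    then show ?thesis using fast[of w0] rhs0 by simp
  next
    case lt: False
    then have w01: "w0 < w1" using w by simp
    have len: "w1 - w0 < max 1 (2 ^ j div 4)" using D(3)[of w0 w1] w by simp
    then have "w1 - w0 \<le> 2 ^ j div 4" using w01 by (simp add: max_def split: if_splits)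
    then have "4 * (w1 - w0) \<le> 2 ^ j" by linarith
    then have "real (4 * (w1 - w0)) \<le> real (2 ^ j)" by (rule of_nat_mono)
    then have len': "real (w1 - w0) \<le> 2 ^ j / 4" by simp
    have K0: "2 ^ j \<le> resp w0 q" and K1: "resp w1 q < 2 ^ Suc j" using cls w by auto
    have dist: "resp w0 z \<le> 2 ^ j / 4" if "w0 \<le> z" "z \<le> w1" for z
      using resp_le[of w0 z] len' that by (smt (verit) of_nat_mono diff_le_mono)
    have "resp w0 q = resp w0 w1 + damp w0 w1 * resp w1 q" using w pq by (intro resp_add) auto
    moreover have "damp w0 w1 * resp w1 q \<le> damp w0 w1 * 2 ^ Suc j" using K1 damp_nonneg by (intro mult_left_mono) auto
    moreover have "resp w0 w1 \<le> 2 ^ j / 4" using dist[of w1] w by simp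
    moreover have "(2::real) ^ Suc j = 2 * 2 ^ j" by simp
    ultimately have "(3 / 8) * 2 ^ Suc j \<le> damp w0 w1 * 2 ^ Suc j" using K0 by linarith
    then have "3 / 8 \<le> damp w0 w1" by (subst (asm) mult_le_cancel_right) auto
    then have P: "1 / 3 \<le> damp w0 w1" by linarith
    have "(\<Sum>u\<in>{w0<..w1}. min (e u) \<Gamma>)
      \<le> (20 * ln (3 * real (w1 - w0)) * ln G + 1) * (100000 * sqrt (real (w1 - w0)) + \<Gamma>)"
    proof (rule pump_bound[OF w01 _ P _ \<Gamma>])
      show "w1 \<le> T" using pq q by simp
      show "0 < speed w0" using pos w by simp
      fix z assume z: "w0 \<le> z" "z \<le> w1"
      have "resp w0 q \<le> resp w0 H" using w pq q by (intro resp_mono) auto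
      moreover have "resp w0 H = resp w0 z + damp w0 z * resp z H" using z pq q by (intro resp_add) auto
      ultimately have "3 / 4 * resp w0 H \<le> damp w0 z * resp z H" using dist[OF z] K0 by simp
      then show "speed z \<le> G * speed w0 * damp w0 z" using w z pq by (intro no_pump) auto
    qed
    also have "\<dots> \<le> (20 * ln (3 * real (q - p)) * ln G + 1) * (100000 * sqrt (real (q - p)) + \<Gamma>)"
    proof -
      have r: "1 \<le> real (w1 - w0)" "real (w1 - w0) \<le> real (q - p)" using w01 pq by auto
      have l: "ln (3 * real (w1 - w0)) \<le> ln (3 * real (q - p))" "0 \<le> ln (3 * real (w1 - w0))"
        using r by auto
      have "20 * ln (3 * real (w1 - w0)) * ln G + 1 \<le> 20 * ln (3 * real (q - p)) * ln G + 1"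
        using l lnG by (intro add_right_mono mult_right_mono) auto
      moreover have "100000 * sqrt (real (w1 - w0)) + \<Gamma> \<le> 100000 * sqrt (real (q - p)) + \<Gamma>" using r by simp
      ultimately show ?thesis using l lnG \<Gamma> by (intro mult_mono) auto
    qed
    finally have a: "(\<Sum>u\<in>{w0<..w1}. min (e u) \<Gamma>)
      \<le> (20 * ln (3 * real (q - p)) * ln G + 1) * (100000 * sqrt (real (q - p)) + \<Gamma>)" .
    have "(\<Sum>u\<in>D. e u) \<le> e w0 + (\<Sum>u\<in>D - {w0}. e u)" using w D(1) by (simp add: sum.remove)
    also have "(\<Sum>u\<in>D - {w0}. e u) = (\<Sum>u\<in>D - {w0}. min (e u) \<Gamma>)" using fast by (intro sum.cong) (auto simp: min_def less_imp_le dest!: fast)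
    also have "\<dots> \<le> (\<Sum>u\<in>{w0<..w1}. min (e u) \<Gamma>)"
    proof (rule sum_mono2)
      show "D - {w0} \<subseteq> {w0<..w1}" using bnd by (auto simp: order_less_le)
    qed (use e_nonneg \<Gamma> in auto)
    finally show ?thesis using a fast[OF w(1)] by linarith
  qed
next
  case True
  have "0 \<le> (20 * ln (3 * real (q - p)) * ln G + 1) * (100000 * sqrt (real (q - p)) + \<Gamma>)"
  proof (cases "q - p = 0")
    case False
    then have "0 \<le> ln (3 * real (q - p))" by (intro ln_ge_zero) linarith
    moreover have "0 \<le> ln G" using G1 by simp
    ultimately show ?thesis using \<Gamma> by (intro mult_nonneg_nonneg add_nonneg_nonneg) auto
  qed (use \<Gamma> in simp)
  then show ?thesis using True \<Gamma> by simp
qed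

text \<open>
  The class is tiled by cells of a length comparable to 2^j, and each element weighs at most 2^(j + 1).
\<close>

lemma slow_class:
  assumes pq: "p < q" "q \<le> H" and \<Gamma>: "0 \<le> \<Gamma>" and G1: "1 \<le> G"
    and C: "C \<subseteq> {p<..<q}"
    and cls: "\<And>u. u \<in> C \<Longrightarrow> 2 ^ j \<le> resp u q \<and> resp u q < 2 ^ Suc j"
    and fast: "\<And>u. u \<in> C \<Longrightarrow> e u < \<Gamma>" and pos: "\<And>u. u \<in> C \<Longrightarrow> 0 < speed u"
    and no_pump: "\<And>u z. u \<in> C \<Longrightarrow> u \<le> z \<Longrightarrow> z < q \<Longrightarrow> 3 / 4 * resp u H \<le> damp u z * resp z H
      \<Longrightarrow> speed z \<le> G * speed u * damp u z"
  shows "(\<Sum>u\<in>C. e u * resp u q) \<le> 48 * real (q - p) *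
    (\<Gamma> + (20 * ln (3 * real (q - p)) * ln G + 1) * (100000 * sqrt (real (q - p)) + \<Gamma>))"
proof (cases "C = {}")
  case False
  let ?Bd = "\<Gamma> + (20 * ln (3 * real (q - p)) * ln G + 1) * (100000 * sqrt (real (q - p)) + \<Gamma>)"
  define n where "n = q - p"
  define L where "L = max 1 (2 ^ j div 4 :: nat)"
  have finC: "finite C" using C finite_subset by blast
  have n1: "1 \<le> n" using pq by (simp add: n_def)
  have "0 \<le> ln (3 * real n)" using n1 by (intro ln_ge_zero) linarith
  then have Bd0: "0 \<le> ?Bd" using \<Gamma> G1 unfolding n_def by (intro mult_nonneg_nonneg add_nonneg_nonneg) auto
  obtain u0 where u0: "u0 \<in> C" using False by blast
  have "2 ^ j \<le> resp u0 q" using cls u0 by simp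
  also have "\<dots> \<le> real (q - u0)" by (rule resp_le)
  also have "\<dots> \<le> real n"
  proof -
    have "p < u0" using u0 C by auto
    then show ?thesis by (simp add: n_def)
  qed
  finally have "2 ^ j \<le> real n" .
  then have jn: "2 ^ j \<le> n" by (metis of_nat_le_iff of_nat_numeral of_nat_power)
  have L1: "1 \<le> L" and Ln: "L \<le> n" using jn n1 by (auto simp: L_def)
  have "2 ^ Suc j \<le> 16 * L"
  proof -
    have "(2::nat) ^ j < 4 * (2 ^ j div 4) + 4" by linarith
    moreover have "2 ^ j div 4 \<le> L" "1 \<le> L" by (auto simp: L_def)
    moreover have "(2::nat) ^ Suc j = 2 * 2 ^ j" by simp
    ultimately show ?thesis by linarith
  qed
  then have jL: "(2::real) ^ Suc j \<le> 16 * real L" by (metis of_nat_le_iff of_nat_mult of_nat_numeral of_nat_power)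
  define I where "I = {p div L..q div L}"
  have cell: "(\<Sum>u\<in>{u \<in> C. u div L = i}. e u) \<le> ?Bd" for i
  proof (rule slow_cell[OF pq(2) \<Gamma> G1, where j = j])
    fix u v assume "u \<in> {u \<in> C. u div L = i}" "v \<in> {u \<in> C. u div L = i}"
    then have "u div L = i" "v div L = i" by auto
    then have "L * i \<le> u" "v < L * i + L"
      using L1 by (metis times_div_less_eq_dividend) (metis L1 \<open>v div L = i\<close> add.commute dividend_less_times_div less_le_trans mult.commute mult_Suc zero_less_one)
    then show "v - u < max 1 (2 ^ j div 4)" unfolding L_def[symmetric] using L1 by linarith
  next
    fix u assume u: "u \<in> {u \<in> C. u div L = i}"
    then show "2 ^ j \<le> resp u q \<and> resp u q < 2 ^ Suc j" "e u < \<Gamma>" "0 < speed u" using cls fast pos by auto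
    fix z assume "u \<le> z" "z < q" "3 / 4 * resp u H \<le> damp u z * resp z H"
    then show "speed z \<le> G * speed u * damp u z" using u by (intro no_pump) auto
  qed (use finC C in auto)
  have "(\<Sum>u\<in>C. e u) = (\<Sum>i\<in>I. \<Sum>u\<in>{u \<in> C. u div L = i}. e u)"
  proof (intro sum.group[symmetric])
    have "p \<le> u" "u \<le> q" if "u \<in> C" for u using that C by (auto dest!: subsetD)
    then show "(\<lambda>u. u div L) ` C \<subseteq> I" by (auto simp: I_def intro!: div_le_mono)
  qed (use finC in \<open>auto simp: I_def\<close>)
  also have "\<dots> \<le> (\<Sum>i\<in>I. ?Bd)" using cell by (intro sum_mono)
  also have "\<dots> = real (card I) * ?Bd" by simp
  finally have sum: "(\<Sum>u\<in>C. e u) \<le> real (card I) * ?Bd" .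
  have "L * (q div L) \<le> q" "p < L * (p div L) + L"
    using L1 dividend_less_times_div[of L p] by (auto simp: add.commute)
  then have "L * (q div L) + 1 \<le> L * (p div L) + L + n" using pq unfolding n_def by linarith
  then have "L * card I \<le> n + 2 * L"
    using pq div_le_mono[of p q L] by (simp add: I_def algebra_simps diff_mult_distrib2 Suc_diff_le)
  then have "real (L * card I) \<le> real (3 * n)" using Ln by (intro of_nat_mono) linarith
  then have LI: "real L * real (card I) \<le> 3 * real n" by simp
  have "(\<Sum>u\<in>C. e u * resp u q) \<le> (\<Sum>u\<in>C. e u * 2 ^ Suc j)"
    using cls e_nonneg by (intro sum_mono mult_left_mono) (auto simp: less_imp_le)
  also have "\<dots> = 2 ^ Suc j * (\<Sum>u\<in>C. e u)" by (simp only: sum_distrib_right[symmetric] mult.commute)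
  also have "\<dots> \<le> (16 * real L) * (real (card I) * ?Bd)"
    using jL sum e_nonneg by (intro mult_mono) (auto intro: sum_nonneg)
  also have "\<dots> = 16 * (real L * real (card I)) * ?Bd" by simp
  also have "\<dots> \<le> 16 * (3 * real n) * ?Bd" using LI Bd0 by (intro mult_right_mono mult_left_mono) auto
  finally show ?thesis by (simp add: n_def)
next
  case True
  have "0 \<le> ln (3 * real (q - p))" using pq by (intro ln_ge_zero) linarith
  then show ?thesis using True \<Gamma> G1 by (auto intro!: mult_nonneg_nonneg add_nonneg_nonneg)
qed

text \<open>
  Dyadic classes of the value of resp u q, of which there are at most 3 * lam. Steps below 1 / T are
  negligible altogether.
\<close>

lemma slow_mass:
  assumes pq: "p < q" "q \<le> H" and \<Gamma>: "1 \<le> \<Gamma>" and G1: "1 \<le> G"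
    and pos: "\<And>u. p < u \<Longrightarrow> u < q \<Longrightarrow> 1 / real T \<le> e u \<Longrightarrow> 0 < speed u"
    and no_pump: "\<And>u z. p < u \<Longrightarrow> 1 / real T \<le> e u \<Longrightarrow> u \<le> z \<Longrightarrow> z < q \<Longrightarrow> 3 / 4 * resp u H \<le> damp u z * resp z H
      \<Longrightarrow> speed z \<le> G * speed u * damp u z"
  defines "lam \<equiv> ln (6 * real T) + ln G"
  shows "(\<Sum>u\<in>{u \<in> {p<..<q}. e u < \<Gamma>}. e u * resp u q)
    \<le> (2 + 144 * (22 * \<Gamma> + 2100000)) * lam ^ 3 * (real (q - p) * sqrt (real (q - p)))"
proof -
  define n where "n = q - p"
  have n1: "1 \<le> n" "n \<le> 2 * T" using pq T2 by (auto simp: n_def)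
  have T0: "0 < real T" using T2 by simp
  have lnG: "0 \<le> ln G" using G1 by simp
  have "exp 1 \<le> 6 * real T" using e_less_272 T2 by linarith
  then have lam1: "1 \<le> lam" using lnG T0 by (simp add: lam_def ln_ge_iff add_increasing2)
  have l3n: "ln (3 * real n) \<le> lam" "0 \<le> ln (3 * real n)"
  proof -
    have "ln (3 * real n) \<le> ln (6 * real T)" using n1 by simp
    then show "ln (3 * real n) \<le> lam" using lnG by (simp add: lam_def)
    show "0 \<le> ln (3 * real n)" using n1 by (intro ln_ge_zero) linarith
  qed
  have sq1: "1 \<le> sqrt (real n)" using n1 by simp
  let ?Bd = "\<Gamma> + (20 * ln (3 * real n) * ln G + 1) * (100000 * sqrt (real n) + \<Gamma>)"
  have Bd: "?Bd \<le> (22 * \<Gamma> + 2100000) * lam ^ 2 * sqrt (real n)"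
  proof -
    have "ln G \<le> lam" using T2 by (simp add: lam_def)
    then have "ln (3 * real n) * ln G \<le> lam * lam" using l3n lnG lam1 by (intro mult_mono) auto
    moreover have "1 \<le> lam ^ 2" using lam1 by simp
    ultimately have a: "20 * ln (3 * real n) * ln G + 1 \<le> 21 * lam ^ 2" by (simp add: power2_eq_square)
    have "\<Gamma> * 1 \<le> \<Gamma> * sqrt (real n)" using \<Gamma> sq1 by (intro mult_left_mono) auto
    then have b: "100000 * sqrt (real n) + \<Gamma> \<le> (100000 + \<Gamma>) * sqrt (real n)" by (simp add: algebra_simps)
    have "(20 * ln (3 * real n) * ln G + 1) * (100000 * sqrt (real n) + \<Gamma>) \<le> (21 * lam ^ 2) * ((100000 + \<Gamma>) * sqrt (real n))"
      using a b \<Gamma> l3n lnG by (intro mult_mono) auto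
    moreover have "\<Gamma> * (1 * 1) \<le> \<Gamma> * (lam ^ 2 * sqrt (real n))"
      using \<Gamma> sq1 \<open>1 \<le> lam ^ 2\<close> by (intro mult_left_mono mult_mono) auto
    ultimately show ?thesis by (simp add: algebra_simps)
  qed
  let ?S = "{u \<in> {p<..<q}. e u < \<Gamma>}"
  define S1 where "S1 = {u \<in> {p<..<q}. e u < \<Gamma> \<and> 1 / real T \<le> e u}"
  define jj where "jj u = (LEAST j. resp u q < 2 ^ Suc j)" for u
  define J where "J = nat \<lfloor>3 / 2 * ln (real n)\<rfloor> + 1"
  have jj: "2 ^ jj u \<le> resp u q \<and> resp u q < 2 ^ Suc (jj u) \<and> jj u < J" if u: "u \<in> S1" for u
  proof -
    have K1: "1 \<le> resp u q" using u by (intro resp_ge_1) (auto simp: S1_def)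
    obtain m where "resp u q < 2 ^ m" using real_arch_pow[of 2 "resp u q"] by auto
    then have "resp u q < 2 ^ Suc m" by (rule less_le_trans) simp
    then have a: "resp u q < 2 ^ Suc (jj u)" unfolding jj_def by (rule LeastI)
    have b: "2 ^ jj u \<le> resp u q"
    proof (cases "jj u")
      case (Suc i)
      then have "i < jj u" by simp
      then have "\<not> resp u q < 2 ^ Suc i" unfolding jj_def by (rule not_less_Least)
      then show ?thesis using Suc by simp
    qed (use K1 in simp)
    also have "resp u q \<le> real (q - u)" by (rule resp_le)
    also have "\<dots> \<le> real n" using u by (auto simp: S1_def n_def)
    finally have "ln (2 ^ jj u) \<le> ln (real n)" by (intro ln_mono) auto
    then have "real (jj u) * ln 2 \<le> ln (real n)" by (simp add: ln_realpow)
    moreover have "real (jj u) * (2/3) \<le> real (jj u) * ln 2" using ln2_ge_two_thirds by (intro mult_left_mono) auto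
    ultimately have "real (jj u) \<le> 3 / 2 * ln (real n)" by linarith
    then have "jj u < J" unfolding J_def by linarith
    then show ?thesis using a b by blast
  qed
  have fin: "finite S1" "finite ?S" by (auto simp: S1_def)
  have "(\<Sum>u\<in>S1. e u * resp u q) = (\<Sum>j<J. \<Sum>u\<in>{u \<in> S1. jj u = j}. e u * resp u q)"
    using fin jj by (intro sum.group[symmetric]) auto
  also have "\<dots> \<le> (\<Sum>j<J. 48 * real n * ?Bd)"
  proof (rule sum_mono)
    fix j
    show "(\<Sum>u\<in>{u \<in> S1. jj u = j}. e u * resp u q) \<le> 48 * real n * ?Bd"
      unfolding n_def
    proof (rule slow_class[OF pq _ G1, where j = j])
      fix u assume u: "u \<in> {u \<in> S1. jj u = j}"
      then show "2 ^ j \<le> resp u q \<and> resp u q < 2 ^ Suc j" using jj[of u] by auto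
      show "e u < \<Gamma>" using u by (simp add: S1_def)
      show "0 < speed u" using u by (intro pos) (auto simp: S1_def)
      fix z assume "u \<le> z" "z < q" "3 / 4 * resp u H \<le> damp u z * resp z H"
      then show "speed z \<le> G * speed u * damp u z" using u by (intro no_pump) (auto simp: S1_def)
    qed (use \<Gamma> in \<open>auto simp: S1_def\<close>)
  qed
  also have "\<dots> = real J * (48 * real n * ?Bd)" by simp
  also have "\<dots> \<le> (3 * lam) * (48 * real n * ((22 * \<Gamma> + 2100000) * lam ^ 2 * sqrt (real n)))"
  proof (intro mult_mono Bd)
    have "ln (real n) \<le> ln (3 * real n)" "0 \<le> ln (real n)" using n1 by auto
    then have "real J \<le> 3 / 2 * lam + 1" unfolding J_def using l3n by linarith
    then show "real J \<le> 3 * lam" using lam1 by linarith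
    show "0 \<le> 48 * real n * ?Bd" using l3n lnG \<Gamma> by (intro mult_nonneg_nonneg add_nonneg_nonneg) auto
    show "0 \<le> ?Bd" using l3n lnG \<Gamma> by (intro mult_nonneg_nonneg add_nonneg_nonneg) auto
  qed (use lam1 in auto)
  also have "\<dots> = 144 * (22 * \<Gamma> + 2100000) * lam ^ 3 * (real n * sqrt (real n))" by (simp add: power3_eq_cube power2_eq_square)
  finally have main: "(\<Sum>u\<in>S1. e u * resp u q) \<le> 144 * (22 * \<Gamma> + 2100000) * lam ^ 3 * (real n * sqrt (real n))" .
  have "(\<Sum>u\<in>?S - S1. e u * resp u q) \<le> (\<Sum>u\<in>?S - S1. 1 / real T * real n)"
  proof (intro sum_mono mult_mono)
    fix u assume u: "u \<in> ?S - S1"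
    then show "e u \<le> 1 / real T" by (auto simp: S1_def)
    show "resp u q \<le> real n" using resp_le[of u q] u by (auto simp: n_def)
  qed (use resp_nonneg in auto)
  also have "\<dots> = real (card (?S - S1)) * (real n / real T)" by simp
  also have "\<dots> \<le> real n * 2"
  proof (intro mult_mono)
    have "card (?S - S1) \<le> card {p<..<q}" by (intro card_mono) auto
    then show "real (card (?S - S1)) \<le> real n" by (simp add: n_def)
    show "real n / real T \<le> 2" using n1 T0 by (simp add: field_simps)
  qed auto
  also have "\<dots> \<le> 2 * lam ^ 3 * (real n * sqrt (real n))"
  proof -
    have "1 \<le> lam ^ 3" using lam1 by simp
    then have "1 * 1 \<le> lam ^ 3 * sqrt (real n)" using sq1 lam1 by (intro mult_mono) auto
    then have "(real n * 2) * 1 \<le> (real n * 2) * (lam ^ 3 * sqrt (real n))" by (intro mult_left_mono) auto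
    then show ?thesis by (simp add: algebra_simps)
  qed
  finally have tiny: "(\<Sum>u\<in>?S - S1. e u * resp u q) \<le> 2 * lam ^ 3 * (real n * sqrt (real n))" .
  have "(\<Sum>u\<in>?S. e u * resp u q) = (\<Sum>u\<in>?S - S1. e u * resp u q) + (\<Sum>u\<in>S1. e u * resp u q)"
    by (rule sum.subset_diff) (auto simp: S1_def)
  then show ?thesis using main tiny unfolding n_def by (simp add: algebra_simps)
qed

end

section \<open>Heavy atoms have a large geometric mean\<close>

text \<open>
  Abel summation.
\<close>

lemma sum_weighted_nonneg:
  fixes x w :: "nat \<Rightarrow> real"
  assumes w0: "\<And>i. 0 \<le> w i" and mono: "\<And>i. w i \<le> w (Suc i)"
    and tails: "\<And>j. j < k \<Longrightarrow> 0 \<le> (\<Sum>i\<in>{j..<k}. x i)"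
  shows "0 \<le> (\<Sum>i\<in>{0..<k}. w i * x i)"
proof -
  have "j \<le> k \<Longrightarrow> w j * (\<Sum>i\<in>{j..<k}. x i) \<le> (\<Sum>i\<in>{j..<k}. w i * x i)" for j
  proof (induction rule: inc_induct)
    case (step j)
    have "0 \<le> (\<Sum>i\<in>{Suc j..<k}. x i)" using tails[of "Suc j"] by (cases "Suc j < k") auto
    then have "w j * (\<Sum>i\<in>{Suc j..<k}. x i) \<le> w (Suc j) * (\<Sum>i\<in>{Suc j..<k}. x i)"
      using mono by (intro mult_right_mono)
    then show ?case using step by (simp add: sum.atLeast_Suc_lessThan algebra_simps)
  qed simp
  from this[of 0] have "w 0 * (\<Sum>i\<in>{0..<k}. x i) \<le> (\<Sum>i\<in>{0..<k}. w i * x i)" by simp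
  moreover have "0 \<le> (\<Sum>i\<in>{0..<k}. x i)" using tails[of 0] by (cases "0 < k") auto
  ultimately show ?thesis using w0[of 0] by (smt (verit) mult_nonneg_nonneg)
qed

text \<open>
  If the tail sums of a dominate those of a', then so do the products: ln (a i) - ln (a' i) is at least
  (a i - a' i) / a i, and the weights 1 / a i increase.
\<close>

lemma sum_ln_mono_tails:
  fixes a a' :: "nat \<Rightarrow> real"
  assumes a: "\<And>i. 0 < a i" "\<And>i. a (Suc i) \<le> a i" and a': "\<And>i. 0 < a' i"
    and tails: "\<And>j. j < k \<Longrightarrow> (\<Sum>i\<in>{j..<k}. a' i) \<le> (\<Sum>i\<in>{j..<k}. a i)"
  shows "(\<Sum>i\<in>{0..<k}. ln (a' i)) \<le> (\<Sum>i\<in>{0..<k}. ln (a i))"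
proof -
  have "0 \<le> (\<Sum>i\<in>{0..<k}. (1 / a i) * (a i - a' i))"
  proof (rule sum_weighted_nonneg)
    show "1 / a i \<le> 1 / a (Suc i)" for i using a by (intro divide_left_mono) auto
    show "0 \<le> (\<Sum>i\<in>{j..<k}. a i - a' i)" if "j < k" for j using tails[OF that] by (simp add: sum_subtractf)
    show "0 \<le> 1 / a i" for i using a(1)[of i] by simp
  qed
  also have "\<dots> \<le> (\<Sum>i\<in>{0..<k}. ln (a i) - ln (a' i))"
  proof (rule sum_mono)
    fix i
    have "ln (a' i / a i) \<le> a' i / a i - 1" using a(1)[of i] a'[of i] by (intro ln_le_minus_one) simp
    then show "1 / a i * (a i - a' i) \<le> ln (a i) - ln (a' i)"
      using a(1)[of i] a'[of i] by (simp add: ln_div field_simps)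
  qed
  finally show ?thesis by (simp add: sum_subtractf)
qed

text \<open>
  The right-hand side is the integral of the logarithm, whose antiderivative is x ln x - x.
\<close>

lemma sum_ln_le_integral:
  fixes y h :: real
  assumes y: "0 < y" and h: "0 < h"
  shows "h * (\<Sum>i\<in>{0..<k}. ln (y + real i * h))
    \<le> ((y + real k * h) * ln (y + real k * h) - (y + real k * h)) - (y * ln y - y)"
proof (induction k)
  case (Suc k)
  define u where "u = y + real k * h"
  have u: "0 < u" using y h by (simp add: u_def add_pos_nonneg)
  have "ln (u / (u + h)) \<le> u / (u + h) - 1" using u h by (intro ln_le_minus_one) simp
  then have "(u + h) * (ln u - ln (u + h)) \<le> - h" using u h by (simp add: ln_div field_simps)
  then have "h * ln u \<le> ((u + h) * ln (u + h) - (u + h)) - (u * ln u - u)" by (simp add: algebra_simps)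
  moreover have "y + real (Suc k) * h = u + h" by (simp add: u_def algebra_simps)
  ultimately show ?case using Suc by (simp add: u_def[symmetric] algebra_simps)
qed simp

text \<open>
  The mean of ln (i / k) is about -1; shifting i by k div 200 changes it by less than 4/100.
\<close>

lemma sum_ln_shifted:
  fixes k i0 :: nat
  assumes k: "2000 \<le> k" and i0: "i0 = k div 200"
  shows "(\<Sum>i\<in>{0..<k}. ln (real (i + 1 + i0) / real k)) \<le> - (96/100) * real k"
proof -
  define y where "y = real (1 + i0) / real k"
  have kk: "real (200 * (1 + i0)) \<le> real (k + 200)" "real k \<le> real (200 * (1 + i0))"
  proof -
    have "200 * (1 + i0) \<le> k + 200" using i0 times_div_less_eq_dividend[of 200 k] by (simp add: algebra_simps)
    moreover have "k \<le> 200 * (1 + i0)" using i0 dividend_less_times_div[of 200 k] by (simp add: algebra_simps)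
    ultimately show "real (200 * (1 + i0)) \<le> real (k + 200)" "real k \<le> real (200 * (1 + i0))" by (blast intro: of_nat_mono)+
  qed
  have y: "1 / 200 \<le> y" "y \<le> 11 / 2000" "0 < y"
  proof -
    show 1: "1 / 200 \<le> y" using kk k by (simp add: y_def field_simps)
    then show "0 < y" by linarith
    have "2000 * real (1 + i0) \<le> 11 * real k" using kk k by simp
    then show "y \<le> 11 / 2000" using k by (simp add: y_def field_simps)
  qed
  have k0: "0 < real k" using k by simp
  have "(\<Sum>i\<in>{0..<k}. ln (real (i + 1 + i0) / real k)) = (\<Sum>i\<in>{0..<k}. ln (y + real i * (1 / real k)))"
    by (intro sum.cong) (auto simp: y_def add_divide_distrib add_ac)
  moreover have "(1 / real k) * (\<Sum>i\<in>{0..<k}. ln (y + real i * (1 / real k)))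
      \<le> ((y + real k * (1 / real k)) * ln (y + real k * (1 / real k)) - (y + real k * (1 / real k))) - (y * ln y - y)"
    using y k0 by (intro sum_ln_le_integral) auto
  ultimately have "(1 / real k) * (\<Sum>i\<in>{0..<k}. ln (real (i + 1 + i0) / real k))
      \<le> (y + 1) * ln (y + 1) - 1 - y * ln y" using k0 by simp
  also have "\<dots> \<le> - (96 / 100)"
  proof -
    have "(y + 1) * ln (y + 1) \<le> (y + 1) * y" using y ln_add_one_self_le_self[of y] by (intro mult_left_mono) (auto simp: add.commute)
    also have "\<dots> \<le> (11/2000 + 1) * (11/2000)" using y by (intro mult_mono) auto
    finally have 1: "(y + 1) * ln (y + 1) \<le> 6 / 1000" by simp
    have "ln (1 / y) \<le> ln (2 ^ 8)" using y by (intro ln_mono) (auto simp: field_simps)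
    also have "\<dots> = 8 * ln 2" by (subst ln_realpow) auto
    also have "\<dots> \<le> 8 * (25 / 36)" using ln2_le_25_over_36 by simp
    finally have "- ln y \<le> 56 / 10" using y by (simp add: ln_div)
    then have "y * (- ln y) \<le> (11 / 2000) * (56 / 10)" using y by (intro mult_mono) auto
    then show ?thesis using 1 by simp
  qed
  finally show ?thesis using k0 by (simp add: field_simps)
qed

lemma powr_tail_step:
  fixes x :: real
  assumes "0 < x" "0 < g"
  shows "g * (x + 1) powr (- 1 - g) \<le> x powr (- g) - (x + 1) powr (- g)"
proof -
  have "1 - g * ln (x / (x + 1)) \<le> exp (- (g * ln (x / (x + 1))))"
    using exp_ge_add_one_self[of "- (g * ln (x / (x + 1)))"] by simp
  also have "\<dots> = (x / (x + 1)) powr (- g)" using assms by (simp add: powr_def)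
  also have "\<dots> = x powr (- g) / (x + 1) powr (- g)" using assms by (simp add: powr_divide)
  finally have 1: "1 - g * ln (x / (x + 1)) \<le> x powr (- g) / (x + 1) powr (- g)" .
  have "ln (x / (x + 1)) \<le> x / (x + 1) - 1" using assms by (intro ln_le_minus_one) simp
  also have "\<dots> = - (1 / (x + 1))" using assms by (simp add: field_simps)
  finally have "g * ln (x / (x + 1)) \<le> g * (- (1 / (x + 1)))" using assms by (intro mult_left_mono) auto
  with 1 have "1 + g / (x + 1) \<le> x powr (- g) / (x + 1) powr (- g)" by simp
  then have "(1 + g / (x + 1)) * (x + 1) powr (- g) \<le> x powr (- g)" using assms by (simp add: field_simps)
  moreover have "(x + 1) powr (- 1 - g) = (x + 1) powr (- g) / (x + 1)"
    using assms powr_diff[of "x + 1" "- g" 1] by (simp add: minus_diff_commute)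
  ultimately show ?thesis by (simp add: algebra_simps)
qed

lemma ln_le_of_sum:
  fixes x :: "'a \<Rightarrow> real"
  assumes "finite Q" "\<And>i. i \<in> Q \<Longrightarrow> 0 < x i" "0 < m" "(\<Sum>i\<in>Q. x i) \<le> m * real (card Q)"
  shows "(\<Sum>i\<in>Q. ln (x i)) \<le> real (card Q) * ln m"
proof -
  have "(\<Sum>i\<in>Q. ln (x i)) \<le> (\<Sum>i\<in>Q. ln m + (x i / m - 1))"
  proof (rule sum_mono)
    fix i assume i: "i \<in> Q"
    have "ln (x i / m) \<le> x i / m - 1" using assms(2)[OF i] assms(3) by (intro ln_le_minus_one) simp
    then show "ln (x i) \<le> ln m + (x i / m - 1)" using assms(2)[OF i] assms(3) by (simp add: ln_div)
  qed
  also have "\<dots> = real (card Q) * ln m + (\<Sum>i\<in>Q. x i) / m - real (card Q)"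
    by (simp add: sum.distrib sum_subtractf sum_divide_distrib)
  also have "(\<Sum>i\<in>Q. x i) / m \<le> real (card Q)" using assms(3,4) by (simp add: field_simps)
  finally show ?thesis by linarith
qed


text \<open>
  In a step that coasts, the gain of an atom is only known to exceed a constant, because the atom counts with its
  step size and not with its weight. The constant is 100 times the bound 24000 for the terms of the reference
  sequence used below, so that capping the gain costs one per cent.
\<close>

definition gain_cap :: real where "gain_cap = 2400000"

abbreviation step_gain :: "real \<Rightarrow> real \<Rightarrow> real \<Rightarrow> real \<Rightarrow> real" where
  "step_gain L a m n \<equiv> min gain_cap (a / (2 * m + L * (n * sqrt n)))"

lemma mult_sqrt_le_exp:
  assumes "0 \<le> x" "0 < \<sigma>"
  shows "x * sqrt x \<le> \<sigma> * sqrt \<sigma> * exp (3 / 2 * (x / \<sigma>))"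
proof -
  define y where "y = x / \<sigma>"
  have y: "0 \<le> y" "x = \<sigma> * y" using assms by (auto simp: y_def)
  have ey: "y \<le> exp y" using exp_ge_add_one_self[of y] by linarith
  then have "sqrt y \<le> sqrt (exp (y / 2) ^ 2)" by (intro real_sqrt_le_mono) (simp add: exp_of_nat_mult[symmetric])
  then have "sqrt y \<le> exp (y / 2)" by simp
  then have "y * sqrt y \<le> exp y * exp (y / 2)" using ey y by (intro mult_mono) auto
  also have "\<dots> = exp (3 / 2 * y)" by (simp add: exp_add[symmetric])
  finally have "(\<sigma> * sqrt \<sigma>) * (y * sqrt y) \<le> (\<sigma> * sqrt \<sigma>) * exp (3 / 2 * y)"
    using assms by (intro mult_left_mono) auto
  then show ?thesis using y by (simp add: real_sqrt_mult y_def[symmetric] mult_ac)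
qed

text \<open>
  A discrete version of the integral of x powr (-8/5). The shift i0 keeps the first terms bounded.
\<close>

lemma reference_tails:
  fixes k i0 j :: nat and R :: real
  assumes "1 \<le> i0" "j \<le> k" and R: "0 \<le> R"
  shows "(\<Sum>i\<in>{j..<k}. 3 / 5 * (R / real k) * (real k / real (i + 1 + i0)) powr (8/5))
    \<le> R * ((real k / real (j + i0)) powr (3/5) - (real k / real (k + i0)) powr (3/5))"
  using assms(2)
proof (induction rule: inc_induct)
  case (step j)
  define x where "x = real (j + i0)"
  have x: "0 < x" "0 < real k" using assms(1) step(2) by (auto simp: x_def)
  have p: "(real k / y) powr r = real k powr r * y powr (- r)" if "0 < y" for y r :: real
    using that x by (simp add: powr_divide powr_minus_divide)
  have "real k powr (8/5) = real k powr (3/5) * real k"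
    using x powr_add[of "real k" "3/5" 1] by simp
  then have "3 / 5 * (R / real k) * (real k / (x + 1)) powr (8/5)
      = R * real k powr (3/5) * (3/5 * (x + 1) powr (- 1 - 3/5))"
    using x p[of "x + 1" "8/5"] by simp
  also have "\<dots> \<le> R * real k powr (3/5) * (x powr (- (3/5)) - (x + 1) powr (- (3/5)))"
    using x R powr_tail_step[of x "3/5"] by (intro mult_left_mono) auto
  also have "\<dots> = R * ((real k / x) powr (3/5) - (real k / (x + 1)) powr (3/5))"
    using x p[of x "3/5"] p[of "x + 1" "3/5"] by (simp add: algebra_simps)
  finally have "3 / 5 * (R / real k) * (real k / (x + 1)) powr (8/5)
      \<le> R * ((real k / x) powr (3/5) - (real k / (x + 1)) powr (3/5))" .
  moreover have "real (j + 1 + i0) = x + 1" "real (Suc j + i0) = x + 1" by (simp_all add: x_def)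
  ultimately show ?case using step by (simp add: sum.atLeast_Suc_lessThan x_def[symmetric] algebra_simps)
qed simp

text \<open>
  Cap the atoms at Q = 24000 R / k. The tails of the capped sequence dominate those of the reference sequence a0 with
  a0 i = (3/5) (R / k) (k / (i + 1 + i0)) powr (8/5), whose logarithms have a mean of at least
  ln ((3/5) R / k) + 1.536. In the denominators n * sqrt n is not additive, so a length above the scale
  sigma = 100 T / k is traded for a factor exp (3/2 * n / sigma), and these factors multiply to at most
  exp (0.015 k). What is left has an arithmetic mean of at most 2.02 R / k, and 2.02 / 0.6 < exp 1.5.
\<close>

lemma balanced_gain:
  fixes a m n :: "nat \<Rightarrow> real" and k :: nat and R T L :: real
  assumes k: "2000 \<le> k" and R: "0 < R" and T: "0 < T" and L: "0 < L"
    and a_pos: "\<And>i. i < k \<Longrightarrow> 0 < a i" and a_anti: "\<And>i j. i \<le> j \<Longrightarrow> j < k \<Longrightarrow> a j \<le> a i"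
    and tails: "\<And>j. 1 \<le> j \<Longrightarrow> j < k \<Longrightarrow> R * ((real k / real j) powr (3/5) - 1) \<le> (\<Sum>i\<in>{j..<k}. a i)"
    and n: "\<And>i. i < k \<Longrightarrow> 1 \<le> n i" and m: "\<And>i. i < k \<Longrightarrow> 0 \<le> m i"
    and sum_n: "(\<Sum>i\<in>{0..<k}. n i) \<le> T" and sum_m: "(\<Sum>i\<in>{0..<k}. m i) \<le> R"
    and small: "real k * (L * ((100 * T / real k) * sqrt (100 * T / real k))) \<le> R / 100"
  shows "1 \<le> (\<Prod>i\<in>{0..<k}. step_gain L (a i) (m i) (n i))"
proof -
  define i0 where "i0 = k div 200"
  define Q where "Q = 24000 * R / real k"
  define aQ where "aQ i = min (a (min i (k - 1))) Q" for i
  define a0 where "a0 i = 3 / 5 * (R / real k) * (real k / real (i + 1 + i0)) powr (8/5)" for i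
  have k0: "0 < real k" using k by simp
  have i0: "10 \<le> i0" using k by (simp add: i0_def)
  have Q0: "0 < Q" using R k0 by (simp add: Q_def)
  have mk: "min i (k - 1) < k" for i using k by auto
  have aQ_pos: "0 < aQ i" for i using a_pos[OF mk] Q0 by (simp add: aQ_def)
  have aQ_eq: "aQ i = min (a i) Q" if "i < k" for i using that min_absorb1[of i "k - 1"] by (simp add: aQ_def)
  have aQ_anti: "aQ (Suc i) \<le> aQ i" for i
    unfolding aQ_def by (intro min.mono a_anti mk) auto
  have a0_pos: "0 < a0 i" for i using R k0 by (simp add: a0_def)
  have a0_le: "a0 i \<le> Q" for i
  proof -
    have "k \<le> 200 * (i + 1 + i0)" by (simp add: i0_def)
    then have "real k \<le> real (200 * (i + 1 + i0))" by (rule of_nat_mono)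
    then have "real k / real (i + 1 + i0) \<le> 200" by (simp add: field_simps)
    then have "(real k / real (i + 1 + i0)) powr (8/5) \<le> 200 powr (8/5)" using k0 by (intro powr_mono2) auto
    also have "\<dots> \<le> 200 powr 2" by (intro powr_mono) auto
    also have "\<dots> = 40000" by simp
    finally have "a0 i \<le> 3 / 5 * (R / real k) * 40000" unfolding a0_def using R k0 by (intro mult_left_mono) auto
    then show ?thesis by (simp add: Q_def)
  qed
  \<comment> \<open>downwards in j: where the cap is active it dominates a0 j, elsewhere the hypothesis on the tails applies\<close>
  have dom: "j \<le> k \<Longrightarrow> (\<Sum>i\<in>{j..<k}. a0 i) \<le> (\<Sum>i\<in>{j..<k}. aQ i)" for j
  proof (induction rule: inc_induct)
    case (step j)
    show ?case
    proof (cases "Q < a j")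
      case True
      then have "aQ j = Q" using step(2) by (simp add: aQ_eq)
      then show ?thesis using step a0_le[of j] by (simp add: sum.atLeast_Suc_lessThan)
    next
      case False
      have eq: "(\<Sum>i\<in>{j..<k}. aQ i) = (\<Sum>i\<in>{j..<k}. a i)"
      proof (rule sum.cong)
        fix i assume i: "i \<in> {j..<k}"
        then have "a i \<le> a j" by (intro a_anti) auto
        then show "aQ i = a i" using i False by (simp add: aQ_eq)
      qed simp
      have ref: "(\<Sum>i\<in>{j..<k}. a0 i)
          \<le> R * ((real k / real (j + i0)) powr (3/5) - (real k / real (k + i0)) powr (3/5))"
        unfolding a0_def using i0 step(2) R by (intro reference_tails) auto
      also have "\<dots> \<le> (\<Sum>i\<in>{j..<k}. a i)"
      proof (cases "j = 0")
        case True
        define r where "r = (real k / real i0) powr (3/5)"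
        have two: "2 \<le> real N powr (3/5)" if "4 \<le> N" for N :: nat
        proof -
          have "2 = 4 powr (1/2 :: real)" by (simp add: powr_half_sqrt)
          also have "\<dots> \<le> 4 powr (3/5)" by (intro powr_mono) auto
          also have "\<dots> \<le> real N powr (3/5)" using that by (intro powr_mono2) auto
          finally show ?thesis .
        qed
        have "r * 2 \<le> r * real i0 powr (3/5)" using two[of i0] i0 by (intro mult_left_mono) (auto simp: r_def)
        also have "\<dots> = real k powr (3/5)" using i0 k0 by (simp add: r_def powr_divide)
        finally have "r \<le> real k powr (3/5) - 1" using two[of k] k by simp
        then have "R * (r - (real k / real (k + i0)) powr (3/5)) \<le> R * (real k powr (3/5) - 1)"
        proof (intro mult_left_mono)
          have "0 \<le> (real k / real (k + i0)) powr (3/5)" by simp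
          then show "r - (real k / real (k + i0)) powr (3/5) \<le> real k powr (3/5) - 1"
            using \<open>r \<le> real k powr (3/5) - 1\<close> by linarith
        qed (use R in simp)
        also have "\<dots> \<le> (\<Sum>i\<in>{1..<k}. a i)" using tails[of 1] k by simp
        also have "\<dots> \<le> (\<Sum>i\<in>{0..<k}. a i)" using a_pos by (intro sum_mono2) (auto simp: less_imp_le)
        finally show ?thesis using True by (simp add: r_def)
      next
        case j: False
        have split: "(real k / real (j + i0)) powr (3/5) = (real k / real j) powr (3/5) * (real j / real (j + i0)) powr (3/5)"
          using j k0 by (simp add: powr_mult[symmetric])
        have 1: "1 \<le> (real k / real j) powr (3/5)" using j step(2) by (intro ge_one_powr_ge_zero) auto
        have 2: "(real j / real (j + i0)) powr (3/5) \<le> (real k / real (k + i0)) powr (3/5)"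
          using j step(2) k0 by (intro powr_mono2) (auto simp: field_simps intro!: mult_left_mono)
        have "real k / real (k + i0) \<le> 1" using k0 by simp
        then have 3: "(real k / real (k + i0)) powr (3/5) \<le> 1" using k0 by (intro powr_le1) auto
        define K where "K = (real k / real j) powr (3/5)"
        define x where "x = (real j / real (j + i0)) powr (3/5)"
        define y where "y = (real k / real (k + i0)) powr (3/5)"
        have "1 * (1 - y) \<le> K * (1 - x)" using 1 2 3 unfolding K_def x_def y_def by (intro mult_mono) auto
        then have "K * x - y \<le> K - 1" by (simp add: algebra_simps)
        then have "R * (K * x - y) \<le> R * (K - 1)" using R by (intro mult_left_mono) auto
        also have "\<dots> \<le> (\<Sum>i\<in>{j..<k}. a i)" unfolding K_def using j step(2) by (intro tails) auto
        finally show ?thesis using split by (simp add: K_def x_def y_def)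
      qed
      finally show ?thesis using eq by simp
    qed
  qed simp
  have "(\<Sum>i\<in>{0..<k}. ln (a0 i)) \<le> (\<Sum>i\<in>{0..<k}. ln (aQ i))"
    using dom by (intro sum_ln_mono_tails aQ_pos aQ_anti a0_pos) auto
  moreover have "(\<Sum>i\<in>{0..<k}. ln (a0 i))
      = real k * ln (3 / 5 * (R / real k)) - 8 / 5 * (\<Sum>i\<in>{0..<k}. ln (real (i + 1 + i0) / real k))"
  proof -
    have "ln (a0 i) = ln (3 / 5 * (R / real k)) - 8 / 5 * ln (real (i + 1 + i0) / real k)" for i
    proof -
      have "ln (real k / real (i + 1 + i0)) = - ln (real (i + 1 + i0) / real k)" using k0 by (simp add: ln_div)
      then show ?thesis unfolding a0_def using R k0 by (subst ln_mult) (auto simp: ln_powr)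
    qed
    then show ?thesis by (simp add: sum_subtractf sum_distrib_left)
  qed
  ultimately have upper: "real k * ln (3 / 5 * (R / real k)) + 1536 / 1000 * real k \<le> (\<Sum>i\<in>{0..<k}. ln (aQ i))"
    using sum_ln_shifted[OF k i0_def] by linarith
  define \<sigma> where "\<sigma> = 100 * T / real k"
  define Y where "Y = L * (\<sigma> * sqrt \<sigma>)"
  define c where "c i = 2 * m i + Y + Q / gain_cap" for i
  define D where "D i = 2 * m i + L * (n i * sqrt (n i))" for i
  have \<sigma>0: "0 < \<sigma>" using T k0 by (simp add: \<sigma>_def)
  have Y0: "0 < Y" using L \<sigma>0 by (simp add: Y_def)
  have gc: "0 < gain_cap" by (simp add: gain_cap_def)
  have D0: "0 < D i" if "i < k" for i
    using m[OF that] n[OF that] L unfolding D_def by (intro add_nonneg_pos mult_pos_pos) auto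
  have c0: "0 < c i" if "i < k" for i using m[OF that] Y0 Q0 gc unfolding c_def by (intro add_nonneg_pos add_nonneg_pos) (auto intro: add_nonneg_nonneg)
  have DQ: "0 < D i + Q / gain_cap" if "i < k" for i using D0[OF that] Q0 gc by (intro add_pos_pos divide_pos_pos)
  have lnD: "ln (D i + Q / gain_cap) \<le> ln (c i) + 3 / 2 * (n i / \<sigma>)" if i: "i < k" for i
  proof -
    have E1: "1 \<le> exp (3 / 2 * (n i / \<sigma>))" using n[OF i] \<sigma>0 by simp
    have "L * (n i * sqrt (n i)) \<le> L * (\<sigma> * sqrt \<sigma> * exp (3 / 2 * (n i / \<sigma>)))"
      using n[OF i] \<sigma>0 L by (intro mult_left_mono mult_sqrt_le_exp) auto
    moreover have "(2 * m i + Q / gain_cap) * 1 \<le> (2 * m i + Q / gain_cap) * exp (3 / 2 * (n i / \<sigma>))"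
      using E1 m[OF i] Q0 gc by (intro mult_left_mono) auto
    ultimately have "D i + Q / gain_cap \<le> c i * exp (3 / 2 * (n i / \<sigma>))"
      by (simp add: D_def c_def Y_def algebra_simps)
    then have "ln (D i + Q / gain_cap) \<le> ln (c i * exp (3 / 2 * (n i / \<sigma>)))"
      using DQ[OF i] by (intro ln_mono) auto
    then show ?thesis using c0[OF i] by (simp add: ln_mult)
  qed
  have "(\<Sum>i\<in>{0..<k}. ln (c i)) \<le> real (card {0..<k}) * ln (202 / 100 * (R / real k))"
  proof (rule ln_le_of_sum)
    have "(\<Sum>i\<in>{0..<k}. c i) = 2 * (\<Sum>i\<in>{0..<k}. m i) + real k * Y + real k * (Q / gain_cap)"
      by (simp add: c_def sum.distrib sum_distrib_left)
    moreover have "real k * (Q / gain_cap) = R / 100" using k0 by (simp add: Q_def gain_cap_def)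
    moreover have "real k * Y \<le> R / 100" using small by (simp add: Y_def \<sigma>_def)
    ultimately show "(\<Sum>i\<in>{0..<k}. c i) \<le> 202 / 100 * (R / real k) * real (card {0..<k})"
      using sum_m k0 by simp
  qed (use c0 R k0 in auto)
  moreover have "(\<Sum>i\<in>{0..<k}. 3 / 2 * (n i / \<sigma>)) \<le> 3 / 200 * real k"
  proof -
    have "(\<Sum>i\<in>{0..<k}. 3 / 2 * (n i / \<sigma>)) = 3 / 2 * ((\<Sum>i\<in>{0..<k}. n i) / \<sigma>)"
      by (simp add: sum_distrib_left sum_divide_distrib)
    also have "\<dots> \<le> 3 / 2 * (T / \<sigma>)" using sum_n \<sigma>0 by (intro mult_left_mono divide_right_mono) auto
    also have "\<dots> = 3 / 200 * real k" using T k0 by (simp add: \<sigma>_def)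
    finally show ?thesis .
  qed
  ultimately have lower: "(\<Sum>i\<in>{0..<k}. ln (c i) + 3 / 2 * (n i / \<sigma>))
      \<le> real k * ln (202 / 100 * (R / real k)) + 3 / 200 * real k"
    by (simp add: sum.distrib)
  have gain: "ln (aQ i) - (ln (c i) + 3 / 2 * (n i / \<sigma>)) \<le> ln (min gain_cap (a i / D i))" if i: "i < k" for i
  proof -
    have "aQ i * D i \<le> a i * (D i + Q / gain_cap)"
      using aQ_eq[OF i] D0[OF i] a_pos[OF i] Q0 gc by (intro mult_mono) auto
    then have "aQ i / (D i + Q / gain_cap) \<le> a i / D i" using D0[OF i] DQ[OF i] by (simp add: divide_le_eq pos_le_divide_eq mult.commute)
    moreover have "aQ i / (D i + Q / gain_cap) \<le> gain_cap"
    proof -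
      have "aQ i \<le> gain_cap * (Q / gain_cap)" using aQ_eq[OF i] gc by simp
      also have "\<dots> \<le> gain_cap * (D i + Q / gain_cap)" using D0[OF i] gc by (intro mult_left_mono) auto
      finally show ?thesis using DQ[OF i] by (simp add: divide_le_eq)
    qed
    ultimately have "aQ i / (D i + Q / gain_cap) \<le> min gain_cap (a i / D i)" by simp
    then have "ln (aQ i / (D i + Q / gain_cap)) \<le> ln (min gain_cap (a i / D i))"
      using aQ_pos[of i] DQ[OF i] by (intro ln_mono) auto
    moreover have "ln (aQ i / (D i + Q / gain_cap)) = ln (aQ i) - ln (D i + Q / gain_cap)"
      using aQ_pos[of i] DQ[OF i] by (simp add: ln_div)
    ultimately show ?thesis using lnD[OF i] by linarith
  qed
  have pos: "0 < min gain_cap (a i / D i)" if "i < k" for i using D0[OF that] a_pos[OF that] gc by simp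
  have num: "0 \<le> ln (3 / 5 * (R / real k)) + 1536 / 1000 - (ln (202 / 100 * (R / real k)) + 3 / 200)"
  proof -
    have "(202 / 60 :: real) \<le> 1 + 3/2 + (3/2)\<^sup>2 / 2" by (simp add: power2_eq_square)
    also have "\<dots> \<le> exp (3/2)" by (rule exp_lower_Taylor_quadratic) simp
    finally have "ln (202 / 60) \<le> ln (exp (3/2 :: real))" by (intro ln_mono) auto
    then have "ln (202 / 60) \<le> (3/2 :: real)" by simp
    moreover have "ln (202 / 60 * (3 / 5 * (R / real k))) = ln (202 / 60) + ln (3 / 5 * (R / real k))"
      using R k0 by (subst ln_mult) auto
    ultimately show ?thesis by simp
  qed
  have "0 \<le> real k * (ln (3 / 5 * (R / real k)) + 1536 / 1000 - (ln (202 / 100 * (R / real k)) + 3 / 200))"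
    using num by (intro mult_nonneg_nonneg) auto
  also have "\<dots> \<le> (\<Sum>i\<in>{0..<k}. ln (aQ i)) - (\<Sum>i\<in>{0..<k}. ln (c i) + 3 / 2 * (n i / \<sigma>))"
    using upper lower by (simp add: algebra_simps)
  also have "\<dots> \<le> (\<Sum>i\<in>{0..<k}. ln (min gain_cap (a i / D i)))"
    unfolding sum_subtractf[symmetric] using gain by (intro sum_mono) auto
  also have "\<dots> = ln (\<Prod>i\<in>{0..<k}. min gain_cap (a i / D i))"
  proof -
    define g where "g i = min gain_cap (a i / D i)" for i
    have "0 < g i" "g i \<noteq> 0" if "i \<in> {0..<k}" for i using pos[of i] that unfolding g_def by auto
    then show ?thesis unfolding g_def[symmetric] by (intro ln_prod[symmetric]) simp_all
  qed
  finally have "1 \<le> (\<Prod>i\<in>{0..<k}. min gain_cap (a i / D i))"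
    using pos by (subst (asm) ln_ge_zero_iff) (auto intro!: prod_pos)
  then show ?thesis by (simp add: D_def)
qed


text \<open>
  With fewer than 2000 atoms in front, the estimate for the geometric mean is not available. Then each of them
  may multiply the tail by 4. The factor 100000 is that of the threshold Omega below.
\<close>

definition head_cost :: real where "head_cost = 4 ^ 2000 * 100000"

lemma head_cost_ge: "k \<le> 2000 \<Longrightarrow> 4 ^ k * 100000 \<le> head_cost"
  unfolding head_cost_def by (intro mult_right_mono power_increasing) auto

text \<open>
  Let k be the first index behind which the sorted atoms have a tail below Omega * k powr (-3/5).
  If k is at least 2000, the k heaviest atoms satisfy the hypothesis of balanced_gain with R equal to that bound.
  Otherwise go back from k to 0: a set whose product is below 1 contains an atom that is smaller than its
  denominator, hence at most three times the bound for the tail, and so is the smallest atom of the set. In this way the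
  tails at most quadruple, the total is at most X, and the empty set, whose product is 1, gives the contradiction.
\<close>

lemma no_atoms_without_gain:
  fixes s :: "'a \<Rightarrow> real" and T :: nat and L X :: real
  assumes A: "finite A" "card A \<le> T" and T: "1 \<le> T" and s_pos: "\<And>u. u \<in> A \<Longrightarrow> 0 < s u" and L: "1 \<le> L"
    and X: "head_cost * (L * real T powr (8/5)) \<le> X"
    and no_gain: "\<And>Q. Q \<subseteq> A \<Longrightarrow> (\<Sum>u\<in>A - Q. s u) \<le> X \<Longrightarrow>
      \<exists>n m. (\<forall>q\<in>Q. 1 \<le> n q \<and> 0 \<le> m q) \<and> (\<Sum>q\<in>Q. n q) \<le> real T \<and> (\<Sum>q\<in>Q. m q) \<le> (\<Sum>u\<in>A - Q. s u)
        \<and> (\<Prod>q\<in>Q. step_gain L (s q) (m q) (n q)) < 1"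
  shows False
proof -
  obtain ys where ys: "set ys = A" "distinct ys" using finite_distinct_list[OF A(1)] by blast
  define xs where "xs = sort_key (\<lambda>u. - s u) ys"
  have xs: "set xs = A" "distinct xs" "sorted (map (\<lambda>u. - s u) xs)" using ys by (auto simp: xs_def)
  define N where "N = length xs"
  have NT: "N \<le> T" using A(2) xs(1,2) distinct_card[of xs] by (simp add: N_def)
  define a where "a i = s (xs ! i)" for i
  have a_pos: "0 < a i" if "i < N" for i using that xs(1) s_pos by (auto simp: a_def N_def)
  have a_anti: "a j \<le> a i" if "i \<le> j" "j < N" for i j
    using sorted_nth_mono[OF xs(3), of i j] that by (simp add: a_def N_def)
  define tail where "tail j = (\<Sum>i\<in>{j..<N}. a i)" for j
  define \<Omega> where "\<Omega> = 100000 * (L * real T powr (8/5))"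
  have T1: "1 \<le> real T powr (8/5)" using T by (intro ge_one_powr_ge_zero) auto
  have "1 * 1 \<le> L * real T powr (8/5)" using T1 L by (intro mult_mono) auto
  then have \<Omega>0: "0 < \<Omega>" by (simp add: \<Omega>_def)
  have \<Omega>X: "4 ^ j * \<Omega> \<le> X" if "j \<le> 2000" for j
  proof -
    have "(4 ^ j * 100000) * (L * real T powr (8/5)) \<le> head_cost * (L * real T powr (8/5))"
      using head_cost_ge[OF that] L by (intro mult_right_mono) auto
    then show ?thesis using X by (simp add: \<Omega>_def mult.assoc)
  qed
  have TT: "L * (real T * sqrt (real T)) \<le> \<Omega>"
  proof -
    have "real T * sqrt (real T) = real T powr (1 + 1/2)" using T powr_add[of "real T" 1 "1/2"] by (simp only: powr_half_sqrt) simp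
    also have "\<dots> \<le> real T powr (8/5)" using T by (intro powr_mono) auto
    finally have "L * (real T * sqrt (real T)) \<le> L * real T powr (8/5)" using L by (intro mult_left_mono) auto
    also have "\<dots> \<le> \<Omega>" using L by (simp add: \<Omega>_def)
    finally show ?thesis .
  qed
  have no_head: "\<exists>n m. (\<forall>i<j. 1 \<le> n i \<and> 0 \<le> m i) \<and> (\<Sum>i\<in>{0..<j}. n i) \<le> real T \<and> (\<Sum>i\<in>{0..<j}. m i) \<le> tail j
        \<and> (\<Prod>i\<in>{0..<j}. step_gain L (a i) (m i) (n i)) < 1"
    if j: "j \<le> N" "tail j \<le> X" for j
  proof -
    let ?Q = "(!) xs ` {0..<j}"
    have inj: "inj_on ((!) xs) {0..<N}" using xs(2) by (simp add: N_def inj_on_nth)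
    have inj': "inj_on ((!) xs) {0..<j}" "inj_on ((!) xs) {j..<N}"
      using inj j(1) by (auto intro: inj_on_subset)
    have AN: "A = (!) xs ` {0..<N}" using xs(1) by (auto simp: N_def set_conv_nth)
    have QA: "?Q \<subseteq> A" unfolding AN using j(1) by auto
    have "A - ?Q = (!) xs ` ({0..<N} - {0..<j})" unfolding AN using inj j(1) by (intro inj_on_image_set_diff[symmetric]) auto
    also have "{0..<N} - {0..<j} = {j..<N}" using j(1) by auto
    finally have t: "(\<Sum>u\<in>A - ?Q. s u) = tail j" using inj'(2) by (simp add: sum.reindex tail_def a_def)
    obtain n m where nm: "\<forall>q\<in>?Q. 1 \<le> n q \<and> 0 \<le> m q" "(\<Sum>q\<in>?Q. n q) \<le> real T" "(\<Sum>q\<in>?Q. m q) \<le> (\<Sum>u\<in>A - ?Q. s u)"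
      "(\<Prod>q\<in>?Q. step_gain L (s q) (m q) (n q)) < 1"
      using no_gain[OF QA] t j(2) by auto
    show ?thesis
    proof (intro exI conjI)
      show "\<forall>i<j. 1 \<le> (n \<circ> (!) xs) i \<and> 0 \<le> (m \<circ> (!) xs) i" using nm(1) by auto
      show "(\<Sum>i\<in>{0..<j}. (n \<circ> (!) xs) i) \<le> real T" "(\<Sum>i\<in>{0..<j}. (m \<circ> (!) xs) i) \<le> tail j"
        using nm(2,3) t inj'(1) by (simp_all add: sum.reindex)
      show "(\<Prod>i\<in>{0..<j}. step_gain L (a i) ((m \<circ> (!) xs) i) ((n \<circ> (!) xs) i)) < 1"
        using nm(4) inj'(1) by (simp add: prod.reindex a_def)
    qed
  qed
  have N0: "1 \<le> N"
  proof (rule ccontr)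
    assume "\<not> 1 \<le> N"
    then have "tail 0 = 0" by (simp add: tail_def)
    then show False using no_head[of 0] \<Omega>X[of 0] \<Omega>0 by auto
  qed
  define k where "k = (LEAST k. 1 \<le> k \<and> tail k < \<Omega> * real k powr (- (3/5)))"
  have ex: "1 \<le> N \<and> tail N < \<Omega> * real N powr (- (3/5))" using N0 \<Omega>0 by (simp add: tail_def)
  have kN: "k \<le> N" unfolding k_def using ex by (rule Least_le)
  have k: "1 \<le> k" "tail k < \<Omega> * real k powr (- (3/5))" using LeastI[of "\<lambda>k. 1 \<le> k \<and> tail k < \<Omega> * real k powr (- (3/5))", OF ex] unfolding k_def by auto
  have before: "\<Omega> * real j powr (- (3/5)) \<le> tail j" if "1 \<le> j" "j < k" for j
    using not_less_Least[OF that(2)[unfolded k_def]] that(1) by auto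
  define R where "R = \<Omega> * real k powr (- (3/5))"
  have k0: "0 < real k" using k by simp
  have R0: "0 < R" using \<Omega>0 k0 by (simp add: R_def)
  have "real k powr (- (3/5)) \<le> real k powr 0" using k by (intro powr_mono) auto
  then have "R \<le> \<Omega> * 1" unfolding R_def using \<Omega>0 k0 by (intro mult_left_mono) auto
  then have tk: "tail k \<le> \<Omega>" using k by (simp add: R_def)
  have tail_split: "tail j = (\<Sum>i\<in>{j..<l}. a i) + tail l" if "j \<le> l" "l \<le> N" for j l
    unfolding tail_def using that by (simp add: sum.atLeastLessThan_concat)
  show False
  proof (cases "2000 \<le> k")
    case True
    obtain n m where nm: "\<forall>i<k. 1 \<le> n i \<and> 0 \<le> m i" "(\<Sum>i\<in>{0..<k}. n i) \<le> real T" "(\<Sum>i\<in>{0..<k}. m i) \<le> tail k"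
      and lt: "(\<Prod>i\<in>{0..<k}. step_gain L (a i) (m i) (n i)) < 1"
      using no_head[OF kN] tk \<Omega>X[of 0] by auto
    have "1 \<le> (\<Prod>i\<in>{0..<k}. step_gain L (a i) (m i) (n i))"
    proof (rule balanced_gain[OF True R0])
      show "0 < real T" "0 < L" using T L by auto
      show "0 < a i" if "i < k" for i using that kN by (intro a_pos) auto
      show "a j \<le> a i" if "i \<le> j" "j < k" for i j using that kN by (intro a_anti) auto
      show "R * ((real k / real j) powr (3/5) - 1) \<le> (\<Sum>i\<in>{j..<k}. a i)" if j: "1 \<le> j" "j < k" for j
      proof -
        have "R * (real k / real j) powr (3/5) = \<Omega> * real j powr (- (3/5))"
          using j k0 by (simp add: R_def powr_divide powr_minus_divide)
        then have "R * ((real k / real j) powr (3/5) - 1) = \<Omega> * real j powr (- (3/5)) - R" by (simp add: algebra_simps)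
        then show ?thesis using before[OF j] k(2) tail_split[of j k] j kN by (simp add: R_def)
      qed
      show "1 \<le> n i" "0 \<le> m i" if "i < k" for i using nm(1) that by auto
      show "(\<Sum>i\<in>{0..<k}. n i) \<le> real T" by (rule nm(2))
      show "(\<Sum>i\<in>{0..<k}. m i) \<le> R" using nm(3) k(2) by (simp add: R_def)
      have "sqrt (real T / real k) = (real T / real k) powr (1/2)" by (simp add: powr_half_sqrt)
      also have "\<dots> \<le> (real T / real k) powr (3/5)" using kN NT k0 by (intro powr_mono) auto
      finally have "(1000 * L * real T) * sqrt (real T / real k) \<le> (1000 * L * real T) * (real T / real k) powr (3/5)"
        using L by (intro mult_left_mono) auto
      also have "\<dots> = R / 100"
      proof -
        have "real T powr (8/5) = real T powr (3/5) * real T" using T powr_add[of "real T" "3/5" 1] by simp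
        then show ?thesis using k0 by (simp add: R_def \<Omega>_def powr_divide powr_minus_divide)
      qed
      also have "(1000 * L * real T) * sqrt (real T / real k)
          = real k * (L * ((100 * real T / real k) * sqrt (100 * real T / real k)))"
      proof -
        have "100 * real T / real k = 100 * (real T / real k)" by simp
        then have "sqrt (100 * real T / real k) = 10 * sqrt (real T / real k)" by (simp only: real_sqrt_mult) (simp add: real_sqrt_unique)
        then show ?thesis using k0 by simp
      qed
      finally show "real k * (L * ((100 * real T / real k) * sqrt (100 * real T / real k))) \<le> R / 100" .
    qed
    then show False using lt by simp
  next
    case False
    have "i \<le> k \<Longrightarrow> tail (k - i) \<le> 4 ^ i * \<Omega>" for i
    proof (induction i)
      case (Suc i)
      define j where "j = k - i"
      have j: "1 \<le> j" "j \<le> N" "k - Suc i = j - 1" using Suc.prems kN by (auto simp: j_def)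
      have IH: "tail j \<le> 4 ^ i * \<Omega>" using Suc by (simp add: j_def)
      moreover have "4 ^ i * \<Omega> \<le> X" using False Suc.prems by (intro \<Omega>X) auto
      ultimately obtain n m where nm: "\<forall>i<j. 1 \<le> n i \<and> 0 \<le> m i" "(\<Sum>i\<in>{0..<j}. n i) \<le> real T" "(\<Sum>i\<in>{0..<j}. m i) \<le> tail j"
        and lt: "(\<Prod>i\<in>{0..<j}. step_gain L (a i) (m i) (n i)) < 1"
        using no_head[OF j(2)] by (meson order_trans)
      have "\<exists>i<j. step_gain L (a i) (m i) (n i) < 1"
      proof (rule ccontr)
        assume "\<not> ?thesis"
        then have "1 \<le> step_gain L (a i) (m i) (n i)" if "i < j" for i
          using that by (meson not_less)
        then have "1 \<le> (\<Prod>i\<in>{0..<j}. step_gain L (a i) (m i) (n i))"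
          by (intro prod_ge_1) simp
        then show False using lt by simp
      qed
      then obtain l where l: "l < j" "a l / (2 * m l + L * (n l * sqrt (n l))) < 1" by (auto simp: gain_cap_def)
      have nl: "1 \<le> n l" "0 \<le> m l" using nm(1) l(1) by auto
      have "0 < L * (n l * sqrt (n l))" using nl L by simp
      then have "a l < 2 * m l + L * (n l * sqrt (n l))" using l(2) nl by (simp add: divide_less_eq)
      also have "m l \<le> tail j"
        using nm(1,3) l(1) member_le_sum[of l "{0..<j}" m] by auto
      also have "n l * sqrt (n l) \<le> real T * sqrt (real T)"
      proof -
        have "n l \<le> (\<Sum>i\<in>{0..<j}. n i)" using nm(1) l(1) by (intro member_le_sum) (auto intro: order_trans[OF zero_le_one])
        then have "n l \<le> real T" using nm(2) by linarith
        then show ?thesis using nl by (intro mult_mono) auto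
      qed
      finally have "a l < 2 * tail j + L * (real T * sqrt (real T))" using L by simp
      also have "\<dots> \<le> 2 * (4 ^ i * \<Omega>) + 4 ^ i * \<Omega>"
      proof -
        have "1 * \<Omega> \<le> 4 ^ i * \<Omega>" using \<Omega>0 by (intro mult_right_mono) auto
        then show ?thesis using IH TT by linarith
      qed
      finally have "a l \<le> 3 * (4 ^ i * \<Omega>)" by linarith
      moreover have "a (j - 1) \<le> a l" using l(1) j by (intro a_anti) auto
      moreover have "tail (j - 1) = a (j - 1) + tail j" using tail_split[of "j - 1" j] j by (cases j) auto
      ultimately show ?case using IH j(3) by simp
    qed (use tk in simp)
    from this[of k] have "tail 0 \<le> X" using \<Omega>X[of k] False by simp
    then show False using no_head[of 0] by auto
  qed
qed

context bounded_gain
begin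

section \<open>Chains through the atoms\<close>

text \<open>
  For steps of at least this size, the window that consists of the step alone gains the cap when it coasts.
\<close>

definition atoms :: "nat set" where "atoms = {u \<in> {1..T}. 8 * gain_cap \<le> e u}"

text \<open>
  mass_cap bounds the weight of everything between two consecutive atoms of a chain, and gap the loss in
  travel across a window of such weight. Reaching a step of size 1 / T costs T * gap, and leaving the
  pumped velocity again costs gap; pump_factor makes up for both.
\<close>

definition mass_cap :: real where "mass_cap = U + 16 * gain_cap * (real T)\<^sup>2"

definition gap :: real where "gap = 2 * mass_cap + 8 * real T"

definition pump_factor :: real where "pump_factor = 2 * real T * gap\<^sup>2"

definition slow_rate :: real where
  "slow_rate = (2 + 144 * (22 * (8 * gain_cap) + 2100000)) * (ln (6 * real T) + ln pump_factor) ^ 3"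

definition window_rate :: real where "window_rate = 4 * slow_rate + 8"

lemma gap_ge: "2 \<le> gap" "8 * real T \<le> gap" "2 * mass_cap \<le> gap" "0 \<le> mass_cap"
proof -
  have "0 \<le> 16 * gain_cap * (real T)\<^sup>2" by (simp add: gain_cap_def)
  then have "1 \<le> mass_cap" using U1 by (simp add: mass_cap_def)
  then show "2 \<le> gap" "8 * real T \<le> gap" "2 * mass_cap \<le> gap" "0 \<le> mass_cap" by (auto simp: gap_def)
qed

lemma pump_factor_ge_1: "1 \<le> pump_factor"
proof -
  have "1 * 1 \<le> (2 * real T) * gap\<^sup>2" using T2 gap_ge by (intro mult_mono) auto
  then show ?thesis by (simp add: pump_factor_def)
qed

lemma slow_rate_nonneg: "0 \<le> slow_rate"
proof -
  have "0 \<le> ln (6 * real T) + ln pump_factor" using T2 pump_factor_ge_1 by (intro add_nonneg_nonneg) auto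
  then show ?thesis by (simp add: slow_rate_def gain_cap_def)
qed

lemma travel_edge_gap:
  assumes "p < q" "q \<le> T" "(\<Sum>u\<in>{p<..<q}. s u) \<le> mass_cap"
  shows "travel p * s q \<le> travel q * gap"
proof -
  have "resp p H \<le> real (H - p)" by (rule resp_le)
  also have "\<dots> \<le> 2 * real T" using T2 by simp
  finally have "2 * (\<Sum>u\<in>{p<..<q}. s u) + 4 * resp p H \<le> gap" using assms(3) by (simp add: gap_def)
  then have "travel q * (2 * (\<Sum>u\<in>{p<..<q}. s u) + 4 * resp p H) \<le> travel q * gap"
    using travel_nonneg by (intro mult_left_mono)
  then show ?thesis using travel_edge[OF assms(1,2)] by linarith
qed

text \<open>
  Either slow_mass applies, or at some z the velocity exceeds what is left of that at an earlier u by the factor pump_factor. In the latter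
  case a detour over u and z gains a factor gap.
\<close>

lemma slow_or_pump:
  assumes pq: "p < q" "q \<le> H" and N0: "0 < travel p" and mass: "(\<Sum>u\<in>{p<..<q}. s u) \<le> mass_cap"
  shows "(\<Sum>u\<in>{u \<in> {p<..<q}. e u < 8 * gain_cap}. e u * resp u q) \<le> slow_rate * (real (q - p) * sqrt (real (q - p)))
    \<or> (\<exists>z. p < z \<and> z < q \<and> 3 / 2 * gap * travel p \<le> travel z)"
proof (cases "\<exists>u z. p < u \<and> 1 / real T \<le> e u \<and> u \<le> z \<and> z < q \<and> 3 / 4 * resp u H \<le> damp u z * resp z H
    \<and> pump_factor * speed u * damp u z < speed z")
  case True
  then obtain u z where uz: "p < u" "1 / real T \<le> e u" "u \<le> z" "z < q"
    and far: "3 / 4 * resp u H \<le> damp u z * resp z H" and pump: "pump_factor * speed u * damp u z < speed z" by blast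
  have T0: "0 < real T" using T2 by simp
  have sub: "(\<Sum>v\<in>{p<..<u}. s v) \<le> mass_cap"
  proof (rule order_trans[OF sum_mono2 mass])
    show "{p<..<u} \<subseteq> {p<..<q}" using uz by auto
  qed (auto simp: s_nonneg)
  have "1 / real T * 1 \<le> e u * resp u H" using uz pq T0 e_nonneg by (intro mult_mono resp_ge_1) auto
  then have "travel p * (1 / real T) \<le> travel p * s u" using N0 by (intro mult_left_mono) (auto simp: s_def)
  also have "\<dots> \<le> travel u * gap" using uz pq sub by (intro travel_edge_gap) auto
  finally have "travel p \<le> real T * gap * travel u" using T0 by (simp add: field_simps)
  then have "3 / 2 * gap * travel p \<le> 3 / 2 * gap * (real T * gap * travel u)" using gap_ge by (intro mult_left_mono) auto
  also have "\<dots> = (pump_factor * speed u) * (3 / 4 * resp u H)" by (simp add: pump_factor_def travel_def power2_eq_square)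
  also have "\<dots> \<le> (pump_factor * speed u) * (damp u z * resp z H)"
    using far pump_factor_ge_1 speed_nonneg by (intro mult_left_mono) auto
  also have "\<dots> = (pump_factor * speed u * damp u z) * resp z H" by simp
  also have "\<dots> \<le> speed z * resp z H" using pump resp_nonneg by (intro mult_right_mono) auto
  finally show ?thesis using uz by (auto simp: travel_def intro!: exI[of _ z])
next
  case False
  have "(\<Sum>u\<in>{u \<in> {p<..<q}. e u < 8 * gain_cap}. e u * resp u q) \<le> slow_rate * (real (q - p) * sqrt (real (q - p)))"
    unfolding slow_rate_def
  proof (rule slow_mass[OF pq _ pump_factor_ge_1])
    show "1 \<le> 8 * gain_cap" by (simp add: gain_cap_def)
    fix u assume u: "p < u" "1 / real T \<le> e u"
    {
      assume "u < q"
      have "(\<Sum>v\<in>{p<..<u}. s v) \<le> mass_cap"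
      proof (rule order_trans[OF sum_mono2 mass])
        show "{p<..<u} \<subseteq> {p<..<q}" using \<open>u < q\<close> by auto
      qed (auto simp: s_nonneg)
      then have "travel p * s u \<le> travel u * gap" using u \<open>u < q\<close> pq by (intro travel_edge_gap) auto
      moreover have "0 < travel p * s u"
      proof -
        have "0 < 1 / real T" using T2 by simp
        then have "0 < e u" using u by linarith
        moreover have "1 \<le> resp u H" using \<open>u < q\<close> pq by (intro resp_ge_1) auto
        ultimately show ?thesis using N0 by (simp add: s_def)
      qed
      ultimately have "0 < travel u * gap" by linarith
      then have "0 < travel u" using gap_ge by (simp add: zero_less_mult_iff)
      then show "0 < speed u" using speed_nonneg[of u] by (auto simp: travel_def zero_less_mult_iff)
    next
      fix z assume "u \<le> z" "z < q" "3 / 4 * resp u H \<le> damp u z * resp z H"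
      then show "speed z \<le> pump_factor * speed u * damp u z" using False u by (meson not_less)
    }
  qed
  then show ?thesis ..
qed

text \<open>
  If more than half of the way from p to the horizon is ahead at q, the gain is at least the step size at q over 8, hence the cap. Otherwise
  the bounded steps of the window weigh at most slow_rate * n powr (3/2), or there is a pump, after which even a
  whole gap is affordable.
\<close>

lemma window_gain:
  assumes pq: "p < q" "q \<in> atoms" and N0: "0 < travel p" and mass: "(\<Sum>u\<in>{p<..<q}. s u) \<le> mass_cap"
  defines "n \<equiv> real (q - p)"
  shows "travel p * step_gain window_rate (s q) (\<Sum>u\<in>{p<..<q} \<inter> atoms. s u) n \<le> travel q"
proof -
  let ?at = "\<Sum>u\<in>{p<..<q} \<inter> atoms. s u"
  let ?D = "2 * ?at + window_rate * (n * sqrt n)"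
  have q: "q \<le> T" "8 * gain_cap \<le> e q" using pq(2) by (auto simp: atoms_def)
  have n1: "1 \<le> n" "1 \<le> sqrt n" using pq(1) by (auto simp: n_def)
  have nn: "n \<le> n * sqrt n" using n1 by simp
  have wr: "8 \<le> window_rate" using slow_rate_nonneg by (simp add: window_rate_def)
  have at0: "0 \<le> ?at" by (intro sum_nonneg s_nonneg)
  have "1 * 1 \<le> window_rate * (n * sqrt n)" using wr n1 nn by (intro mult_mono) linarith+
  then have D1: "1 \<le> ?D" using at0 by linarith
  show ?thesis
  proof (cases "2 * resp p q < resp p H")
    case True
    have "travel p * (8 * gain_cap) \<le> travel p * e q" using q N0 by (intro mult_left_mono) auto
    also have "\<dots> \<le> 8 * travel q" using pq(1) q True by (intro travel_edge_coasting)
    finally have "travel p * gain_cap \<le> travel q" by simp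
    moreover have "travel p * min gain_cap (s q / ?D) \<le> travel p * gain_cap" using N0 by (intro mult_left_mono) auto
    ultimately show ?thesis by linarith
  next
    case False
    have qH: "q \<le> H" using q by simp
    have "travel p * s q \<le> travel q * ?D"
      using slow_or_pump[OF pq(1) qH N0 mass]
    proof
      let ?A = "{p<..<q}"
      assume slow: "(\<Sum>u\<in>{u \<in> ?A. e u < 8 * gain_cap}. e u * resp u q) \<le> slow_rate * (real (q - p) * sqrt (real (q - p)))"
      have "?A - atoms = {u \<in> ?A. e u < 8 * gain_cap}" using q by (auto simp: atoms_def)
      then have "2 * ?at + 4 * (\<Sum>u\<in>?A - atoms. e u * resp u q) + 8 * n \<le> ?D"
        using slow nn by (simp add: window_rate_def n_def[symmetric] algebra_simps)
      then have "travel q * (2 * ?at + 4 * (\<Sum>u\<in>?A - atoms. e u * resp u q) + 8 * n) \<le> travel q * ?D"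
        using travel_nonneg by (intro mult_left_mono)
      moreover have "travel p * s q \<le> travel q * (2 * ?at + 4 * (\<Sum>u\<in>?A - atoms. e u * resp u q) + 8 * n)"
        unfolding n_def using pq(1) q False by (intro travel_edge_damped) auto
      ultimately show ?thesis by linarith
    next
      assume "\<exists>z. p < z \<and> z < q \<and> 3 / 2 * gap * travel p \<le> travel z"
      then obtain z where z: "p < z" "z < q" "3 / 2 * gap * travel p \<le> travel z" by blast
      have "(\<Sum>v\<in>{z<..<q}. s v) \<le> mass_cap"
      proof (rule order_trans[OF sum_mono2 mass])
        show "{z<..<q} \<subseteq> {p<..<q}" using z by auto
      qed (auto simp: s_nonneg)
      then have "travel z * s q \<le> travel q * gap" using z q by (intro travel_edge_gap) auto
      moreover have "3 / 2 * gap * travel p * s q \<le> travel z * s q" using z s_nonneg by (intro mult_right_mono)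
      ultimately have "gap * (3 / 2 * (travel p * s q)) \<le> gap * travel q" by (simp add: algebra_simps)
      then have "3 / 2 * (travel p * s q) \<le> travel q" using gap_ge by (subst (asm) mult_le_cancel_left_pos) auto
      moreover have "0 \<le> travel p * s q" using N0 s_nonneg by simp
      moreover have "travel q * 1 \<le> travel q * ?D" using D1 travel_nonneg by (intro mult_left_mono)
      ultimately show ?thesis by linarith
    qed
    then have "travel p * (s q / ?D) \<le> travel q" using D1 by (simp add: field_simps)
    moreover have "travel p * min gain_cap (s q / ?D) \<le> travel p * (s q / ?D)" using N0 by (intro mult_left_mono) auto
    ultimately show ?thesis by linarith
  qed
qed


lemma mass_le_cap:
  assumes S: "S \<subseteq> {1..T}" and at: "(\<Sum>u\<in>S \<inter> atoms. s u) \<le> U"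
  shows "(\<Sum>u\<in>S. s u) \<le> mass_cap"
proof -
  have fin: "finite S" using S finite_subset by blast
  have "(\<Sum>u\<in>S - atoms. s u) \<le> (\<Sum>u\<in>S - atoms. 8 * gain_cap * (2 * real T))"
  proof (rule sum_mono)
    fix u assume u: "u \<in> S - atoms"
    have "resp u H \<le> real (H - u)" by (rule resp_le)
    also have "\<dots> \<le> 2 * real T" using T2 by simp
    finally have "resp u H \<le> 2 * real T" .
    moreover have "e u \<le> 8 * gain_cap" using u S by (auto simp: atoms_def)
    ultimately show "s u \<le> 8 * gain_cap * (2 * real T)"
      unfolding s_def using resp_nonneg e_nonneg by (intro mult_mono) (auto simp: gain_cap_def)
  qed
  also have "\<dots> = real (card (S - atoms)) * (16 * gain_cap * real T)" by simp
  also have "\<dots> \<le> real T * (16 * gain_cap * real T)"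
  proof (rule mult_right_mono)
    have "card (S - atoms) \<le> card {1..T}" using S by (intro card_mono) auto
    then show "real (card (S - atoms)) \<le> real T" by simp
  qed (simp add: gain_cap_def)
  finally have "(\<Sum>u\<in>S - atoms. s u) \<le> 16 * gain_cap * (real T)\<^sup>2" by (simp add: power2_eq_square mult_ac)
  moreover have "(\<Sum>u\<in>S. s u) = (\<Sum>u\<in>S \<inter> atoms. s u) + (\<Sum>u\<in>S - atoms. s u)"
    using fin by (simp add: sum.Int_Diff)
  ultimately show ?thesis using at by (simp add: mass_cap_def)
qed

text \<open>
  One window for each element of Q. The windows are disjoint, so that their lengths n and the weights m of the other
  atoms in them add up.
\<close>

lemma atoms_gain:
  assumes "finite Q" "Q \<subseteq> atoms" "(\<Sum>u\<in>atoms \<inter> {..Max (insert 0 Q)} - Q. s u) \<le> U"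
  shows "\<exists>n m. (\<forall>q\<in>Q. 1 \<le> n q \<and> 0 \<le> m q) \<and> (\<Sum>q\<in>Q. n q) = real (Max (insert 0 Q))
    \<and> (\<Sum>q\<in>Q. m q) \<le> (\<Sum>u\<in>atoms \<inter> {..Max (insert 0 Q)} - Q. s u) \<and> 0 < travel (Max (insert 0 Q))
    \<and> (\<Prod>q\<in>Q. step_gain window_rate (s q) (m q) (n q)) \<le> travel (Max (insert 0 Q))"
  using assms
proof (induction Q rule: finite_linorder_max_induct)
  case empty
  show ?case using travel_0 by (intro exI[of _ "\<lambda>_. 0"]) (auto intro: sum_nonneg s_nonneg)
next
  case (insert q Q)
  define p where "p = Max (insert 0 Q)"
  have p_in: "p \<in> insert 0 Q" unfolding p_def using insert(1) by (intro Max_in) auto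
  have qT: "q \<in> {1..T}" "8 * gain_cap \<le> e q" "q \<in> atoms" using insert.prems(1) by (auto simp: atoms_def)
  have pq: "p < q" using p_in insert(2) qT by auto
  have p_max: "u \<le> p" if "u \<in> Q" for u unfolding p_def using insert(1) that by auto
  have Mq: "Max (insert 0 (insert q Q)) = q"
    using insert(1,2) by (intro Max_eqI) (auto simp: less_imp_le)
  have qQ: "q \<notin> Q" using insert(2) by auto
  have fin: "finite atoms" by (simp add: atoms_def)
  let ?W = "{p<..<q} \<inter> atoms"
  have split: "atoms \<inter> {..q} - insert q Q = (atoms \<inter> {..p} - Q) \<union> ?W"
    using pq p_max qQ by (auto simp: not_le dest: p_max)
  have sum_split: "(\<Sum>u\<in>atoms \<inter> {..q} - insert q Q. s u) = (\<Sum>u\<in>atoms \<inter> {..p} - Q. s u) + (\<Sum>u\<in>?W. s u)"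
    unfolding split using fin by (intro sum.union_disjoint) auto
  have nonneg: "0 \<le> (\<Sum>u\<in>atoms \<inter> {..p} - Q. s u)" "0 \<le> (\<Sum>u\<in>?W. s u)" by (auto intro: sum_nonneg s_nonneg)
  have small: "(\<Sum>u\<in>atoms \<inter> {..p} - Q. s u) \<le> U" "(\<Sum>u\<in>?W. s u) \<le> U"
    using insert.prems(2) sum_split nonneg unfolding Mq by linarith+
  obtain n m where nm: "\<forall>q\<in>Q. 1 \<le> n q \<and> 0 \<le> m q" "(\<Sum>q\<in>Q. n q) = real p"
    "(\<Sum>q\<in>Q. m q) \<le> (\<Sum>u\<in>atoms \<inter> {..p} - Q. s u)" "0 < travel p"
    "(\<Prod>q\<in>Q. step_gain window_rate (s q) (m q) (n q)) \<le> travel p"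
    using insert.IH insert.prems(1) small(1) unfolding p_def[symmetric] by auto
  define n' where "n' = n(q := real (q - p))"
  define m' where "m' = m(q := (\<Sum>u\<in>?W. s u))"
  have mass: "(\<Sum>u\<in>{p<..<q}. s u) \<le> mass_cap" using small(2) qT by (intro mass_le_cap) auto
  let ?g = "\<lambda>n m q. step_gain window_rate (s q) (m q) (n q)"
  have step: "travel p * ?g n' m' q \<le> travel q"
    using window_gain[OF pq qT(3) nm(4) mass] by (simp add: n'_def m'_def)
  have "1 \<le> real (q - p)" using pq by simp
  have gpos: "0 < ?g n' m' q"
  proof -
    have "0 < e q" using qT by (simp add: gain_cap_def)
    moreover have "1 \<le> resp q H" using qT by (intro resp_ge_1) auto
    ultimately have "0 < s q" by (simp add: s_def)
    moreover have "0 < window_rate * (n' q * sqrt (n' q))"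
      using pq slow_rate_nonneg by (simp add: n'_def window_rate_def)
    moreover have "0 \<le> m' q" using nonneg by (simp add: m'_def)
    ultimately show ?thesis by (simp add: gain_cap_def)
  qed
  have old: "n' u = n u" "m' u = m u" if "u \<in> Q" for u using that qQ by (auto simp: n'_def m'_def)
  have eqs: "(\<Sum>u\<in>Q. n' u) = (\<Sum>u\<in>Q. n u)" "(\<Sum>u\<in>Q. m' u) = (\<Sum>u\<in>Q. m u)"
    "(\<Prod>u\<in>Q. ?g n' m' u) = (\<Prod>u\<in>Q. ?g n m u)"
    using old by (auto intro!: sum.cong prod.cong)
  show ?case
    unfolding Mq
  proof (intro exI conjI)
    show "\<forall>u\<in>insert q Q. 1 \<le> n' u \<and> 0 \<le> m' u" using nm(1) old pq nonneg by (auto simp: n'_def m'_def)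
    have "(\<Sum>u\<in>insert q Q. n' u) = n' q + (\<Sum>u\<in>Q. n u)" using insert(1) qQ eqs by simp
    then show "(\<Sum>u\<in>insert q Q. n' u) = real q" using nm(2) pq by (simp add: n'_def)
    have "(\<Sum>u\<in>insert q Q. m' u) = m' q + (\<Sum>u\<in>Q. m u)" using insert(1) qQ eqs by simp
    then show "(\<Sum>u\<in>insert q Q. m' u) \<le> (\<Sum>u\<in>atoms \<inter> {..q} - insert q Q. s u)"
      using nm(3) sum_split by (simp add: m'_def)
    have "0 < travel p * ?g n' m' q" using nm(4) gpos by (intro mult_pos_pos)
    then show "0 < travel q" using step by linarith
    have "(\<Prod>u\<in>insert q Q. ?g n' m' u) = ?g n' m' q * (\<Prod>u\<in>Q. ?g n m u)" using insert(1) qQ eqs by simp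
    also have "\<dots> \<le> ?g n' m' q * travel p" using nm(5) gpos by (intro mult_left_mono) auto
    finally show "(\<Prod>u\<in>insert q Q. ?g n' m' u) \<le> travel q" using step by (simp add: mult.commute)
  qed
qed

text \<open>
  A chain through Q with product at least 1 would have travel at least 1 at its last element p, whereas only U / 4
  of atoms and U / 4 of bounded steps lie behind p. So Q has product below 1 whenever the atoms outside Q weigh at most U / 4.
\<close>

lemma large_gain_contradiction:
  assumes big: "4 * head_cost * (window_rate * real T powr (8/5)) \<le> U"
  shows False
proof (rule no_atoms_without_gain)
  show "finite atoms" by (simp add: atoms_def)
  have "card atoms \<le> card {1..T}" by (intro card_mono) (auto simp: atoms_def)
  then show "card atoms \<le> T" by simp
  show T1: "1 \<le> T" using T2 by simp
  show wr: "1 \<le> window_rate" using slow_rate_nonneg by (simp add: window_rate_def)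
  show X: "head_cost * (window_rate * real T powr (8/5)) \<le> U / 4" using big by simp
  show "0 < s u" if "u \<in> atoms" for u
  proof -
    have "0 < e u" "1 \<le> resp u H" using that by (auto simp: atoms_def gain_cap_def intro!: resp_ge_1)
    then show ?thesis by (simp add: s_def)
  qed
  fix Q assume Q: "Q \<subseteq> atoms" and tail: "(\<Sum>u\<in>atoms - Q. s u) \<le> U / 4"
  have fin: "finite atoms" "finite Q" using Q by (auto simp: atoms_def intro: finite_subset)
  define p where "p = Max (insert 0 Q)"
  have "p \<in> insert 0 Q" unfolding p_def using fin by (intro Max_in) auto
  then have pT: "p \<le> T" using Q by (auto simp: atoms_def)
  have p_max: "u \<le> p" if "u \<in> Q" for u unfolding p_def using fin that by auto
  have sub: "(\<Sum>u\<in>atoms \<inter> {..p} - Q. s u) \<le> (\<Sum>u\<in>atoms - Q. s u)"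
    using fin by (intro sum_mono2) (auto simp: s_nonneg)
  then have "(\<Sum>u\<in>atoms \<inter> {..Max (insert 0 Q)} - Q. s u) \<le> U" using tail U1 unfolding p_def by linarith
  from atoms_gain[OF fin(2) Q this] obtain n m where nm: "\<forall>q\<in>Q. 1 \<le> n q \<and> 0 \<le> m q" "(\<Sum>q\<in>Q. n q) = real p"
    "(\<Sum>q\<in>Q. m q) \<le> (\<Sum>u\<in>atoms \<inter> {..p} - Q. s u)" "0 < travel p"
    "(\<Prod>q\<in>Q. step_gain window_rate (s q) (m q) (n q)) \<le> travel p"
    unfolding p_def by auto
  have "\<not> 1 \<le> travel p"
  proof
    assume N1: "1 \<le> travel p"
    let ?A = "{p<..<H}"
    have AT: "?A = {p<..T}" by auto
    have at: "(\<Sum>u\<in>?A \<inter> atoms. s u) \<le> U / 4"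
    proof (rule order_trans[OF sum_mono2 tail])
      show "?A \<inter> atoms \<subseteq> atoms - Q" by (auto dest: p_max)
    qed (use fin in \<open>auto simp: s_nonneg\<close>)
    have mass: "(\<Sum>u\<in>?A. s u) \<le> mass_cap" using at U1 pT by (intro mass_le_cap) auto
    have "p < H" using pT by simp
    from slow_or_pump[OF this order.refl nm(4) mass] show False
    proof
      assume slow: "(\<Sum>u\<in>{u \<in> ?A. e u < 8 * gain_cap}. e u * resp u H) \<le> slow_rate * (real (H - p) * sqrt (real (H - p)))"
      have T0: "1 \<le> real T" using T1 by simp
      have "real (H - p) * sqrt (real (H - p)) \<le> (2 * real T) * sqrt (4 * real T)"
        using T2 by (intro mult_mono real_sqrt_le_mono) auto
      also have "\<dots> = 4 * (real T * sqrt (real T))" by (simp add: real_sqrt_mult)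
      also have "real T * sqrt (real T) = real T powr (1 + 1/2)"
        using T1 powr_add[of "real T" 1 "1/2"] by (simp only: powr_half_sqrt) simp
      also have "\<dots> \<le> real T powr (8/5)" using T0 by (intro powr_mono) auto
      finally have "slow_rate * (real (H - p) * sqrt (real (H - p))) \<le> slow_rate * (4 * real T powr (8/5))"
        using slow_rate_nonneg by (intro mult_left_mono) auto
      also have "\<dots> \<le> window_rate * real T powr (8/5)" by (simp add: window_rate_def algebra_simps)
      also have "\<dots> \<le> U / 4"
      proof -
        have "1 * (window_rate * real T powr (8/5)) \<le> head_cost * (window_rate * real T powr (8/5))"
          using head_cost_ge[of 0] wr by (intro mult_right_mono) auto
        then show ?thesis using X by linarith
      qed
      finally have "slow_rate * (real (H - p) * sqrt (real (H - p))) \<le> U / 4" .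
      moreover have "?A - atoms = {u \<in> ?A. e u < 8 * gain_cap}" by (auto simp: atoms_def)
      ultimately have "(\<Sum>u\<in>?A - atoms. s u) \<le> U / 4" using slow by (simp add: s_def)
      moreover have "B p = (\<Sum>u\<in>?A \<inter> atoms. s u) + (\<Sum>u\<in>?A - atoms. s u)"
        unfolding B_def AT[symmetric] by (simp add: sum.Int_Diff[symmetric])
      ultimately have "B p \<le> U / 2" using at by simp
      moreover have "U * 1 \<le> U * (travel p)\<^sup>2" using U1 N1 by (intro mult_left_mono) auto
      ultimately have "U \<le> 2" using travel_bound[OF pT] by linarith
      moreover have "100000 * 1 \<le> head_cost * (window_rate * real T powr (8/5))"
      proof (rule mult_mono)
        have "1 * 1 \<le> window_rate * real T powr (8/5)" using wr T0 by (intro mult_mono ge_one_powr_ge_zero) auto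
        then show "1 \<le> window_rate * real T powr (8/5)" by simp
      qed (use head_cost_ge[of 0] in auto)
      ultimately show False using X by linarith
    next
      assume "\<exists>z. p < z \<and> z < H \<and> 3 / 2 * gap * travel p \<le> travel z"
      then obtain z where z: "p < z" "z < H" "3 / 2 * gap * travel p \<le> travel z" by blast
      have "3 / 2 * gap * 1 \<le> 3 / 2 * gap * travel p" using N1 gap_ge by (intro mult_left_mono) auto
      then have Nz: "gap \<le> travel z" using z gap_ge by linarith
      have "2 * gap \<le> gap * gap" using gap_ge by (intro mult_right_mono) auto
      also have "\<dots> \<le> travel z * travel z" using Nz gap_ge by (intro mult_mono) auto
      also have "\<dots> \<le> U * (travel z)\<^sup>2" using U1 mult_right_mono[of 1 U "(travel z)\<^sup>2"] by (simp add: power2_eq_square)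
      also have "\<dots> \<le> 1 + B z" using z by (intro travel_bound) auto
      also have "B z \<le> (\<Sum>u\<in>?A. s u)" unfolding B_def AT using z by (intro sum_mono2) (auto simp: s_nonneg)
      finally show False using mass gap_ge by linarith
    qed
  qed
  then have "(\<Prod>q\<in>Q. step_gain window_rate (s q) (m q) (n q)) < 1" using nm(5) by linarith
  then show "\<exists>n m. (\<forall>q\<in>Q. 1 \<le> n q \<and> 0 \<le> m q) \<and> (\<Sum>q\<in>Q. n q) \<le> real T \<and> (\<Sum>q\<in>Q. m q) \<le> (\<Sum>u\<in>atoms - Q. s u)
        \<and> (\<Prod>q\<in>Q. step_gain window_rate (s q) (m q) (n q)) < 1"
    using nm(1,2,3) sub pT by (intro exI[of _ n] exI[of _ m]) auto
qed

end

section \<open>The lower bound\<close>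

lemma ln_le_powr_over:
  fixes x r :: real
  assumes "1 \<le> x" "0 < r"
  shows "ln x \<le> x powr r / r"
proof -
  have "ln (x powr r) \<le> x powr r - 1" using assms by (intro ln_le_minus_one) simp
  then show ?thesis using assms by (simp add: ln_powr field_simps)
qed

lemma golden_ratio_bounds: "1618 / 1000 \<le> (1 + sqrt 5) / 2" "(1 + sqrt 5) / 2 \<le> 2"
proof -
  have "2236 / 1000 \<le> sqrt 5" by (rule real_le_rsqrt) (simp add: power2_eq_square)
  then show "1618 / 1000 \<le> (1 + sqrt 5) / 2" by simp
  have "sqrt 5 \<le> 3" by (rule real_le_lsqrt) auto
  then show "(1 + sqrt 5) / 2 \<le> 2" by simp
qed

text \<open>
  With U = A * T powr alpha * ln T all the logarithms involved are at most (K + 4 * ln A) * ln T. Hence the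
  requirement of large_gain_contradiction reads C * (K + 4 * ln A)^3 <= A, once
  ln T squared has been absorbed by T powr (18/1000), the excess of the golden ratio over 8/5. A sixth power A = r^6
  satisfies it because ln A <= 6 * r.
\<close>

lemma no_bounded_gain:
  "\<exists>A\<ge>1. \<forall>T e b. \<not> bounded_gain T e b (A * (real T powr ((1 + sqrt 5) / 2) * ln (real T)))"
proof -
  define C1 :: real where "C1 = 2 + 144 * (22 * (8 * gain_cap) + 2100000)"
  define C2 :: real where "C2 = 10 + 32 * gain_cap"
  define K where "K = 2 * ln (12 * C2\<^sup>2) + 16"
  define C where "C = 48 * head_cost * C1 * (1000 / 9)\<^sup>2"
  define r where "r = C * (K + 24)"
  define A where "A = r ^ 6"
  have C1: "1 \<le> C1" by (simp add: C1_def gain_cap_def)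
  have C2: "1 \<le> C2" by (simp add: C2_def gain_cap_def)
  have "1 * 1 \<le> 12 * C2\<^sup>2" using C2 by (intro mult_mono) auto
  then have K: "16 \<le> K" by (simp add: K_def)
  have hc: "1 \<le> head_cost" using head_cost_ge[of 0] by simp
  have C0: "1 \<le> C"
  proof -
    have "1 * 1 * 1 * 1 \<le> 48 * head_cost * C1 * (1000 / 9)\<^sup>2" using hc C1 by (intro mult_mono) (auto simp: power2_eq_square)
    then show ?thesis by (simp add: C_def)
  qed
  have "1 * 1 \<le> C * (K + 24)" using C0 K by (intro mult_mono) auto
  then have r1: "1 \<le> r" by (simp add: r_def)
  have A1: "1 \<le> A" using r1 by (simp add: A_def)
  have A_large: "C * (K + 4 * ln A) ^ 3 \<le> A"
  proof -
    have "ln r \<le> r" using ln_le_minus_one[of r] r1 by linarith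
    then have "ln A \<le> 6 * r" using r1 by (simp add: A_def ln_realpow)
    moreover have "K * 1 \<le> K * r" using K r1 by (intro mult_left_mono) auto
    ultimately have "K + 4 * ln A \<le> (K + 24) * r" by (simp add: algebra_simps)
    moreover have "0 \<le> ln A" using A1 by simp
    ultimately have "(K + 4 * ln A) ^ 3 \<le> ((K + 24) * r) ^ 3" using K by (intro power_mono) auto
    then have "C * (K + 4 * ln A) ^ 3 \<le> C * ((K + 24) * r) ^ 3" using C0 by (intro mult_left_mono) auto
    also have "\<dots> = C * ((K + 24) ^ 3 * r ^ 3)" by (simp add: power_mult_distrib)
    also have "\<dots> \<le> C ^ 3 * ((K + 24) ^ 3 * r ^ 3)"
      using C0 K r1 power_increasing[of 1 3 C] by (intro mult_right_mono) auto
    also have "\<dots> = r ^ 3 * r ^ 3" by (simp add: r_def power_mult_distrib)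
    also have "\<dots> = A" by (simp add: A_def flip: power_add)
    finally show ?thesis .
  qed
  have "\<not> bounded_gain T e b (A * (real T powr ((1 + sqrt 5) / 2) * ln (real T)))" for T e b
  proof
    define U where "U = A * (real T powr ((1 + sqrt 5) / 2) * ln (real T))"
    assume "bounded_gain T e b (A * (real T powr ((1 + sqrt 5) / 2) * ln (real T)))"
    then interpret bounded_gain T e b U by (simp add: U_def)
    define l where "l = ln (real T)"
    have T2': "2 \<le> real T" using T2 by simp
    have l_ge: "1 / 2 \<le> l"
    proof -
      have "ln 2 \<le> l" unfolding l_def using T2' by (intro ln_mono) auto
      then show ?thesis using ln2_ge_two_thirds by linarith
    qed
    have U_le: "U \<le> A * real T ^ 3"
    proof -
      have "real T powr ((1 + sqrt 5) / 2) \<le> real T powr 2" using T2' golden_ratio_bounds by (intro powr_mono) auto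
      moreover have "ln (real T) \<le> real T" using ln_le_minus_one[of "real T"] T2' by linarith
      ultimately have "real T powr ((1 + sqrt 5) / 2) * ln (real T) \<le> real T powr 2 * real T" using T2' by (intro mult_mono) auto
      also have "\<dots> = real T ^ 3" using T2' by (simp add: power2_eq_square power3_eq_cube)
      finally show ?thesis using A1 unfolding U_def by (intro mult_left_mono) auto
    qed
    have gap_le: "gap \<le> C2 * A * real T ^ 3"
    proof -
      have t: "(real T)\<^sup>2 \<le> real T ^ 3" "real T \<le> real T ^ 3" "0 \<le> real T ^ 3"
        using T2' power_increasing[of 2 3 "real T"] power_increasing[of 1 3 "real T"] by auto
      have "1 * real T ^ 3 \<le> A * real T ^ 3" using A1 t by (intro mult_right_mono) auto
      then have "(real T)\<^sup>2 \<le> A * real T ^ 3" "real T \<le> A * real T ^ 3" using t by linarith+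
      then show ?thesis using U_le by (simp add: gap_def mass_cap_def C2_def gain_cap_def algebra_simps)
    qed
    have lam_le: "ln (6 * real T) + ln pump_factor \<le> (K + 4 * ln A) * l"
    proof -
      have "gap\<^sup>2 \<le> (C2 * A * real T ^ 3)\<^sup>2" using gap_le gap_ge by (intro power_mono) auto
      then have "pump_factor \<le> 2 * real T * (C2 * A * real T ^ 3)\<^sup>2"
        unfolding pump_factor_def by (intro mult_left_mono) auto
      then have "6 * real T * pump_factor \<le> 6 * real T * (2 * real T * (C2 * A * real T ^ 3)\<^sup>2)"
        by (intro mult_left_mono) auto
      also have "\<dots> = (12 * C2\<^sup>2) * (A\<^sup>2 * real T ^ 8)" by (simp add: power_mult_distrib power2_eq_square eval_nat_numeral)
      finally have "ln (6 * real T * pump_factor) \<le> ln ((12 * C2\<^sup>2) * (A\<^sup>2 * real T ^ 8))"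
        using T2' pump_factor_ge_1 by (intro ln_mono) auto
      also have "\<dots> = ln (12 * C2\<^sup>2) + (2 * ln A + 8 * l)"
        using A1 C2 T2' by (simp add: ln_mult ln_realpow l_def)
      also have "ln (6 * real T * pump_factor) = ln (6 * real T) + ln pump_factor"
        using T2' pump_factor_ge_1 by (subst ln_mult) auto
      finally have a: "ln (6 * real T) + ln pump_factor \<le> (ln (12 * C2\<^sup>2) + 2 * ln A) + 8 * l" by simp
      have "0 \<le> ln (12 * C2\<^sup>2) + 2 * ln A" using K A1 \<open>1 * 1 \<le> 12 * C2\<^sup>2\<close> by (intro add_nonneg_nonneg) auto
      then have "(ln (12 * C2\<^sup>2) + 2 * ln A) * 1 \<le> (ln (12 * C2\<^sup>2) + 2 * ln A) * (2 * l)"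
        using l_ge by (intro mult_left_mono) auto
      with a have "ln (6 * real T) + ln pump_factor \<le> (ln (12 * C2\<^sup>2) + 2 * ln A) * (2 * l) + 8 * l" by simp
      also have "\<dots> \<le> (K + 4 * ln A) * l" using l_ge by (simp add: K_def algebra_simps)
      finally show ?thesis .
    qed
    define y where "y = (K + 4 * ln A) * l"
    have y1: "1 \<le> y"
    proof -
      have "0 \<le> ln A" using A1 by simp
      then have "16 \<le> K + 4 * ln A" using K by linarith
      then have "16 * (1 / 2) \<le> (K + 4 * ln A) * l" using l_ge by (intro mult_mono) auto
      then show ?thesis by (simp add: y_def)
    qed
    have "0 \<le> ln (6 * real T) + ln pump_factor" using T2' pump_factor_ge_1 by (intro add_nonneg_nonneg) auto
    then have "slow_rate \<le> C1 * y ^ 3"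
      unfolding slow_rate_def C1_def[symmetric] using lam_le C1 by (intro mult_left_mono power_mono) (auto simp: y_def)
    moreover have "1 * 1 \<le> C1 * y ^ 3" using C1 y1 by (intro mult_mono) auto
    ultimately have "window_rate \<le> 12 * (C1 * y ^ 3)" unfolding window_rate_def by linarith
    then have "4 * head_cost * (window_rate * real T powr (8/5)) \<le> 4 * head_cost * (12 * (C1 * y ^ 3) * real T powr (8/5))"
      using hc by (intro mult_left_mono mult_right_mono) auto
    also have "\<dots> = (48 * head_cost * C1 * (K + 4 * ln A) ^ 3 * l) * (l\<^sup>2 * real T powr (8/5))"
      by (simp add: y_def power_mult_distrib power2_eq_square power3_eq_cube)
    also have "\<dots> \<le> (48 * head_cost * C1 * (K + 4 * ln A) ^ 3 * l) * ((1000 / 9)\<^sup>2 * real T powr ((1 + sqrt 5) / 2))"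
    proof (rule mult_left_mono)
      have "l \<le> real T powr (9/1000) / (9/1000)" unfolding l_def using T2' by (intro ln_le_powr_over) auto
      then have "l\<^sup>2 \<le> (1000 / 9 * real T powr (9/1000))\<^sup>2" using l_ge by (intro power_mono) auto
      also have "\<dots> = (1000 / 9)\<^sup>2 * real T powr (18/1000)"
        by (simp add: power_mult_distrib power2_eq_square powr_add[symmetric])
      finally have "l\<^sup>2 * real T powr (8/5) \<le> (1000 / 9)\<^sup>2 * real T powr (18/1000) * real T powr (8/5)"
        by (intro mult_right_mono) auto
      also have "\<dots> = (1000 / 9)\<^sup>2 * real T powr (1618/1000)" by (simp add: mult.assoc powr_add[symmetric])
      also have "\<dots> \<le> (1000 / 9)\<^sup>2 * real T powr ((1 + sqrt 5) / 2)"
        using T2' golden_ratio_bounds by (intro mult_left_mono powr_mono) auto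
      finally show "l\<^sup>2 * real T powr (8/5) \<le> (1000 / 9)\<^sup>2 * real T powr ((1 + sqrt 5) / 2)" .
      show "0 \<le> 48 * head_cost * C1 * (K + 4 * ln A) ^ 3 * l"
        using hc C1 K A1 l_ge by (intro mult_nonneg_nonneg zero_le_power add_nonneg_nonneg) auto
    qed
    also have "\<dots> = (C * (K + 4 * ln A) ^ 3) * (real T powr ((1 + sqrt 5) / 2) * l)" by (simp add: C_def)
    also have "\<dots> \<le> A * (real T powr ((1 + sqrt 5) / 2) * l)"
      using A_large l_ge by (intro mult_right_mono) auto
    finally have "4 * head_cost * (window_rate * real T powr (8/5)) \<le> U" by (simp add: U_def l_def)
    then show False by (rule large_gain_contradiction)
  qed
  then show ?thesis using A1 by blast
qed

theorem theorem2p1: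
  shows "\<exists>c::real. c > 0 \<and>
    (\<forall>(T::nat) (\<eta>::nat \<Rightarrow> real) (\<beta>::nat \<Rightarrow> real).
      T \<ge> 2 \<and> (\<forall>t<T. \<eta> t \<ge> 0) \<and> (\<forall>t<T. 0 \<le> \<beta> t \<and> \<beta> t < 1) \<longrightarrow>
      (\<exists>(d::nat) (f::(nat \<Rightarrow>\<^sub>0 real) \<Rightarrow> real) xstar x0.
        d \<le> T + 1 \<and>
        huber_chain_objective d f \<and>
        f differentiable_on euclid d \<and>
        convex_on (euclid d) f \<and>
        1-lipschitz_on (euclid d) (gradient d f) \<and>
        is_arg_min f (\<lambda>x. x \<in> euclid d) xstar \<and>
        x0 \<in> euclid d \<and>
        norm (x0 - xstar) \<le> 1 \<and>
        f (heavy_ball (gradient d f) \<eta> \<beta> x0 T) - f xstar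
          \<ge> c / (real T powr ((1 + sqrt 5) / 2) * ln (real T))))"
proof -
  obtain A :: real where A1: "1 \<le> A"
    and A: "\<And>T e b. \<not> bounded_gain T e b (A * (real T powr ((1 + sqrt 5) / 2) * ln (real T)))"
    using no_bounded_gain by blast
  show ?thesis
  proof (intro exI[of _ "1 / (16 * A)"] conjI allI impI)
    show "0 < 1 / (16 * A)" using A1 by simp
    fix T :: nat and \<eta> \<beta> :: "nat \<Rightarrow> real"
    assume *: "T \<ge> 2 \<and> (\<forall>t<T. \<eta> t \<ge> 0) \<and> (\<forall>t<T. 0 \<le> \<beta> t \<and> \<beta> t < 1)"
    define e where "e u = (if u = 0 then 1 else if u \<le> T then \<eta> (u - 1) else 0)" for u
    \<comment> \<open>the first momentum term is a multiple of x_0 - x_(-1) = 0, hence b 1 = 0\<close>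
    define b where "b u = (if 2 \<le> u \<and> u \<le> T then \<beta> (u - 1) else 0)" for u
    interpret schedule T e b
    proof
      show "2 \<le> T" using * by simp
      show "0 \<le> e u" for u using * by (auto simp: e_def)
      show "0 \<le> b u" "b u < 1" for u using * by (auto simp: b_def)
      show "e 0 = 1" "b (Suc 0) = 0" by (auto simp: e_def b_def)
    qed
    define F where "F = real T powr ((1 + sqrt 5) / 2) * ln (real T)"
    have F1: "1 \<le> F"
    proof -
      have "real T powr 1 \<le> real T powr ((1 + sqrt 5) / 2)" using T2 golden_ratio_bounds by (intro powr_mono) auto
      then have "2 \<le> real T powr ((1 + sqrt 5) / 2)" using T2 by simp
      moreover have "ln 2 \<le> ln (real T)" using T2 by (intro ln_mono) auto
      then have "2 / 3 \<le> ln (real T)" using ln2_ge_two_thirds by linarith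
      ultimately have "2 * (2 / 3) \<le> F" unfolding F_def by (intro mult_mono) auto
      then show ?thesis by simp
    qed
    have AF: "1 \<le> A * F" using mult_mono[OF A1 F1] A1 by simp
    obtain q M where r: "reach q M" and gain: "1 + B q < A * F * (M * resp q H)\<^sup>2"
    proof (rule ccontr)
      assume "\<not> thesis"
      then have "\<And>q M. reach q M \<Longrightarrow> A * F * (M * resp q H)\<^sup>2 \<le> 1 + B q" using that by (meson not_less)
      then have "bounded_gain T e b (A * F)" using AF schedule_axioms
        by (simp add: bounded_gain_def bounded_gain_axioms_def)
      then show False using A by (simp add: F_def)
    qed
    have "1 / (16 * A) / F \<le> (M * resp q H)\<^sup>2 / (16 * (1 + B q))"
    proof -
      have "0 < 1 + B q" using B_nonneg[of q] by linarith
      then show ?thesis using gain A1 F1 by (simp add: field_simps)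
    qed
    moreover have "\<exists>d f xstar x0. d \<le> T + 1 \<and> huber_chain_objective d f \<and> f differentiable_on euclid d \<and>
      convex_on (euclid d) f \<and> 1-lipschitz_on (euclid d) (gradient d f) \<and>
      is_arg_min f (\<lambda>x. x \<in> euclid d) xstar \<and> x0 \<in> euclid d \<and> norm (x0 - xstar) \<le> 1 \<and>
      (M * resp q H)\<^sup>2 / (16 * (1 + B q)) \<le> f (heavy_ball (gradient d f) \<eta> \<beta> x0 T) - f xstar"
      using r by (rule reach_lower_bound) (auto simp: e_def b_def)
    ultimately show "\<exists>d f xstar x0. d \<le> T + 1 \<and> huber_chain_objective d f \<and> f differentiable_on euclid d \<and>
      convex_on (euclid d) f \<and> 1-lipschitz_on (euclid d) (gradient d f) \<and>
      is_arg_min f (\<lambda>x. x \<in> euclid d) xstar \<and> x0 \<in> euclid d \<and> norm (x0 - xstar) \<le> 1 \<and>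
      1 / (16 * A) / (real T powr ((1 + sqrt 5) / 2) * ln (real T))
        \<le> f (heavy_ball (gradient d f) \<eta> \<beta> x0 T) - f xstar"
      unfolding F_def by (meson order_trans)
  qed
qed

end
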